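(* Let $(A_1,B_1),(A_2,B_2)\in \mathrm{Sym}^2(\mathbb{Q}^3)^*\otimes_{\mathbb Q}\mathbb{Q}^2$ satisfy, for both $i=1,2$, (a) $A_i$ and $B_i$ are linearly independent over $\mathbb{Q}$, (b) $cA_i+dB_i$ is positive-definite for some $c,d\in\mathbb{Q}$, and (c) $q_{\mathbb Z}(A_1,B_1)=q_{\mathbb Z}(A_2,B_2)$. Suppose that $\det(A_ix-B_iy)=0$ has a multiple root for at least one of $i=1,2$. Then either $(A_1,B_1)=(w,1)\cdot(A_2,B_2)$ for some $w\in GL_3(\mathbb{Z})$, or there are $w_1,w_2\in GL_3(\mathbb{Z})$ and $v\in GL_2(\mathbb{Q})$ such that the set $\{(A_1,B_1),(A_2,B_2)\}$ equals one of (i) $\{(w_1,v)\cdot(x_1^2-x_1x_2+x_2^2,\ x_3^2),\ (w_2,v)\cdot(x_1^2+3x_2^2,\ x_3^2)\}$, (ii) $\{(w_1,v)\cdot(x_1^2-x_1x_2+x_2^2,\ (x_1+x_2+3x_3)^2),\ (w_2,v)\cdot(x_1^2+3x_2^2,\ (x_1+3x_3)^2)\}$.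
   Context: $\mathrm{Sym}^2(\mathbb{Q}^3)^*$ is the set of ternary quadratic forms over $\mathbb{Q}$; $\mathrm{Sym}^2(\mathbb{Q}^3)^*\otimes_{\mathbb Q}\mathbb{Q}^2$ is the set of pairs $(A,B)$ of such forms. A form $\sum_{i\le j}s_{ij}x_ix_j$ is identified with the symmetric matrix with diagonal entries $s_{ii}$ and off-diagonal entries $s_{ij}/2$. $q_{\mathbb Z}(A,B)=\{(A(v),B(v)):0\ne v\in\mathbb{Z}^3\}$. Roots of the binary cubic form $\det(A_ix-B_iy)$ are taken as points $[x:y]$ of the projective line over $\overline{\mathbb{Q}}$. The group $GL_3(\mathbb{Q})\times GL_2(\mathbb{Q})$ acts on pairs by $$\left(w,\begin{pmatrix} r&s\\t&u\end{pmatrix}\right)\cdot(A,B)=(rA(\mathbf{x}w)+sB(\mathbf{x}w),\ tA(\mathbf{x}w)+uB(\mathbf{x}w)),$$ with $\mathbf{x}$ a row vector. *)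

theory Defs
  imports "HOL-Analysis.Analysis" "HOL-Algebra.Algebraic_Closure_Type"
begin

(* A ternary quadratic form sum_{i <= j} s_ij x_i x_j over the rationals is identified with the
   symmetric matrix with diagonal entries s_ii and off-diagonal entries s_ij / 2. *)

definition tern_forms :: "(rat^3^3) set" where
  "tern_forms = {A. transpose A = A}"

definition form_eval :: "'a::comm_ring_1^3^3 \<Rightarrow> 'a^3 \<Rightarrow> 'a" where
  "form_eval A x = (\<Sum>i\<in>UNIV. \<Sum>j\<in>UNIV. A $ i $ j * x $ i * x $ j)"

definition tern_form :: "rat \<Rightarrow> rat \<Rightarrow> rat \<Rightarrow> rat \<Rightarrow> rat \<Rightarrow> rat \<Rightarrow> rat^3^3" where
  "tern_form s11 s22 s33 s12 s13 s23 =
     vector [vector [s11, s12/2, s13/2], vector [s12/2, s22, s23/2], vector [s13/2, s23/2, s33]]"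

lemma form_eval_tern_form:
  "form_eval (tern_form s11 s22 s33 s12 s13 s23) x =
     s11 * (x$1)^2 + s22 * (x$2)^2 + s33 * (x$3)^2
     + s12 * x$1 * x$2 + s13 * x$1 * x$3 + s23 * x$2 * x$3"
  by (simp add: form_eval_def tern_form_def sum_3 power2_eq_square algebra_simps)

(* the square of the linear form with coefficient vector l *)
definition lin_square :: "rat^3 \<Rightarrow> rat^3^3" where
  "lin_square l = (\<chi> i j. l $ i * l $ j)"

lemma form_eval_lin_square: "form_eval (lin_square l) x = (\<Sum>i\<in>UNIV. l $ i * x $ i)^2"
  by (simp add: form_eval_def lin_square_def power2_eq_square sum_product ac_simps)

definition mat_scale :: "'a::times \<Rightarrow> 'a^'n^'m \<Rightarrow> 'a^'n^'m" where
  "mat_scale c A = map_matrix (\<lambda>a. c * a) A"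

definition lin_indep_pair :: "rat^3^3 \<Rightarrow> rat^3^3 \<Rightarrow> bool" where
  "lin_indep_pair A B \<longleftrightarrow> (\<forall>c d. mat_scale c A + mat_scale d B = 0 \<longrightarrow> c = 0 \<and> d = 0)"

definition pos_def :: "rat^3^3 \<Rightarrow> bool" where
  "pos_def A \<longleftrightarrow> (\<forall>x. x \<noteq> 0 \<longrightarrow> form_eval A x > 0)"

definition qZ :: "(rat^3^3) \<times> (rat^3^3) \<Rightarrow> (rat \<times> rat) set" where
  "qZ P = {(form_eval (fst P) (\<chi> i. of_int (v $ i)), form_eval (snd P) (\<chi> i. of_int (v $ i))) |
            v :: int^3. v \<noteq> 0}"

(* the form x |-> A(xw), for a row vector x *)
definition subst_form :: "'a::comm_ring_1^3^3 \<Rightarrow> 'a^3^3 \<Rightarrow> 'a^3^3" where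
  "subst_form w A = w ** A ** transpose w"

lemma form_eval_subst_form: "form_eval (subst_form w A) x = form_eval A (x v* w)"
  by (simp add: form_eval_def subst_form_def matrix_matrix_mult_def vector_matrix_mult_def
      transpose_def sum_3 algebra_simps)

definition pair_act ::
    "rat^3^3 \<Rightarrow> rat^2^2 \<Rightarrow> (rat^3^3) \<times> (rat^3^3) \<Rightarrow> (rat^3^3) \<times> (rat^3^3)" where
  "pair_act w g P =
     (let A = subst_form w (fst P); B = subst_form w (snd P)
      in (mat_scale (g$1$1) A + mat_scale (g$1$2) B, mat_scale (g$2$1) A + mat_scale (g$2$2) B))"

(* GL_3(Z) as a set of rational matrices; invertibility is over the integers *)
definition GL3Z :: "(rat^3^3) set" where
  "GL3Z = {map_matrix of_int w | w :: int^3^3. invertible w}"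

definition GL2Q :: "(rat^2^2) set" where
  "GL2Q = {g. invertible g}"

(* det(Ax - By) as a function on the algebraic closure of the rationals; since that field is
   infinite, identities between such functions are identities between binary cubic forms. *)
definition det_cubic ::
    "(rat^3^3) \<times> (rat^3^3) \<Rightarrow> rat alg_closure \<Rightarrow> rat alg_closure \<Rightarrow> rat alg_closure" where
  "det_cubic P x y =
     det (mat_scale x (map_matrix to_ac (fst P)) - mat_scale y (map_matrix to_ac (snd P)))"

(* [a : b] is a root of multiplicity at least 2 of the binary cubic form F: the square of the
   linear form b x - a y vanishing at [a : b] divides F, the cofactor being linear. *)
definition multiple_root_at :: "('a::field \<Rightarrow> 'a \<Rightarrow> 'a) \<Rightarrow> 'a \<Rightarrow> 'a \<Rightarrow> bool" where
  "multiple_root_at F a b \<longleftrightarrow>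
     (a, b) \<noteq> (0, 0) \<and> (\<exists>l m. \<forall>x y. F x y = (b * x - a * y)^2 * (l * x + m * y))"

definition has_multiple_root :: "('a::field \<Rightarrow> 'a \<Rightarrow> 'a) \<Rightarrow> bool" where
  "has_multiple_root F \<longleftrightarrow> (\<exists>a b. multiple_root_at F a b)"

end

theory Submission
  imports Defs
begin

text \<open>
  A multiple root of \<open>det (A x - B y)\<close> is rational, and because the pencil of \<open>A\<close> and \<open>B\<close> contains a
  definite form, the matrix of the pencil at a double root has rank one. The pencil therefore contains
  the square of an integral linear form \<open>l\<close>. Subtracting from the definite form the largest
  admissible multiple of \<open>l\<^sup>2\<close> leaves a semidefinite form with a rational zero. Thus a change of basis
  of the pencil turns the first pair into \<open>(A', l\<^sup>2)\<close>, where \<open>A'\<close> is non-negative, has a nontrivial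
  integral zero, and has no nontrivial zero in common with \<open>l\<close> (\<open>multiple_root_reduction\<close>).

  All of this is visible in the set of values. A form whose values at integral vectors are squares
  of integers is the square of an integral linear form (\<open>square_valued_form\<close>), so the same change of
  basis brings the second pair to the same shape. Taking the zero of \<open>A'\<close> along the third coordinate
  axis and reducing the remaining binary form, both pairs become
  \<open>(a (x\<^sup>2 - \<alpha> x y + c y\<^sup>2), (p x + q y + N z)\<^sup>2)\<close> with \<open>0 \<le> \<alpha> \<le> 1 \<le> c\<close> and \<open>N > 0\<close>
  (\<open>normal_form\<close>). The values determine \<open>a\<close> and \<open>N\<close>, and the third variable only moves the linear
  form within its residue class modulo \<open>N\<close>. What remains is a problem in the plane: for each value
  \<open>v\<close> of the binary form one knows which residues \<open>p x + q y\<close> modulo \<open>N\<close> occur at vectors of value \<open>v\<close>.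

  Without the residues, this says that two reduced binary forms with minimum \<open>1\<close> have the same values.
  Such forms agree, except that \<open>x\<^sup>2 - x y + y\<^sup>2\<close> and \<open>x\<^sup>2 + 3 y\<^sup>2\<close> share their values. The proof
  compares the least value that is not a square and the few values after it (\<open>same_values\<close>).

  If the two binary forms agree, then so do, up to sign, the residues at the short vectors \<open>(1,0)\<close>,
  \<open>(0,1)\<close> and \<open>(1,1)\<close>. Any two of these vectors form a basis, so the three signs can be chosen
  equal (\<open>cong_pm_common_sign\<close>), and an automorphism of the binary form carries one
  residue functional to the other (\<open>linked_if_same_attains\<close>). When the form has many automorphisms,
  several shortest vectors compete for a residue and a few longer vectors have to be consulted. A linked
  pair of functionals gives an integral equivalence of the ternary pairs.

  In the exceptional case the six shortest vectors of \<open>x\<^sup>2 - x y + y\<^sup>2\<close> all have the residue of the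
  two shortest vectors of \<open>x\<^sup>2 + 3 y\<^sup>2\<close>, up to sign. This forces \<open>p = q\<close> and \<open>3 p = 0\<close> modulo \<open>N\<close>
  (\<open>residues_exceptional\<close>). Either \<open>p\<close> vanishes modulo \<open>N\<close>, which is family (i), or it has order
  three, which is family (ii).
\<close>

(* The dollar sign stands for the entries of vectors and matrices. Reading it as the coefficient of a
   power series too makes nested indices ambiguous. *)
no_notation fps_nth (infixl \<open>$\<close> 75)

section \<open>Values of reduced binary forms\<close>

text \<open>
  The reduced forms of minimum \<open>1\<close> are those with \<open>0 \<le> \<alpha> \<le> 1 \<le> c\<close>. The minus sign makes \<open>(1,0)\<close>, \<open>(0,1)\<close>
  and \<open>(1,1)\<close> the short vectors, with values \<open>1\<close>, \<open>c\<close> and \<open>c + 1 - \<alpha>\<close>.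
\<close>
definition binform :: "rat \<Rightarrow> rat \<Rightarrow> int \<Rightarrow> int \<Rightarrow> rat" where
  "binform \<alpha> c x y = of_int x ^ 2 - \<alpha> * of_int x * of_int y + c * of_int y ^ 2"

lemma binform_uminus: "binform \<alpha> c (-x) (-y) = binform \<alpha> c x y"
  by (simp add: binform_def)

definition binvalue :: "rat \<Rightarrow> rat \<Rightarrow> rat \<Rightarrow> bool" where
  "binvalue \<alpha> c v \<longleftrightarrow> (\<exists>x y. binform \<alpha> c x y = v)"

lemma binvalueI: "binform \<alpha> c x y = v \<Longrightarrow> binvalue \<alpha> c v"
  by (auto simp: binvalue_def)

text \<open>
  Completing the square gives \<open>(x - \<alpha> y / 2)\<^sup>2 + (c - \<alpha>\<^sup>2 / 4) y\<^sup>2\<close>, and \<open>y\<^sup>2 \<ge> 4\<close> here. All short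
  vectors therefore lie on the lines \<open>y = 0\<close> and \<open>y = \<plusminus>1\<close>.
\<close>
lemma binform_ge:
  assumes "0 \<le> \<alpha>" "\<alpha> \<le> 1" "1 \<le> c" "y \<noteq> 0" "y \<noteq> 1" "y \<noteq> -1"
  shows "binform \<alpha> c x y \<ge> 4 * c - \<alpha>"
proof -
  have y: "2 \<le> \<bar>y\<bar>" using assms by linarith
  have "2^2 \<le> \<bar>y\<bar>^2" using y by (intro power_mono) auto
  hence "of_int 4 \<le> (of_int (y^2) :: rat)" by (simp only: of_int_le_iff) simp
  hence y4: "(4::rat) \<le> of_int y ^ 2" by simp
  have a2: "\<alpha>^2 \<le> \<alpha>" using assms by (simp add: power2_eq_square mult_left_le)
  have "binform \<alpha> c x y = (of_int x - \<alpha> * of_int y / 2)^2 + (c - \<alpha>^2/4) * of_int y ^ 2"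
    by (simp add: binform_def power2_eq_square field_simps)
  hence "binform \<alpha> c x y \<ge> (c - \<alpha>^2/4) * of_int y ^ 2" by simp
  moreover have "(c - \<alpha>^2/4) * of_int y ^ 2 \<ge> (c - \<alpha>^2/4) * 4"
    using y4 a2 assms by (intro mult_left_mono) linarith+
  moreover have "(c - \<alpha>^2/4) * 4 = 4 * c - \<alpha>^2" by (simp add: algebra_simps)
  ultimately show ?thesis using a2 by linarith
qed

lemma binform_unit:
  "y = 1 \<or> y = -1 \<Longrightarrow> binform \<alpha> c x y = c + of_int (x*y)^2 - \<alpha> * of_int (x*y)"
  by (auto simp: binform_def)

lemma binform_zero [simp]: "binform \<alpha> c x 0 = of_int x ^ 2"
  by (simp add: binform_def)

lemma binvalue_cases:
  assumes "0 \<le> \<alpha>" "\<alpha> \<le> 1" "1 \<le> c" "binvalue \<alpha> c v"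
  obtains (square) k where "k \<ge> 0" "v = of_int k ^ 2"
    | (unit) j where "v = c + of_int j ^ 2 - \<alpha> * of_int j"
    | (large) "v \<ge> 4 * c - \<alpha>"
proof -
  obtain x y where xy: "binform \<alpha> c x y = v" using assms(4) by (auto simp: binvalue_def)
  show ?thesis
  proof (cases "y = 0")
    case True
    have "v = of_int \<bar>x\<bar> ^ 2" using xy True by simp
    thus ?thesis using square[of "\<bar>x\<bar>"] by simp
  next
    case False
    show ?thesis
      using large unit xy binform_unit binform_ge[OF assms(1-3) False] by metis
  qed
qed

lemma unit_cases:
  fixes \<alpha> c :: rat
  assumes "0 \<le> \<alpha>" "\<alpha> \<le> 1" 
  defines "f \<equiv> \<lambda>j::int. c + of_int j ^ 2 - \<alpha> * of_int j"
  shows "j = 0 \<or> j = 1 \<or> j = -1 \<or> f j \<ge> c + 4 - 2 * \<alpha>"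
proof -
  consider "j = 0" | "j = 1" | "j = -1" | "j \<ge> 2" | "j \<le> -2" by linarith
  thus ?thesis
  proof cases
    case 4
    hence "of_int 2 \<le> (of_int j :: rat)" by (simp only: of_int_le_iff)
    hence "(of_int j - 2) * (of_int j + 2 - \<alpha>) \<ge> (0::rat)"
      using assms(1,2) by (intro mult_nonneg_nonneg) simp_all
    thus ?thesis by (simp add: f_def power2_eq_square algebra_simps)
  next
    case 5
    hence "of_int j \<le> (of_int (-2) :: rat)" by (simp only: of_int_le_iff)
    hence "(- 2 - of_int j) * (2 + \<alpha> - of_int j) \<ge> (0::rat)"
      using assms(1,2) by (intro mult_nonneg_nonneg) simp_all
    moreover have "0 \<le> \<alpha> * 4" using assms by simp
    ultimately show ?thesis by (simp add: f_def power2_eq_square algebra_simps)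
  qed auto
qed

definition is_square :: "rat \<Rightarrow> bool" where "is_square v \<longleftrightarrow> (\<exists>k\<ge>0. v = of_int k ^ 2)"

text \<open>
  Apart from squares, the values near \<open>c\<close> are known, and they are listed in increasing order. Two
  forms are compared below by looking up the first values of one of them in the list of the other.
\<close>
lemma binvalue_small:
  assumes "0 \<le> \<alpha>" "\<alpha> \<le> 1" "1 \<le> c" "binvalue \<alpha> c v"
  shows "is_square v \<or> v = c \<or> v = c + 1 - \<alpha> \<or> v = c + 1 + \<alpha> \<or>
         v \<ge> c + 4 - 2 * \<alpha> \<or> v \<ge> 4 * c - \<alpha>"
  using assms
proof (cases rule: binvalue_cases)
  case (unit j)
  thus ?thesis using unit_cases[OF assms(1,2), of j c] by auto
qed (auto simp: is_square_def)

lemma binvalue_c: "binvalue \<alpha> c c" by (rule binvalueI[of _ _ 0 1]) (simp add: binform_def)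
lemma binvalue_d: "binvalue \<alpha> c (c + 1 - \<alpha>)" by (rule binvalueI[of _ _ 1 1]) (simp add: binform_def)
lemma binvalue_e: "binvalue \<alpha> c (c + 1 + \<alpha>)" by (rule binvalueI[of _ _ "-1" 1]) (simp add: binform_def)

lemma is_square_1: "is_square 1" and is_square_4: "is_square 4"
  unfolding is_square_def by (rule exI[of _ 1], simp) (rule exI[of _ 2], simp)

lemma square_gap:
  assumes "is_square v" "is_square w" "v < w"
  obtains k where "k \<ge> (0::int)" "v = of_int k ^ 2" "w \<ge> v + 2 * of_int k + 1"
proof -
  obtain k m where km: "k \<ge> 0" "m \<ge> 0" "v = of_int k ^ 2" "w = of_int m ^ 2"
    using assms by (auto simp: is_square_def)
  have "k < m" using km assms(3) by (metis of_int_less_iff of_int_power power_less_imp_less_base)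
  hence "(k+1)^2 \<le> m^2" using km by (intro power_mono) auto
  hence "of_int ((k+1)^2) \<le> (of_int (m^2) :: rat)" by (simp only: of_int_le_iff)
  hence "w \<ge> v + 2 * of_int k + 1" using km by (simp add: power2_eq_square algebra_simps)
  thus ?thesis using that km by blast
qed

text \<open>
  From \<open>1\<close> on, consecutive squares differ by at least \<open>3\<close>. The values next to \<open>c\<close> lie in an interval of
  length at most \<open>2\<close>, so at most one of them is a square.
\<close>
lemma is_square_gap3:
  assumes "is_square v" "is_square w" "v < w" "1 \<le> v"
  shows "w \<ge> v + 3"
proof -
  obtain k where k: "k \<ge> (0::int)" "v = of_int k ^ 2" "w \<ge> v + 2 * of_int k + 1"
    using square_gap assms by blast
  have "k \<ge> 1" using k assms(4) by (cases "k = 0") auto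
  hence "(of_int k :: rat) \<ge> 1" by simp
  thus ?thesis using k by linarith
qed

lemma is_square_gap5:
  assumes "is_square v" "is_square w" "v < w" "1 < v"
  shows "w \<ge> v + 5"
proof -
  obtain k where k: "k \<ge> (0::int)" "v = of_int k ^ 2" "w \<ge> v + 2 * of_int k + 1"
    using square_gap assms by blast
  have "k \<ge> 2" using k assms(4) by (cases "k = 0"; cases "k = 1") auto
  hence "(of_int k :: rat) \<ge> 2" by simp
  thus ?thesis using k by linarith
qed

lemma is_square_ge4:
  assumes "is_square v" "1 < v" shows "v \<ge> 4"
  using is_square_gap3[OF is_square_1] assms by fastforce

text \<open>
  If \<open>c\<close> is not a square, the values after \<open>c\<close> are \<open>c + 1 - \<alpha>\<close> and \<open>c + 1 + \<alpha>\<close>. The two candidates for the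
  middle coefficient differ there, and each discrepancy can only be explained by a square. The
  squares are too sparse for this.
\<close>
lemma middle_coefficient_determined:
  assumes 1: "0 \<le> \<alpha>" "\<alpha> < \<beta>" "\<beta> \<le> 1" "1 \<le> c" and nsq: "\<not> is_square c"
    and V: "\<And>v. binvalue \<alpha> c v \<longleftrightarrow> binvalue \<beta> c v"
  shows False
proof -
  have c1: "c > 1" using nsq 1 is_square_1 by (auto simp: order.order_iff_strict)
  note s1 = binvalue_small[of \<alpha> c] and s2 = binvalue_small[of \<beta> c]
  have d2: "is_square (c + 1 - \<beta>) \<or> \<beta> = 1"
    using s1[of "c + 1 - \<beta>"] V binvalue_d[of \<beta> c] 1 c1 by auto
  have d1: "is_square (c + 1 - \<alpha>)"
    using s2[of "c + 1 - \<alpha>"] V binvalue_d[of \<alpha> c] 1 c1 by auto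
  have "\<beta> = 1"
  proof (rule ccontr)
    assume "\<beta> \<noteq> 1"
    thus False using is_square_gap3[of "c+1-\<beta>" "c+1-\<alpha>"] d1 d2 1 by auto
  qed
  have e1: "is_square (c + 1 + \<alpha>)"
    using s2[of "c + 1 + \<alpha>"] V binvalue_e[of \<alpha> c] 1 c1 \<open>\<beta> = 1\<close> by auto
  have a0: "\<alpha> = 0" using is_square_gap3[OF d1 e1] 1 by fastforce
  have "binvalue \<alpha> c (c + 2)" using V binvalue_e[of \<beta> c] \<open>\<beta> = 1\<close> by (simp add: add.commute)
  hence "is_square (c + 2) \<or> c + 2 \<ge> 4 * c" using s1[of "c+2"] a0 1 by auto
  moreover have "c + 1 \<ge> 4" using is_square_ge4[of "c+1"] d1 a0 c1 by auto
  ultimately show False using is_square_gap3[of "c+1" "c+2"] d1 a0 c1 by auto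
qed

lemma same_values_nonsquare:
  assumes 1: "0 \<le> \<alpha>" "\<alpha> \<le> 1" "1 \<le> c" "\<not> is_square c"
    and 2: "0 \<le> \<beta>" "\<beta> \<le> 1" "1 \<le> d" "\<not> is_square d"
    and V: "\<And>v. binvalue \<alpha> c v \<longleftrightarrow> binvalue \<beta> d v"
  shows "\<alpha> = \<beta> \<and> c = d"
proof -
  have "d \<le> c" using binvalue_small[OF 2(1-3), of c] V[of c] binvalue_c[of \<alpha> c] 1 2 by auto
  moreover have "c \<le> d" using binvalue_small[OF 1(1-3), of d] V[of d] binvalue_c[of \<beta> d] 1 2 by auto
  ultimately have cd: "c = d" by simp
  moreover have "\<alpha> = \<beta>"
    using middle_coefficient_determined[of \<alpha> \<beta> c] middle_coefficient_determined[of \<beta> \<alpha> c] V 1 2 cd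
    by (metis linorder_neqE)
  ultimately show ?thesis by simp
qed

text \<open>
  The values on the axis \<open>y = 0\<close> are squares whatever the form is. The least value that is not a
  square is the first one that carries information.
\<close>
definition min_nonsquare :: "rat \<Rightarrow> rat \<Rightarrow> rat" where
  "min_nonsquare \<alpha> c = (if \<not> is_square c then c else if \<alpha> = 1 then c + 2 else c + 1 - \<alpha>)"

lemma min_nonsquare:
  assumes 1: "0 \<le> \<alpha>" "\<alpha> \<le> 1" "1 \<le> c"
  shows "binvalue \<alpha> c (min_nonsquare \<alpha> c)" "\<not> is_square (min_nonsquare \<alpha> c)"
    "\<And>v. binvalue \<alpha> c v \<Longrightarrow> \<not> is_square v \<Longrightarrow> min_nonsquare \<alpha> c \<le> v"
proof -
  show "binvalue \<alpha> c (min_nonsquare \<alpha> c)"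
    using binvalue_c[of \<alpha> c] binvalue_d[of \<alpha> c] binvalue_e[of 1 c] by (auto simp: min_nonsquare_def add.commute)
  show "\<not> is_square (min_nonsquare \<alpha> c)"
    using is_square_gap3[of c "min_nonsquare \<alpha> c"] 1 by (auto simp: min_nonsquare_def)
  show "min_nonsquare \<alpha> c \<le> v" if "binvalue \<alpha> c v" "\<not> is_square v" for v
    using binvalue_small[OF 1 that(1)] that 1 by (auto simp: min_nonsquare_def)
qed

text \<open>
  If \<open>c\<close> is a square, the least nonsquare value lies in \<open>(c, c + 1]\<close> or equals \<open>c + 2\<close>. It determines \<open>c\<close>
  because squares are at least \<open>3\<close> apart, and then it determines \<open>\<alpha>\<close>.
\<close>
lemma same_values_square:
  assumes 1: "0 \<le> \<alpha>" "\<alpha> \<le> 1" "1 \<le> c" "is_square c"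
    and 2: "0 \<le> \<beta>" "\<beta> \<le> 1" "1 \<le> d" "is_square d"
    and w: "min_nonsquare \<alpha> c = min_nonsquare \<beta> d"
  shows "\<alpha> = \<beta> \<and> c = d"
proof -
  have "\<not> c < d" "\<not> d < c"
    using is_square_gap3[of c d] is_square_gap3[of d c] 1 2 w by (auto simp: min_nonsquare_def split: if_splits)
  thus ?thesis using 1 2 w by (auto simp: min_nonsquare_def split: if_splits)
qed

lemma int_sq_minus_self_ne3: "(j::int) * j - j \<noteq> 3"
proof
  assume "j * j - j = 3"
  moreover have "even (j * j - j)" by auto
  ultimately show False by simp
qed

text \<open>
  This separates \<open>x\<^sup>2 - x y + 2 y\<^sup>2\<close> from \<open>x\<^sup>2 + y\<^sup>2\<close>, which takes the value \<open>5\<close> at \<open>(2,1)\<close>.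
\<close>
lemma five_not_value: "\<not> binvalue 1 2 5"
proof
  assume "binvalue 1 2 5"
  hence *: "0 \<le> (1::rat)" "(1::rat) \<le> 1" "1 \<le> (2::rat)" "binvalue 1 2 5" by auto
  show False
    using *
  proof (cases rule: binvalue_cases)
    case (square k)
    thus False using is_square_gap5[OF is_square_4, of 5] by (auto simp: is_square_def)
  next
    case (unit j)
    hence "of_int (j * j - j) = (of_int 3 :: rat)" by (simp add: power2_eq_square)
    thus False using int_sq_minus_self_ne3[of j] by (simp only: of_int_eq_iff)
  qed simp
qed

text \<open>
  The forms \<open>x\<^sup>2 + (3/2) y\<^sup>2\<close> and \<open>x\<^sup>2 - x y / 2 + y\<^sup>2\<close> share the values \<open>1\<close>, \<open>3/2\<close>, \<open>5/2\<close> and \<open>4\<close>. The first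
  one also takes the value \<open>11/2\<close>, at \<open>(2,1)\<close>, which tells them apart.
\<close>
lemma eleven_halves_not_value: "\<not> binvalue (1/2) 1 (11/2)"
proof
  assume "binvalue (1/2) 1 (11/2)"
  then obtain x y where "binform (1/2) 1 x y = 11/2" by (auto simp: binvalue_def)
  hence "of_int (2*x*x - x*y + 2*y*y) = (of_int 11 :: rat)"
    by (simp add: binform_def power2_eq_square)
  hence *: "2*x*x - x*y + 2*y*y = 11" by (simp only: of_int_eq_iff)
  have "(4*x-y)^2 + 15 * y^2 = 88" "(4*y-x)^2 + 15 * x^2 = 88"
    using * by (simp_all add: power2_eq_square algebra_simps)
  hence "15 * y^2 \<le> 88" "15 * x^2 \<le> 88"
    using zero_le_power2[of "4*x-y"] zero_le_power2[of "4*y-x"] by linarith+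
  hence "\<bar>y\<bar>^2 < 3^2" "\<bar>x\<bar>^2 < 3^2" by simp_all
  hence "\<bar>x\<bar> < 3" "\<bar>y\<bar> < 3" using power_less_imp_less_base[of _ 2 "3::int"] by auto
  hence "x \<in> {-2,-1,0,1,2}" "y \<in> {-2,-1,0,1,2}" by auto
  thus False using * by auto
qed

lemma hex_values: assumes "binvalue 1 1 v" shows "v \<in> \<int>" "v \<noteq> 5"
proof -
  obtain x y where xy: "binform 1 1 x y = v" using assms by (auto simp: binvalue_def)
  hence v: "v = of_int (x*x - x*y + y*y)" by (simp add: binform_def power2_eq_square)
  show "v \<in> \<int>" unfolding v by simp
  show "v \<noteq> 5"
  proof
    assume "v = 5"
    hence "of_int (x*x - x*y + y*y) = (of_int 5 :: rat)" using v by simp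
    hence *: "x*x - x*y + y*y = 5" by (simp only: of_int_eq_iff)
    have "(2*x-y)^2 + 3 * y^2 = 20" "(2*y-x)^2 + 3 * x^2 = 20"
      using * by (simp_all add: power2_eq_square algebra_simps)
    hence "3 * y^2 \<le> 20" "3 * x^2 \<le> 20"
      using zero_le_power2[of "2*x-y"] zero_le_power2[of "2*y-x"] by linarith+
    hence "\<bar>y\<bar>^2 < 3^2" "\<bar>x\<bar>^2 < 3^2" by simp_all
    hence "\<bar>x\<bar> < 3" "\<bar>y\<bar> < 3" using power_less_imp_less_base[of _ 2 "3::int"] by auto
    hence "x \<in> {-2,-1,0,1,2}" "y \<in> {-2,-1,0,1,2}" by auto
    thus False using * by auto
  qed
qed

text \<open>
  For \<open>\<alpha> = 1\<close> the vectors with \<open>y = 1\<close> come in pairs of equal value, \<open>c + j (j - 1)\<close>. The gaps in the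
  list of values are then wider than for general \<open>\<alpha>\<close>.
\<close>
lemma binvalue_small_1:
  assumes "1 \<le> c" "binvalue 1 c v"
  shows "is_square v \<or> v = c \<or> v = c + 2 \<or> v \<ge> c + 6 \<or> v \<ge> 4 * c - 1"
proof -
  have *: "0 \<le> (1::rat)" "(1::rat) \<le> 1" by auto
  from * assms show ?thesis
  proof (cases rule: binvalue_cases)
    case (unit j)
    consider "j = 0 \<or> j = 1" | "j = -1 \<or> j = 2" | "j \<ge> 3" | "j \<le> -2" by linarith
    thus ?thesis
    proof cases
      case 3
      hence "0 \<le> (j - 3) * (j + 2)" by (intro mult_nonneg_nonneg) auto
      hence "6 \<le> j^2 - j" by (simp add: power2_eq_square algebra_simps)
      hence "of_int 6 \<le> (of_int (j^2 - j) :: rat)" by (simp only: of_int_le_iff)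
      thus ?thesis using unit by simp
    next
      case 4
      hence "0 \<le> (3 - j) * (- 2 - j)" by (intro mult_nonneg_nonneg) auto
      hence "6 \<le> j^2 - j" by (simp add: power2_eq_square algebra_simps)
      hence "of_int 6 \<le> (of_int (j^2 - j) :: rat)" by (simp only: of_int_le_iff)
      thus ?thesis using unit by simp
    qed (use unit in auto)
  qed (auto simp: is_square_def)
qed

text \<open>
  One form has its least nonsquare value at \<open>(0,1)\<close>, the other has a square there and its least
  nonsquare value further out. Equating the two expresses \<open>c\<close> through \<open>d\<close> and \<open>\<beta>\<close>, and the next values
  leave three survivors: \<open>x\<^sup>2 - x y + 2 y\<^sup>2\<close> against \<open>x\<^sup>2 + y\<^sup>2\<close>, \<open>x\<^sup>2 + (3/2) y\<^sup>2\<close> against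
  \<open>x\<^sup>2 - x y / 2 + y\<^sup>2\<close>, and \<open>x\<^sup>2 + 3 y\<^sup>2\<close> against \<open>x\<^sup>2 - x y + y\<^sup>2\<close>. A single further value rules out
  the first two.
\<close>
lemma same_values_mixed:
  assumes 1: "0 \<le> \<alpha>" "\<alpha> \<le> 1" "1 \<le> c" "\<not> is_square c"
    and 2: "0 \<le> \<beta>" "\<beta> \<le> 1" "1 \<le> d" "is_square d"
    and V: "\<And>v. binvalue \<alpha> c v \<longleftrightarrow> binvalue \<beta> d v"
    and w: "min_nonsquare \<alpha> c = min_nonsquare \<beta> d"
  shows "\<alpha> = 0 \<and> c = 3 \<and> \<beta> = 1 \<and> d = 1"
proof -
  note s1 = binvalue_small[OF 1(1-3)] and s2 = binvalue_small[OF 2(1-3)]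
  have d14: "d = 1 \<or> d \<ge> 4" using is_square_ge4[of d] 2 by (auto simp: order.order_iff_strict)
  have gap: "is_square v \<Longrightarrow> v > d \<Longrightarrow> v \<ge> d + 3 \<and> (d = 1 \<or> v \<ge> d + 5)" for v
    using is_square_gap3[of d v] is_square_gap5[of d v] d14 2 by auto
  have D1: "binvalue \<beta> d (c + 1 - \<alpha>)" and E1: "binvalue \<beta> d (c + 1 + \<alpha>)"
    using V binvalue_d[of \<alpha> c] binvalue_e[of \<alpha> c] by auto
  show ?thesis
  proof (cases "\<beta> = 1")
    case True
    hence c: "c = d + 2" using w 1 2 by (simp add: min_nonsquare_def)
    have "d = 1"
    proof (rule ccontr)
      assume "d \<noteq> 1"
      hence d4: "d \<ge> 4" using d14 by simp
      have t2: "binvalue \<beta> d v \<Longrightarrow> is_square v \<or> v = d \<or> v = d + 2 \<or> v \<ge> d + 6 \<or> v \<ge> 4 * d - 1" for v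
        using binvalue_small_1[OF 2(3)] True by simp
      have "\<alpha> = 1" using t2[OF D1] gap[of "c+1-\<alpha>"] d4 c 1 by auto
      thus False using t2[OF E1] gap[of "c+1+\<alpha>"] d4 c 1 by auto
    qed
    moreover have "\<alpha> = 0"
    proof -
      have "binvalue 1 1 (4 + \<alpha>)" using E1 c True \<open>d = 1\<close> by simp
      hence "4 + \<alpha> \<in> \<int>" "4 + \<alpha> \<noteq> 5" using hex_values by auto
      obtain n where n: "4 + \<alpha> = of_int n" using \<open>4 + \<alpha> \<in> \<int>\<close> by (rule Ints_cases)
      have "of_int 4 \<le> (of_int n :: rat)" "of_int n < (of_int 5 :: rat)"
        using 1 \<open>4 + \<alpha> \<noteq> 5\<close> n by auto
      hence "n = 4" by (simp only: of_int_le_iff of_int_less_iff)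
      thus ?thesis using n by simp
    qed
    ultimately show ?thesis using c True by simp
  next
    case False
    hence c: "c = d + 1 - \<beta>" using w 1 2 by (simp add: min_nonsquare_def)
    have "\<beta> = 0 \<or> \<beta> > 0" using 2 by auto
    thus ?thesis
    proof
      assume b0: "\<beta> = 0"
      have "\<alpha> = 1" using s2[OF D1] gap[of "c+1-\<alpha>"] b0 c 1 2 by auto
      hence "d = 1" using s2[OF E1] gap[of "c+1+\<alpha>"] b0 c 1 2 by auto
      have "binvalue 0 1 5" by (rule binvalueI[of _ _ 2 1]) (simp add: binform_def)
      thus ?thesis using V five_not_value \<open>d = 1\<close> \<open>\<alpha> = 1\<close> b0 c by simp
    next
      assume b0: "\<beta> > 0"
      have b1: "\<beta> < 1" using False 2 by simp
      have "binvalue \<alpha> c (d + 1 + \<beta>)" using V binvalue_e[of \<beta> d] by simp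
      hence "c + 1 - \<alpha> = d + 1 + \<beta> \<or> c + 1 + \<alpha> = d + 1 + \<beta>"
        using s1[of "d+1+\<beta>"] gap[of "d+1+\<beta>"] b0 b1 c 1 2 by auto
      hence half: "\<beta> = 1/2"
      proof
        assume a: "c + 1 - \<alpha> = d + 1 + \<beta>"
        show ?thesis using s2[OF E1] gap[of "c+1+\<alpha>"] a b0 b1 c 1 2 by auto
      next
        assume a: "c + 1 + \<alpha> = d + 1 + \<beta>"
        show ?thesis using s2[OF D1] gap[of "c+1-\<alpha>"] a b0 b1 c 1 2 by auto
      qed
      have a0: "\<alpha> = 0" using half \<open>c + 1 - \<alpha> = d + 1 + \<beta> \<or> c + 1 + \<alpha> = d + 1 + \<beta>\<close> c by auto
      have "binform \<beta> d 2 1 = d + 3" by (simp add: binform_def half)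
      hence "binvalue \<alpha> c (d + 3)" using V binvalueI by metis
      hence "d = 1" using s1[of "d+3"] gap[of "d+3"] half a0 c 2 by auto
      have "binform 0 (3/2) 2 1 = 11/2" by (simp add: binform_def)
      hence "binvalue (1/2) 1 (11/2)" using V binvalueI \<open>d = 1\<close> half a0 c by fastforce
      thus ?thesis using eleven_halves_not_value by simp
    qed
  qed
qed

text \<open>
  The case distinction is whether \<open>c\<close> and \<open>d\<close> are squares. The exception is genuine: \<open>x\<^sup>2 - x y + y\<^sup>2\<close>
  is the norm form of the Eisenstein integers, \<open>x\<^sup>2 + 3 y\<^sup>2\<close> is its restriction to a subring of
  index two, and every Eisenstein integer has an associate in that subring.
\<close>
theorem same_values:
  assumes 1: "0 \<le> \<alpha>" "\<alpha> \<le> 1" "1 \<le> c" and 2: "0 \<le> \<beta>" "\<beta> \<le> 1" "1 \<le> d"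
    and V: "\<And>v. binvalue \<alpha> c v \<longleftrightarrow> binvalue \<beta> d v"
  shows "(\<alpha> = \<beta> \<and> c = d) \<or> (\<alpha> = 0 \<and> c = 3 \<and> \<beta> = 1 \<and> d = 1) \<or>
         (\<beta> = 0 \<and> d = 3 \<and> \<alpha> = 1 \<and> c = 1)"
proof -
  have w: "min_nonsquare \<alpha> c = min_nonsquare \<beta> d"
    using min_nonsquare[OF 1] min_nonsquare[OF 2] V by (meson order_antisym)
  show ?thesis
    using same_values_nonsquare[of \<alpha> c \<beta> d] same_values_square[of \<alpha> c \<beta> d]
      same_values_mixed[of \<alpha> c \<beta> d] same_values_mixed[of \<beta> d \<alpha> c] 1 2 V w by metis
qed

section \<open>Residues of linear functionals and automorphisms of the form\<close>

lemma dvd_combination: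
  fixes N :: int
  assumes "N dvd x" "N dvd y" "z = i * x + j * y" shows "N dvd z"
  using assms by simp

text \<open>
  Congruence up to sign. A vector and its negative have the same value, so the value of a form
  sees a residue only up to sign.
\<close>
definition cong_pm :: "int \<Rightarrow> int \<Rightarrow> int \<Rightarrow> bool" where
  "cong_pm N r s \<longleftrightarrow> N dvd r - s \<or> N dvd r + s"

lemma cong_pm_refl [simp]: "cong_pm N r r" by (simp add: cong_pm_def)

lemma cong_pm_sym: "cong_pm N r s \<Longrightarrow> cong_pm N s r"
  by (auto simp: cong_pm_def add.commute dvd_diff_commute)

lemma cong_pm_trans: assumes "cong_pm N r s" "cong_pm N s t" shows "cong_pm N r t"
proof -
  have "r - t = (r - s) + (s - t)" "r + t = (r + s) - (s - t)" "r + t = (r - s) + (s + t)" "r - t = (r + s) - (s + t)"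
    by simp_all
  thus ?thesis using assms unfolding cong_pm_def by (metis dvd_add dvd_diff)
qed

lemma cong_pm_uminus: "cong_pm N (-r) s \<longleftrightarrow> cong_pm N r s" "cong_pm N r (-s) \<longleftrightarrow> cong_pm N r s"
proof -
  have "- r - s = - (r + s)" "- r + s = - (r - s)" by simp_all
  thus "cong_pm N (-r) s \<longleftrightarrow> cong_pm N r s" unfolding cong_pm_def by (metis dvd_minus_iff)
  show "cong_pm N r (-s) \<longleftrightarrow> cong_pm N r s" unfolding cong_pm_def by auto
qed

lemma cong_pm_mult: assumes "cong_pm N r s" shows "cong_pm N (r * k) (s * k)"
  using assms unfolding cong_pm_def by (metis dvd_mult2 left_diff_distrib distrib_right)

text \<open>
  Two pairs of classes with the same underlying set agree as unordered pairs, even if the two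
  members of a pair coincide.
\<close>
lemma cong_pm_match2:
  assumes "cong_pm N x x' \<or> cong_pm N x y'" "cong_pm N y x' \<or> cong_pm N y y'" "cong_pm N x' x \<or> cong_pm N x' y" "cong_pm N y' x \<or> cong_pm N y' y"
  shows "(cong_pm N x x' \<and> cong_pm N y y') \<or> (cong_pm N x y' \<and> cong_pm N y x')"
  using assms by (meson cong_pm_sym cong_pm_trans)

text \<open>
  The vectors at which two functionals agree modulo \<open>N\<close> form a subgroup, and so do those at which
  they are opposite. One of these subgroups contains two of the vectors \<open>(1,0)\<close>, \<open>(0,1)\<close>, \<open>(1,1)\<close>, and
  any two of them form a basis.
\<close>
lemma cong_pm_common_sign:
  assumes "cong_pm N p p'" "cong_pm N q q'" "cong_pm N (p + q) (p' + q')"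
  shows "(N dvd p - p' \<and> N dvd q - q') \<or> (N dvd p + p' \<and> N dvd q + q')"
proof -
  consider "N dvd p - p'" "N dvd q - q'" | "N dvd p + p'" "N dvd q + q'"
    | "N dvd p - p'" "N dvd q + q'" | "N dvd p + p'" "N dvd q - q'"
    using assms(1,2) unfolding cong_pm_def by blast
  thus ?thesis
  proof cases
    case 3
    show ?thesis using assms(3) unfolding cong_pm_def
    proof
      assume h: "N dvd p + q - (p' + q')"
      have "N dvd q - q'" by (rule dvd_combination[where i="1" and j="-1", OF h 3(1)]) (simp add: algebra_simps)
      thus ?thesis using 3 by blast
    next
      assume h: "N dvd p + q + (p' + q')"
      have "N dvd p + p'" by (rule dvd_combination[where i="1" and j="-1", OF h 3(2)]) (simp add: algebra_simps)
      thus ?thesis using 3 by blast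
    qed
  next
    case 4
    show ?thesis using assms(3) unfolding cong_pm_def
    proof
      assume h: "N dvd p + q - (p' + q')"
      have "N dvd p - p'" by (rule dvd_combination[where i="1" and j="-1", OF h 4(2)]) (simp add: algebra_simps)
      thus ?thesis using 4 by blast
    next
      assume h: "N dvd p + q + (p' + q')"
      have "N dvd q + q'" by (rule dvd_combination[where i="1" and j="-1", OF h 4(1)]) (simp add: algebra_simps)
      thus ?thesis using 4 by blast
    qed
  qed blast+
qed

text \<open>
  The residue \<open>r\<close> of the functional \<open>p x + q y\<close> modulo \<open>N\<close> occurs at a vector of value \<open>v\<close>. This is what
  remains of a simultaneous value of the ternary pair after the third variable has been
  eliminated.
\<close>
definition attains :: "rat \<Rightarrow> rat \<Rightarrow> int \<Rightarrow> int \<Rightarrow> int \<Rightarrow> rat \<Rightarrow> int \<Rightarrow> bool" where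
  "attains \<alpha> c N p q v r \<longleftrightarrow> (\<exists>x y. binform \<alpha> c x y = v \<and> N dvd r - (p * x + q * y))"

lemma attainsI: "attains \<alpha> c N p q (binform \<alpha> c x y) (p * x + q * y)"
  unfolding attains_def by (intro exI[of _ x] exI[of _ y]) simp

lemma attains_unit: "attains \<alpha> c N p q (c + of_int j ^ 2 - \<alpha> * of_int j) (q + p * j)"
  using attainsI[of \<alpha> c N p q j 1] by (simp add: binform_def algebra_simps)

lemma attains_horizontal: "attains \<alpha> c N p q (of_int k ^ 2) (p * k)"
  using attainsI[of \<alpha> c N p q k 0] by simp

lemma attains_cases:
  assumes "0 \<le> \<alpha>" "\<alpha> \<le> 1" "1 \<le> c" "attains \<alpha> c N p q v r" "v < 4 * c - \<alpha>"
  obtains (square) k where "v = of_int k ^ 2" "cong_pm N r (p * k)"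
    | (unit) j where "v = c + of_int j ^ 2 - \<alpha> * of_int j" "cong_pm N r (q + p * j)"
proof -
  obtain x y where xy: "binform \<alpha> c x y = v" "N dvd r - (p * x + q * y)"
    using assms(4) by (auto simp: attains_def)
  consider "y = 0" | "y = 1" | "y = -1"
    using binform_ge[OF assms(1-3), of y x] assms(5) xy by linarith
  thus ?thesis
  proof cases
    case 1
    thus ?thesis using square[of x] xy by (simp add: cong_pm_def)
  next
    case 2
    thus ?thesis using unit[of x] xy by (simp add: cong_pm_def binform_def algebra_simps)
  next
    case 3
    have "r - (p * x + q * y) = r + (q + p * (-x))" using 3 by simp
    hence "cong_pm N r (q + p * (-x))" using xy unfolding cong_pm_def by metis
    moreover have "v = c + of_int (-x) ^ 2 - \<alpha> * of_int (-x)"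
      using xy 3 by (simp add: binform_def)
    ultimately show ?thesis by (rule unit[rotated])
  qed
qed

text \<open>
  Some automorphism of the binary form carries the functional \<open>(p, q)\<close> to \<open>(p', q')\<close> modulo \<open>N\<close>. The
  matrix entries are listed so that the automorphism can be extended to three variables later.
\<close>
definition linked :: "rat \<Rightarrow> rat \<Rightarrow> int \<Rightarrow> int \<Rightarrow> int \<Rightarrow> int \<Rightarrow> int \<Rightarrow> bool" where
  "linked \<alpha> c N p q p' q' \<longleftrightarrow> (\<exists>h11 h12 h21 h22 :: int. \<bar>h11 * h22 - h12 * h21\<bar> = 1 \<and>
     (\<forall>x y. binform \<alpha> c (h11 * x + h12 * y) (h21 * x + h22 * y) = binform \<alpha> c x y) \<and>
     N dvd p * h11 + q * h21 - p' \<and> N dvd p * h12 + q * h22 - q')"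

lemma linkedI:
  assumes "\<bar>h11 * h22 - h12 * h21\<bar> = 1" "N dvd p * h11 + q * h21 - p'" "N dvd p * h12 + q * h22 - q'"
   "\<And>x y. binform \<alpha> c (h11 * x + h12 * y) (h21 * x + h22 * y) = binform \<alpha> c x y"
  shows "linked \<alpha> c N p q p' q'"
  unfolding linked_def using assms by blast

lemma linked_trans:
  assumes "linked \<alpha> c N p q p' q'" "linked \<alpha> c N p' q' p'' q''"
  shows "linked \<alpha> c N p q p'' q''"
proof -
  obtain a b d e where h: "\<bar>a * e - b * d\<bar> = 1" "N dvd p * a + q * d - p'" "N dvd p * b + q * e - q'"
    "\<And>x y. binform \<alpha> c (a * x + b * y) (d * x + e * y) = binform \<alpha> c x y"
    using assms(1) unfolding linked_def by blast
  obtain a' b' d' e' where h': "\<bar>a' * e' - b' * d'\<bar> = 1" "N dvd p' * a' + q' * d' - p''"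
    "N dvd p' * b' + q' * e' - q''"
    "\<And>x y. binform \<alpha> c (a' * x + b' * y) (d' * x + e' * y) = binform \<alpha> c x y"
    using assms(2) unfolding linked_def by blast
  show ?thesis
  proof (rule linkedI)
    have "(a*a'+b*d') * (d*b'+e*e') - (a*b'+b*e') * (d*a'+e*d') = (a*e-b*d) * (a'*e'-b'*d')"
      by (simp add: algebra_simps)
    thus "\<bar>(a*a'+b*d') * (d*b'+e*e') - (a*b'+b*e') * (d*a'+e*d')\<bar> = 1"
      using h(1) h'(1) by (simp add: abs_mult)
    have "N dvd a' * (p * a + q * d - p') + d' * (p * b + q * e - q') + (p' * a' + q' * d' - p'')"
      using h(2,3) h'(2) by (intro dvd_add dvd_mult)
    thus "N dvd p * (a*a'+b*d') + q * (d*a'+e*d') - p''" by (simp add: algebra_simps)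
    have "N dvd b' * (p * a + q * d - p') + e' * (p * b + q * e - q') + (p' * b' + q' * e' - q'')"
      using h(2,3) h'(3) by (intro dvd_add dvd_mult)
    thus "N dvd p * (a*b'+b*e') + q * (d*b'+e*e') - q''" by (simp add: algebra_simps)
    fix x y
    show "binform \<alpha> c ((a*a'+b*d') * x + (a*b'+b*e') * y) ((d*a'+e*d') * x + (d*b'+e*e') * y) = binform \<alpha> c x y"
      using h(4)[of "a'*x+b'*y" "d'*x+e'*y"] h'(4)[of x y] by (simp add: algebra_simps)
  qed
qed

text \<open>
  The inverse matrix is the adjugate times the determinant \<open>u = \<plusminus>1\<close>, which keeps everything
  integral.
\<close>
lemma linked_sym:
  assumes "linked \<alpha> c N p q p' q'" shows "linked \<alpha> c N p' q' p q"
proof -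
  obtain a b d e where h: "\<bar>a * e - b * d\<bar> = 1" "N dvd p * a + q * d - p'" "N dvd p * b + q * e - q'"
    "\<And>x y. binform \<alpha> c (a * x + b * y) (d * x + e * y) = binform \<alpha> c x y"
    using assms unfolding linked_def by blast
  define u where "u = a * e - b * d"
  have u: "u * u = 1" using h(1) unfolding u_def by (metis abs_mult_self_eq mult_1)
  show ?thesis
  proof (rule linkedI)
    have "(u*e) * (u*a) - (-(u*b)) * (-(u*d)) = (u*u) * u" by (simp add: u_def algebra_simps)
    thus "\<bar>(u*e) * (u*a) - (-(u*b)) * (-(u*d))\<bar> = 1" using u h(1) by (simp add: u_def)
    have "p' * (u*e) + q' * (-(u*d)) - p = u * ((p' - (p*a+q*d)) * e - (q' - (p*b+q*e)) * d) + (u*u-1) * p"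
      by (simp add: u_def algebra_simps)
    moreover have "N dvd p' - (p*a+q*d)" "N dvd q' - (p*b+q*e)" using h(2,3) by (simp_all add: dvd_diff_commute)
    ultimately show "N dvd p' * (u*e) + q' * (-(u*d)) - p" using u by simp
    have "p' * (-(u*b)) + q' * (u*a) - q = u * (- (p' - (p*a+q*d)) * b + (q' - (p*b+q*e)) * a) + (u*u-1) * q"
      by (simp add: u_def algebra_simps)
    thus "N dvd p' * (-(u*b)) + q' * (u*a) - q"
      using u h(2) \<open>N dvd q' - (p*b+q*e)\<close> by simp
    fix x y
    have "a * (u*e*x + -(u*b)*y) + b * (-(u*d)*x + u*a*y) = u*u*x"
      "d * (u*e*x + -(u*b)*y) + e * (-(u*d)*x + u*a*y) = u*u*y"
      by (simp_all add: u_def algebra_simps)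
    thus "binform \<alpha> c (u*e*x + -(u*b)*y) (-(u*d)*x + u*a*y) = binform \<alpha> c x y"
      using h(4)[of "u*e*x + -(u*b)*y" "-(u*d)*x + u*a*y"] u by simp
  qed
qed

lemma linked_rep_imp:
  assumes "linked \<alpha> c N p q p' q'" "attains \<alpha> c N p' q' v r" shows "attains \<alpha> c N p q v r"
proof -
  obtain a b d e where h: "N dvd p * a + q * d - p'" "N dvd p * b + q * e - q'"
    "\<And>x y. binform \<alpha> c (a * x + b * y) (d * x + e * y) = binform \<alpha> c x y"
    using assms(1) unfolding linked_def by blast
  obtain x y where xy: "binform \<alpha> c x y = v" "N dvd r - (p' * x + q' * y)"
    using assms(2) by (auto simp: attains_def)
  have "N dvd r - (p' * x + q' * y) - (x * (p * a + q * d - p') + y * (p * b + q * e - q'))"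
    by (rule dvd_diff[OF xy(2) dvd_add[OF dvd_mult[OF h(1)] dvd_mult[OF h(2)]]])
  hence "N dvd r - (p * (a*x+b*y) + q * (d*x+e*y))" by (simp add: algebra_simps)
  thus ?thesis using h(3)[of x y] xy(1) unfolding attains_def by metis
qed

lemma linked_attains:
  assumes "linked \<alpha> c N p q p' q'" shows "attains \<alpha> c N p' q' v r \<longleftrightarrow> attains \<alpha> c N p q v r"
  using linked_rep_imp assms linked_sym by blast

lemma linked_sign:
  assumes "(N dvd p - p' \<and> N dvd q - q') \<or> (N dvd p + p' \<and> N dvd q + q')"
  shows "linked \<alpha> c N p q p' q'"
  using assms
proof
  assume "N dvd p - p' \<and> N dvd q - q'"
  thus ?thesis by (intro linkedI[of 1 1 0 0]) auto
next
  assume *: "N dvd p + p' \<and> N dvd q + q'"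
  have "- p - p' = - (p + p')" "- q - q' = - (q + q')" by auto
  hence "N dvd - p - p'" "N dvd - q - q'" using * dvd_minus_iff by metis+
  thus ?thesis by (intro linkedI[of "-1" "-1" 0 0]) (auto simp: binform_uminus)
qed

lemma linked_common:
  assumes "cong_pm N p p'" "cong_pm N q q'" "cong_pm N (p + q) (p' + q')"
  shows "linked \<alpha> c N p q p' q'"
  using linked_sign cong_pm_common_sign[OF assms] by blast

lemma linked_rectangular:
  assumes "cong_pm N p p'" "cong_pm N q q'" shows "linked 0 c N p q p' q'"
proof -
  have "linked 0 c N p q p (-q)"
    by (rule linkedI[of 1 "-1" 0 0]) (auto simp: binform_def)
  moreover have "linked 0 c N p q p' q' \<or> linked 0 c N p (-q) p' q'"
  proof -
    have "- q - q' = - (q + q')" "- q + q' = - (q - q')" by auto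
    hence "N dvd - q - q' \<longleftrightarrow> N dvd q + q'" "N dvd - q + q' \<longleftrightarrow> N dvd q - q'" by (metis dvd_minus_iff)+
    thus ?thesis using assms unfolding cong_pm_def by (metis linked_sign)
  qed
  ultimately show ?thesis using linked_trans by blast
qed

lemma linked_swap: "linked \<alpha> 1 N p q q p"
  by (rule linkedI[of 0 0 1 1]) (auto simp: binform_def)

lemma linked_reflect: "linked 1 c N p q (-p) (p + q)"
  by (rule linkedI[of "-1" 1 1 0]) (auto simp: binform_def power2_eq_square algebra_simps)

text \<open>
  The rotation of order three of the hexagonal lattice permutes \<open>p\<close>, \<open>q\<close>, \<open>-p-q\<close> cyclically.
\<close>
lemma linked_rotate: "linked 1 1 N p q q (-p-q)"
  by (rule linkedI[of 0 "-1" "-1" 1]) (auto simp: binform_def power2_eq_square algebra_simps)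

text \<open>
  Let a single pair of opposite vectors on the lines \<open>y = \<plusminus>1\<close> have the given value. The only
  competitors are vectors \<open>(k, 0)\<close> of the same value. Unless the residues match at once, both of
  them are taken by a competitor, and on the axis \<open>y = 0\<close> the two functionals agree up to sign.
\<close>
lemma cong_pm_at_unit:
  assumes 1: "0 \<le> \<alpha>" "\<alpha> \<le> 1" "1 \<le> c"
    and R: "\<And>v r. attains \<alpha> c N p q v r \<longleftrightarrow> attains \<alpha> c N p' q' v r"
    and pp: "cong_pm N p p'"
    and small: "c + of_int j ^ 2 - \<alpha> * of_int j < 4 * c - \<alpha>"
    and uniq: "\<And>i. of_int i ^ 2 - \<alpha> * of_int i = of_int j ^ 2 - \<alpha> * of_int j \<Longrightarrow> i = j"
  shows "cong_pm N (q + p * j) (q' + p' * j)"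
proof -
  define v where "v = c + of_int j ^ 2 - \<alpha> * of_int j"
  have v: "v < 4 * c - \<alpha>" using small v_def by simp
  have *: "cong_pm N r (q + p * j) \<or> (\<exists>k. v = of_int k ^ 2 \<and> cong_pm N r (p * k))" if "attains \<alpha> c N p q v r" for p q r
    using 1 that v
  proof (cases rule: attains_cases)
    case (unit i)
    hence "i = j" using uniq[of i] by (simp add: v_def)
    thus ?thesis using unit by simp
  qed blast
  have "attains \<alpha> c N p' q' v (q + p * j)" "attains \<alpha> c N p q v (q' + p' * j)" using R attains_unit v_def by metis+
  hence
    "cong_pm N (q + p * j) (q' + p' * j) \<or> (\<exists>k. v = of_int k ^ 2 \<and> cong_pm N (q + p * j) (p' * k))"
    "cong_pm N (q' + p' * j) (q + p * j) \<or> (\<exists>k. v = of_int k ^ 2 \<and> cong_pm N (q' + p' * j) (p * k))"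
    using * by blast+
  moreover have "cong_pm N (q + p * j) (q' + p' * j)"
    if km: "v = of_int k ^ 2" "v = of_int m ^ 2" "cong_pm N (q + p * j) (p' * k)" "cong_pm N (q' + p' * j) (p * m)" for k m
  proof -
    have "of_int (k ^ 2) = (of_int (m ^ 2) :: rat)" using km by simp
    hence "k = m \<or> k = -m" by (simp only: of_int_eq_iff power2_eq_iff)
    hence "cong_pm N (p' * k) (p' * m)" by (auto simp: cong_pm_uminus)
    moreover have "cong_pm N (p' * m) (p * m)" using pp cong_pm_mult cong_pm_sym by blast
    ultimately show ?thesis using km(3,4) cong_pm_trans cong_pm_sym by meson
  qed
  ultimately show ?thesis using cong_pm_sym by blast
qed

text \<open>
  For \<open>0 < \<alpha> < 1\<close> the vector \<open>(1,1)\<close> is, up to sign, the only vector of its value on the lines \<open>y = \<plusminus>1\<close>,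
  and it supplies the third condition of \<open>cong_pm_common_sign\<close>. For \<open>\<alpha> = 0\<close> changing the sign of \<open>y\<close> is
  an automorphism.
\<close>
lemma linked_generic:
  assumes 1: "0 \<le> \<alpha>" "\<alpha> < 1" "1 \<le> c"
    and R: "\<And>v r. attains \<alpha> c N p q v r \<longleftrightarrow> attains \<alpha> c N p' q' v r"
    and pp: "cong_pm N p p'" and qq: "cong_pm N q q'"
  shows "linked \<alpha> c N p q p' q'"
proof (cases "\<alpha> = 0")
  case True
  thus ?thesis using linked_rectangular pp qq by blast
next
  case False
  have "i = 1" if "of_int i ^ 2 - \<alpha> * of_int i = of_int 1 ^ 2 - \<alpha> * of_int 1" for i :: int
  proof -
    have "(of_int i - 1) * (of_int (i + 1) - \<alpha>) = 0" using that by (simp add: power2_eq_square algebra_simps)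
    moreover have "of_int (i + 1) \<noteq> \<alpha>"
    proof
      assume *: "of_int (i + 1) = \<alpha>"
      hence "of_int 0 < (of_int (i + 1) :: rat)" "of_int (i+1) < (of_int 1 :: rat)" using 1 False by auto
      hence "0 < i + 1" "i + 1 < 1" by (simp_all only: of_int_less_iff)
      thus False by simp
    qed
    ultimately show ?thesis by simp
  qed
  hence "cong_pm N (q + p * 1) (q' + p' * 1)"
    using 1 by (intro cong_pm_at_unit[OF _ _ _ R pp, of 1]) auto
  thus ?thesis using linked_common[OF pp qq] by (simp add: add.commute)
qed

lemma unit_ge:
  fixes \<alpha> c :: rat
  assumes "0 \<le> \<alpha>" "\<alpha> \<le> 1"
  shows "c + of_int j ^ 2 - \<alpha> * of_int j \<ge> c"
  using unit_cases[OF assms, of j c] assms by auto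

lemma unit_eq:
  fixes \<alpha> :: rat
  assumes "0 \<le> \<alpha>" "\<alpha> < 1" "of_int j ^ 2 - \<alpha> * of_int j = 0"
  shows "j = 0"
  using unit_cases[of \<alpha> j 0] assms by auto

lemma cong_pm_at_one:
  assumes 1: "0 \<le> \<alpha>" "\<alpha> \<le> 1" "1 < c" and R: "attains \<alpha> c N p q 1 r"
  shows "cong_pm N r p"
proof -
  have c: "1 \<le> c" "1 < 4 * c - \<alpha>" using 1 by auto
  from 1(1,2) c(1) R c(2) show ?thesis
  proof (cases rule: attains_cases)
    case (square k)
    hence "k = 1 \<or> k = -1" by (metis of_int_1 of_int_eq_iff of_int_power power2_eq_1_iff)
    thus ?thesis using square by (auto simp: cong_pm_uminus)
  next
    case (unit j)
    thus ?thesis using unit_ge[OF 1(1,2), of c j] 1 by simp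
  qed
qed

lemma attains_one: "attains \<alpha> c N p q 1 p"
  using attains_horizontal[of \<alpha> c N p q 1] by simp

lemma linked_acute_long:
  assumes 1: "0 \<le> \<alpha>" "\<alpha> < 1" "1 < c"
    and R: "\<And>v r. attains \<alpha> c N p q v r \<longleftrightarrow> attains \<alpha> c N p' q' v r"
  shows "linked \<alpha> c N p q p' q'"
proof -
  have pp: "cong_pm N p p'" using cong_pm_at_one[of \<alpha> c N p' q' p] R attains_one 1 less_imp_le by blast
  have "cong_pm N (q + p * 0) (q' + p' * 0)"
    using 1 unit_eq by (intro cong_pm_at_unit[OF _ _ _ R pp]) auto
  thus ?thesis using linked_generic[OF _ _ _ R pp] 1 by simp
qed

text \<open>
  For \<open>c = 1\<close> there are four shortest vectors, and the exchange of \<open>x\<close> and \<open>y\<close> makes up for not knowing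
  which of them has which residue.
\<close>
lemma linked_acute_rhombic:
  assumes 1: "0 \<le> \<alpha>" "\<alpha> < 1"
    and R: "\<And>v r. attains \<alpha> 1 N p q v r \<longleftrightarrow> attains \<alpha> 1 N p' q' v r"
  shows "linked \<alpha> 1 N p q p' q'"
proof -
  have *: "cong_pm N r p \<or> cong_pm N r q" if "attains \<alpha> 1 N p q 1 r" for p q r
  proof -
    have "0 \<le> \<alpha>" "\<alpha> \<le> 1" "1 \<le> (1::rat)" "1 < 4 * 1 - \<alpha>" using 1 by auto
    from this(1-3) that this(4) show ?thesis
    proof (cases rule: attains_cases)
      case (square k)
      hence "k = 1 \<or> k = -1" by (metis of_int_1 of_int_eq_iff of_int_power power2_eq_1_iff)
      thus ?thesis using square by (auto simp: cong_pm_uminus)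
    next
      case (unit j)
      thus ?thesis using unit_eq[OF 1, of j] by simp
    qed
  qed
  have q1: "attains \<alpha> 1 N p q 1 q" for p q using attains_unit[of \<alpha> 1 N p q 0] by simp
  have "(cong_pm N p p' \<and> cong_pm N q q') \<or> (cong_pm N p q' \<and> cong_pm N q p')"
    by (rule cong_pm_match2) (use * R attains_one q1 in blast)+
  thus ?thesis
  proof
    assume "cong_pm N p p' \<and> cong_pm N q q'"
    thus ?thesis using linked_generic[OF _ _ _ R] 1 by simp
  next
    assume "cong_pm N p q' \<and> cong_pm N q p'"
    moreover have "attains \<alpha> 1 N q p v r \<longleftrightarrow> attains \<alpha> 1 N p' q' v r" for v r
      using R linked_attains[OF linked_swap] by blast
    ultimately have "linked \<alpha> 1 N q p p' q'" using linked_generic[of \<alpha> 1 N q p p' q'] 1 by simp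
    thus ?thesis using linked_swap linked_trans by blast
  qed
qed

section \<open>Forms with a reflection fixing the shortest vector\<close>

lemma linked_reflected:
  assumes "N dvd q + p + q'" shows "linked 1 c N p q p q'"
proof -
  have "linked 1 c N (-p) (p + q) p q'" using assms by (intro linked_sign) (simp add: algebra_simps)
  thus ?thesis using linked_reflect linked_trans by blast
qed

lemma linked_two_torsion:
  assumes "N dvd 2 * p" "N dvd q + q' \<or> N dvd q - p - q'" shows "linked 1 c N p q p q'"
  using assms(2)
proof
  assume "N dvd q + q'"
  moreover have "N dvd p + p" using assms(1) by (simp only: mult_2)
  ultimately show ?thesis by (intro linked_sign) simp
next
  assume *: "N dvd q - p - q'"
  have "(p + q) - q' = (q - p - q') + 2 * p" "- p - p = - (2 * p)" by simp_all
  hence "N dvd (p + q) - q'" "N dvd -p - p" using * assms(1) dvd_add dvd_minus_iff by metis+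
  hence "linked 1 c N (-p) (p + q) p q'" by (intro linked_sign) auto
  thus ?thesis using linked_reflect linked_trans by blast
qed

text \<open>
  For \<open>\<alpha> = 1\<close> the vectors \<open>(-n, 1)\<close> and \<open>(n + 1, 1)\<close> have the same value and are exchanged by a
  reflection that fixes \<open>(1,0)\<close> up to sign. Their residues match up to sign and order. If one of the
  two signs is positive, the functionals are linked. If both are negative, subtracting the two
  congruences eliminates \<open>q\<close> and \<open>q'\<close> and bounds the order of \<open>p\<close>.
\<close>
lemma isosceles_step:
  assumes "cong_pm N (q - n * p) (q' - n * p) \<or> cong_pm N (q - n * p) (q' + (n + 1) * p)"
    "cong_pm N (q + (n + 1) * p) (q' - n * p) \<or> cong_pm N (q + (n + 1) * p) (q' + (n + 1) * p)"
    "cong_pm N (q' - n * p) (q - n * p) \<or> cong_pm N (q' - n * p) (q + (n + 1) * p)"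
    "cong_pm N (q' + (n + 1) * p) (q - n * p) \<or> cong_pm N (q' + (n + 1) * p) (q + (n + 1) * p)"
  shows "linked 1 c N p q p q' \<or>
    N dvd (2 + 4 * n) * p \<and> (N dvd q + q' - 2 * n * p \<or> N dvd q - p - q' - 2 * n * p)"
proof (rule ccontr)
  assume not: "\<not> ?thesis"
  hence no: "\<not> N dvd q - q'" "\<not> N dvd q + p + q'"
    "N dvd (2 + 4 * n) * p \<Longrightarrow> \<not> N dvd q + q' - 2 * n * p"
    "N dvd (2 + 4 * n) * p \<Longrightarrow> \<not> N dvd q - p - q' - 2 * n * p"
    using linked_sign[of N p p q q'] linked_reflected by auto
  from cong_pm_match2[OF assms(1,2)] assms(3,4)
  consider "cong_pm N (q - n * p) (q' - n * p)" "cong_pm N (q + (n + 1) * p) (q' + (n + 1) * p)"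
    | "cong_pm N (q - n * p) (q' + (n + 1) * p)" "cong_pm N (q + (n + 1) * p) (q' - n * p)" by blast
  thus False
  proof cases
    case 1
    have A: "N dvd q + q' - 2 * n * p" using 1(1) no(1) unfolding cong_pm_def by (simp add: algebra_simps)
    have B: "N dvd q + q' + 2 * (n + 1) * p" using 1(2) no(1) unfolding cong_pm_def by (simp add: algebra_simps)
    have "N dvd (2 + 4 * n) * p" by (rule dvd_combination[where i="1" and j="-1", OF B A]) (simp add: algebra_simps)
    thus False using no A by blast
  next
    case 2
    have "N dvd q - n * p - (q' + (n + 1) * p)" using 2(1) no(2) unfolding cong_pm_def by (simp add: algebra_simps)
    hence a: "N dvd q - p - q' - 2 * n * p" by (simp add: algebra_simps)
    have b: "N dvd q + (n + 1) * p - (q' - n * p)" using 2(2) no(2) unfolding cong_pm_def by (simp add: algebra_simps)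
    have "N dvd (2 + 4 * n) * p" by (rule dvd_combination[where i="1" and j="-1", OF b a]) (simp add: algebra_simps)
    thus False using no a by blast
  qed
qed

lemma attains_isosceles:
  assumes c: "1 \<le> c" and n: "\<not> is_square (c + of_int n ^ 2 + of_int n)" "c + of_int n ^ 2 + of_int n < 4 * c - 1"
    and R: "attains 1 c N p q (c + of_int n ^ 2 + of_int n) r"
  shows "cong_pm N r (q - n * p) \<or> cong_pm N r (q + (n + 1) * p)"
proof -
  have "0 \<le> (1::rat)" "1 \<le> (1::rat)" by auto
  from this c R n(2) show ?thesis
  proof (cases rule: attains_cases)
    case (square k)
    hence "is_square (c + of_int n ^ 2 + of_int n)" unfolding is_square_def by (intro exI[of _ "\<bar>k\<bar>"]) simp
    thus ?thesis using n by simp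
  next
    case (unit j)
    hence "(of_int (j + n) :: rat) * of_int (j - n - 1) = 0" by (simp add: power2_eq_square algebra_simps)
    hence "j = - n \<or> j = n + 1" by (simp only: mult_eq_0_iff of_int_eq_0_iff) auto
    thus ?thesis using unit by (auto simp: algebra_simps)
  qed
qed

lemma isosceles_value:
  assumes c: "1 \<le> c" and n: "\<not> is_square (c + of_int n ^ 2 + of_int n)" "c + of_int n ^ 2 + of_int n < 4 * c - 1"
    and R: "\<And>v r. attains 1 c N p q v r \<longleftrightarrow> attains 1 c N p q' v r"
  shows "linked 1 c N p q p q' \<or>
    N dvd (2 + 4 * n) * p \<and> (N dvd q + q' - 2 * n * p \<or> N dvd q - p - q' - 2 * n * p)"
proof -
  note * = attains_isosceles[OF c n]
  have a: "attains 1 c N p q (c + of_int n ^ 2 + of_int n) (q - n * p)" for q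
    using attains_unit[of 1 c N p q "-n"] by (simp add: algebra_simps)
  have b: "attains 1 c N p q (c + of_int n ^ 2 + of_int n) (q + (n + 1) * p)" for q
    using attains_unit[of 1 c N p q "n + 1"] by (simp add: algebra_simps power2_eq_square)
  show ?thesis
    by (rule isosceles_step) (use * a b R in blast)+
qed

text \<open>
  Consecutive squares differ by an odd number. Other squares differ by at least \<open>4 k + 4\<close>, where \<open>k\<^sup>2\<close>
  is the smaller one, and \<open>6\<close> itself is not a square.
\<close>
lemma is_square_plus_6: assumes "is_square c" shows "\<not> is_square (c + 6)"
proof
  assume "is_square (c + 6)"
  then obtain k m where km: "k \<ge> 0" "m \<ge> 0" "c = of_int k ^ 2" "c + 6 = of_int m ^ 2"
    using assms by (auto simp: is_square_def)
  hence "(of_int (k^2 + 6) :: rat) = of_int (m^2)" by simp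
  hence eq: "k^2 + 6 = m^2" by (simp only: of_int_eq_iff)
  hence "k < m" using km by (intro power_less_imp_less_base[of k 2 m]) auto
  then consider "m = k + 1" | "m \<ge> k + 2" by linarith
  thus False
  proof cases
    case 1
    thus False using eq by (simp add: power2_eq_square algebra_simps) presburger
  next
    case 2
    hence "(k + 2)^2 \<le> m^2" using km by (intro power_mono) auto
    hence "k = 0" using eq km by (simp add: power2_eq_square algebra_simps)
    hence "m * m = 6" using eq by (simp add: power2_eq_square)
    moreover have "m \<le> 2 \<or> m \<ge> 3" by auto
    ultimately show False using km mult_mono[of m 2 m 2] mult_mono[of 3 m 3 m] by auto
  qed
qed

text \<open>
  If \<open>c\<close> is a square, some \<open>(k, 0)\<close> has the same value as \<open>(0,1)\<close>, so the values \<open>c + 2\<close> and \<open>c + 6\<close>, which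
  are not squares, are used in place of \<open>c\<close>. Unless the functionals are linked, they give \<open>6 p = 0\<close>
  and \<open>10 p = 0\<close>, hence \<open>2 p = 0\<close>, and in that case the sign ambiguity is harmless.
\<close>
lemma linked_isosceles_long:
  assumes c: "1 < c" and R: "\<And>v r. attains 1 c N p q v r \<longleftrightarrow> attains 1 c N p q' v r"
  shows "linked 1 c N p q p q'"
proof (cases "is_square c")
  case False
  thus ?thesis using isosceles_value[of c 0 N p q q'] R c linked_two_torsion by auto
next
  case True
  have c4: "4 \<le> c" using is_square_ge4 True c by simp
  have "\<not> is_square (c + 2)" using is_square_gap3[OF True, of "c + 2"] c by auto
  hence 1: "linked 1 c N p q p q' \<or>
    N dvd 6 * p \<and> (N dvd q + q' - 2 * p \<or> N dvd q - p - q' - 2 * p)"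
    using isosceles_value[of c 1 N p q q'] R c4 by (auto simp: add.commute)
  have 2: "linked 1 c N p q p q' \<or> N dvd 10 * p"
    using isosceles_value[of c 2 N p q q'] is_square_plus_6[OF True] R c4 by (auto simp: add.commute)
  show ?thesis
  proof (rule ccontr)
    assume not: "\<not> ?thesis"
    hence *: "N dvd 6 * p" "N dvd 10 * p" "N dvd q + q' - 2 * p \<or> N dvd q - p - q' - 2 * p"
      using 1 2 by auto
    have "2 * p = 2 * (6 * p) - 10 * p" by simp
    hence p: "N dvd 2 * p" using *(1,2) by (metis dvd_diff dvd_mult)
    have "q + q' = (q + q' - 2 * p) + 2 * p" "q - p - q' = (q - p - q' - 2 * p) + 2 * p" by simp_all
    hence "N dvd q + q' \<or> N dvd q - p - q'" using *(3) p dvd_add by metis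
    thus False using linked_two_torsion p not by blast
  qed
qed

section \<open>The hexagonal form\<close>

lemma hex_norm_3:
  assumes "binform 1 1 x y = 3"
  shows "(x,y) \<in> {(1,-1),(-1,1),(2,1),(-2,-1),(1,2),(-1,-2)}"
proof -
  have "of_int (x*x - x*y + y*y) = (of_int 3 :: rat)" using assms by (simp add: binform_def power2_eq_square)
  hence *: "x*x - x*y + y*y = 3" by (simp only: of_int_eq_iff)
  have "(2*x-y)^2 + 3 * y^2 = 12" "(2*y-x)^2 + 3 * x^2 = 12"
    using * by (simp_all add: power2_eq_square algebra_simps)
  hence "3 * y^2 \<le> 12" "3 * x^2 \<le> 12"
    using zero_le_power2[of "2*x-y"] zero_le_power2[of "2*y-x"] by linarith+
  hence "\<bar>y\<bar>^2 < 3^2" "\<bar>x\<bar>^2 < 3^2" by simp_all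
  hence "\<bar>x\<bar> < 3" "\<bar>y\<bar> < 3" using power_less_imp_less_base[of _ 2 "3::int"] by auto
  hence "x \<in> {-2,-1,0,1,2}" "y \<in> {-2,-1,0,1,2}" by auto
  thus ?thesis using * by auto
qed

lemma attains_hex_3:
  assumes "attains 1 1 N p q 3 r" shows "cong_pm N r (p - q) \<or> cong_pm N r (2 * p + q) \<or> cong_pm N r (p + 2 * q)"
proof -
  obtain x y where xy: "binform 1 1 x y = 3" "N dvd r - (p * x + q * y)"
    using assms by (auto simp: attains_def)
  show ?thesis using hex_norm_3[OF xy(1)] xy(2) by (auto simp: cong_pm_def algebra_simps)
qed

lemma attains_hex_1:
  assumes "attains 1 1 N p q 1 r" shows "cong_pm N r p \<or> cong_pm N r q \<or> cong_pm N r (p + q)"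
proof -
  have "0 \<le> (1::rat)" "(1::rat) \<le> 1" "(1::rat) \<le> 1" "(1::rat) < 4 * 1 - 1" by auto
  from this(1-3) assms this(4) show ?thesis
  proof (cases rule: attains_cases)
    case (square k)
    hence "k = 1 \<or> k = -1" by (metis of_int_1 of_int_eq_iff of_int_power power2_eq_1_iff)
    thus ?thesis using square by (auto simp: cong_pm_uminus)
  next
    case (unit j)
    hence "(of_int j :: rat) * of_int (j - 1) = 0" by (simp add: power2_eq_square algebra_simps)
    hence "j = 0 \<or> j = 1" by (simp only: mult_eq_0_iff of_int_eq_0_iff) auto
    thus ?thesis using unit by (auto simp: add.commute)
  qed
qed

text \<open>
  The shortest vectors of the hexagonal form have the residues \<open>p\<close>, \<open>q\<close>, \<open>p + q\<close> up to sign. If the sets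
  of these classes agree for two functionals but not with multiplicity, one functional takes the
  class of \<open>p\<close> twice and the other one takes another class twice. This leads to \<open>5 p = 0\<close>, where the
  set of shortest residues really does not decide (\<open>1, 1, 2\<close> and \<open>1, 2, 2\<close> modulo \<open>5\<close>). The vectors of
  value \<open>3\<close> do.
\<close>
lemma hex_asymmetric:
  assumes q: "cong_pm N q p \<or> cong_pm N (p + q) p" and q': "\<not> cong_pm N q' p" "\<not> cong_pm N (p + q') p"
    and 1: "cong_pm N q' q \<or> cong_pm N q' (p + q)" "cong_pm N (p + q') q \<or> cong_pm N (p + q') (p + q)"
    and 3: "cong_pm N (p - q') (p - q) \<or> cong_pm N (p - q') (2 * p + q) \<or> cong_pm N (p - q') (p + 2 * q)"
  shows False
proof -
  have p0: "\<not> (N dvd p \<and> N dvd q')"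
  proof
    assume "N dvd p \<and> N dvd q'"
    hence "N dvd q' - p" by auto
    thus False using q'(1) by (simp add: cong_pm_def)
  qed
  \<comment> \<open>the residue of the short vector of the first functional that is not in the class of \<open>p\<close>\<close>
  obtain u where u: "cong_pm N q' u" "cong_pm N (p + q') u"
    and u02: "N dvd u \<or> (N dvd u - 2 * p \<or> N dvd u + 2 * p) \<and> (N dvd q - p \<or> N dvd q + 2 * p)"
  proof (cases "cong_pm N q p")
    case True
    hence "cong_pm N q' (p + q)" "cong_pm N (p + q') (p + q)" using 1 q' cong_pm_trans by blast+
    moreover have "N dvd p + q \<or> N dvd (p + q) - 2 * p \<and> N dvd q - p"
      using True by (auto simp: cong_pm_def add.commute)
    ultimately show ?thesis using that by blast
  next
    case False
    hence *: "cong_pm N (p + q) p" using q by blast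
    hence "cong_pm N q' q" "cong_pm N (p + q') q" using 1 q' cong_pm_trans by blast+
    moreover have "N dvd q \<or> N dvd q + 2 * p" using * by (auto simp: cong_pm_def algebra_simps mult_2)
    ultimately show ?thesis using that by blast
  qed
  show False
  proof (cases "N dvd u")
    case True
    have "q' = (q' - u) + u" "q' = (q' + u) - u" "p + q' = (p + q' - u) + u" "p + q' = (p + q' + u) - u" by simp_all
    hence "N dvd q'" "N dvd p + q'" using u True unfolding cong_pm_def by (metis dvd_add dvd_diff)+
    thus False using p0 by (metis dvd_add_left_iff)
  next
    case False
    hence u2: "N dvd u - 2 * p \<or> N dvd u + 2 * p" and qp: "N dvd q - p \<or> N dvd q + 2 * p" using u02 by auto
    have u2: "cong_pm N u (2 * p)" using u2 by (simp add: cong_pm_def)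
    have a: "cong_pm N q' (2 * p)" "cong_pm N (p + q') (2 * p)" using u u2 cong_pm_trans by blast+
    have one: "\<not> N dvd p"
    proof
      assume *: "N dvd p"
      hence "cong_pm N p 0" "N dvd 2 * p" by (simp_all add: cong_pm_def)
      hence "N dvd q'" using a(1) unfolding cong_pm_def by (metis dvd_add_left_iff dvd_diff_left_iff)
      thus False using * p0 by blast
    qed
    have "N dvd q' - 2 * p"
    proof (rule ccontr)
      assume "\<not> ?thesis"
      hence b: "N dvd q' + 2 * p" using a(1) by (simp add: cong_pm_def)
      from a(2) show False unfolding cong_pm_def
      proof
        assume "N dvd p + q' - 2 * p"
        hence "N dvd q' - p" by (simp add: algebra_simps)
        thus False using q' by (simp add: cong_pm_def)
      next
        assume h: "N dvd p + q' + 2 * p"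
        have "N dvd p" by (rule dvd_combination[where i="1" and j="-1", OF h b]) (simp add: algebra_simps)
        thus False using one by blast
      qed
    qed
    moreover have "N dvd 5 * p"
      using a(2) unfolding cong_pm_def
    proof
      assume h: "N dvd p + q' - 2 * p"
      have "N dvd p" by (rule dvd_combination[where i="1" and j="-1", OF h \<open>N dvd q' - 2 * p\<close>]) (simp add: algebra_simps)
      thus ?thesis using one by blast
    next
      assume h: "N dvd p + q' + 2 * p"
      show ?thesis by (rule dvd_combination[where i="1" and j="-1", OF h \<open>N dvd q' - 2 * p\<close>]) (simp add: algebra_simps)
    qed
    ultimately have q'2: "N dvd q' - 2 * p" and p5: "N dvd 5 * p" by auto
    have "cong_pm N (p - q') p" using q'2 by (auto simp: cong_pm_def algebra_simps)
    hence 3: "cong_pm N p (p - q) \<or> cong_pm N p (2 * p + q) \<or> cong_pm N p (p + 2 * q)" using 3 cong_pm_trans cong_pm_sym by blast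
    \<comment> \<open>the vectors of value \<open>3\<close> have the residues \<open>0\<close> and \<open>\<plusminus>3 p\<close> for the first functional, but one of them has \<open>\<plusminus>p\<close> for the second\<close>
    have z: "N dvd p - q \<or> cong_pm N (p - q) (3 * p)" "N dvd 2 * p + q \<or> cong_pm N (2 * p + q) (3 * p)"
      "N dvd p + 2 * q \<or> cong_pm N (p + 2 * q) (3 * p)"
    proof -
      from qp show "N dvd p - q \<or> cong_pm N (p - q) (3 * p)"
      proof
        assume "N dvd q - p" thus ?thesis by (simp add: dvd_diff_commute)
      next
        assume h: "N dvd q + 2 * p"
        have "N dvd (p - q) - 3 * p" by (rule dvd_combination[where i="-1" and j="0", OF h h]) (simp add: algebra_simps)
        thus ?thesis by (simp add: cong_pm_def)
      qed
      from qp show "N dvd 2 * p + q \<or> cong_pm N (2 * p + q) (3 * p)"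
      proof
        assume "N dvd q + 2 * p" thus ?thesis by (simp add: add.commute)
      next
        assume h: "N dvd q - p"
        have "N dvd (2 * p + q) - 3 * p" by (rule dvd_combination[where i="1" and j="0", OF h h]) (simp add: algebra_simps)
        thus ?thesis by (simp add: cong_pm_def)
      qed
      from qp show "N dvd p + 2 * q \<or> cong_pm N (p + 2 * q) (3 * p)"
      proof
        assume h: "N dvd q - p"
        have "N dvd (p + 2 * q) - 3 * p" by (rule dvd_combination[where i="2" and j="0", OF h h]) (simp add: algebra_simps)
        thus ?thesis by (simp add: cong_pm_def)
      next
        assume h: "N dvd q + 2 * p"
        have "N dvd (p + 2 * q) + 3 * p" by (rule dvd_combination[where i="2" and j="0", OF h h]) (simp add: algebra_simps)
        thus ?thesis by (simp add: cong_pm_def)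
      qed
    qed
    have "cong_pm N p r \<Longrightarrow> N dvd r \<Longrightarrow> N dvd p" for r
      unfolding cong_pm_def by (metis dvd_add_left_iff dvd_diff_left_iff)
    hence "cong_pm N p (3 * p)" using 3 z one cong_pm_trans by blast
    thus False unfolding cong_pm_def
    proof
      assume "N dvd p - 3 * p"
      hence "N dvd 2 * (p - 3 * p) + 5 * p" using dvd_add[OF dvd_mult p5] by blast
      hence "N dvd p" by simp
      thus False using one by blast
    next
      assume "N dvd p + 3 * p"
      hence "N dvd 5 * p - (p + 3 * p)" using p5 by (intro dvd_diff)
      hence "N dvd p" by simp
      thus False using one by blast
    qed
  qed
qed

lemma hex_reps:
  "attains 1 1 N p q 1 p" "attains 1 1 N p q 1 q" "attains 1 1 N p q 1 (p + q)" "attains 1 1 N p q 3 (p - q)"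
  using attains_one attains_unit[of 1 1 N p q 0] attains_unit[of 1 1 N p q 1] attains_unit[of 1 1 N "-p" "-q" 1]
    attainsI[of 1 1 N p q 1 "-1"]
  by (simp_all add: add.commute binform_def)

text \<open>
  Here the functionals already agree at \<open>(1,0)\<close>. By \<open>hex_asymmetric\<close> the remaining two classes match
  as a pair, which is the situation of \<open>isosceles_step\<close> for \<open>n = 0\<close>.
\<close>
lemma linked_hex_common_first:
  assumes R: "\<And>v r. attains 1 1 N p q v r \<longleftrightarrow> attains 1 1 N p q' v r"
  shows "linked 1 1 N p q p q'"
proof -
  have q1: "cong_pm N q p \<or> cong_pm N q q' \<or> cong_pm N q (p + q')" "cong_pm N (p + q) p \<or> cong_pm N (p + q) q' \<or> cong_pm N (p + q) (p + q')"
     "cong_pm N q' p \<or> cong_pm N q' q \<or> cong_pm N q' (p + q)" "cong_pm N (p + q') p \<or> cong_pm N (p + q') q \<or> cong_pm N (p + q') (p + q)"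
    using hex_reps(2,3) attains_hex_1 R by metis+
  have q3: "cong_pm N (p - q') (p - q) \<or> cong_pm N (p - q') (2 * p + q) \<or> cong_pm N (p - q') (p + 2 * q)"
    "cong_pm N (p - q) (p - q') \<or> cong_pm N (p - q) (2 * p + q') \<or> cong_pm N (p - q) (p + 2 * q')"
    using hex_reps(4) attains_hex_3 R by metis+
  have iff: "(cong_pm N q p \<or> cong_pm N (p + q) p) \<longleftrightarrow> (cong_pm N q' p \<or> cong_pm N (p + q') p)"
    using hex_asymmetric[of N q p q'] hex_asymmetric[of N q' p q] q1 q3 by blast
  have "(cong_pm N q q' \<or> cong_pm N q (p + q')) \<and> (cong_pm N (p + q) q' \<or> cong_pm N (p + q) (p + q')) \<and> 
     (cong_pm N q' q \<or> cong_pm N q' (p + q)) \<and> (cong_pm N (p + q') q \<or> cong_pm N (p + q') (p + q))"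
    using iff q1 cong_pm_trans cong_pm_sym by meson
  hence "linked 1 1 N p q p q' \<or> N dvd 2 * p \<and> (N dvd q + q' \<or> N dvd q - p - q')"
    using isosceles_step[of N q 0 p q' 1] by (simp add: add.commute)
  thus ?thesis using linked_two_torsion by blast
qed

lemma linked_via:
  assumes R: "\<And>v r. attains \<alpha> c N p q v r \<longleftrightarrow> attains \<alpha> c N p' q' v r"
    and l: "linked \<alpha> c N p' q' p'' q''"
    and *: "(\<And>v r. attains \<alpha> c N p q v r \<longleftrightarrow> attains \<alpha> c N p'' q'' v r) \<Longrightarrow> linked \<alpha> c N p q p'' q''"
  shows "linked \<alpha> c N p q p' q'"
  using linked_trans[OF * linked_sym[OF l]] linked_attains[OF l] R by blast

lemma linked_cong_pm:
  assumes "cong_pm N p' p" obtains q'' where "linked \<alpha> c N p' q' p q''"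
proof -
  have "linked \<alpha> c N p' q' p q'" if "N dvd p' - p" using that by (intro linked_sign) auto
  moreover have "linked \<alpha> c N p' q' p (-q')" if "N dvd p' + p" using that by (intro linked_sign) auto
  ultimately show ?thesis using assms that unfolding cong_pm_def by blast
qed

text \<open>
  Some shortest vector has the residue \<open>p\<close> for the second functional, up to sign, and a rotation
  moves it to \<open>(1,0)\<close>.
\<close>
lemma linked_hex:
  assumes R: "\<And>v r. attains 1 1 N p q v r \<longleftrightarrow> attains 1 1 N p' q' v r"
  shows "linked 1 1 N p q p' q'"
proof -
  have "cong_pm N p p' \<or> cong_pm N p q' \<or> cong_pm N p (p' + q')" using R attains_hex_1 attains_one by metis
  then obtain a b where ab: "linked 1 1 N p' q' a b" "cong_pm N a p"
  proof (elim disjE)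
    assume "cong_pm N p p'" 
    moreover have "linked 1 1 N p' q' p' q'" by (rule linked_sign) simp
    ultimately show ?thesis using that cong_pm_sym by blast
  next
    assume "cong_pm N p q'"
    thus ?thesis using that linked_rotate cong_pm_sym by blast
  next
    assume "cong_pm N p (p' + q')"
    hence "cong_pm N (- p' - q') p" using cong_pm_sym cong_pm_uminus(1)[of N "p' + q'" p] by simp
    thus ?thesis using that linked_trans[OF linked_rotate linked_rotate] by blast
  qed
  obtain b' where "linked 1 1 N a b p b'" using linked_cong_pm ab(2) by blast
  hence l: "linked 1 1 N p' q' p b'" using ab(1) linked_trans by blast
  show ?thesis using linked_via[OF R l] linked_hex_common_first by blast
qed

theorem linked_if_same_attains:
  assumes "0 \<le> \<alpha>" "\<alpha> \<le> 1" "1 \<le> c"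
    and R: "\<And>v r. attains \<alpha> c N p q v r \<longleftrightarrow> attains \<alpha> c N p' q' v r"
  shows "linked \<alpha> c N p q p' q'"
proof -
  consider "\<alpha> < 1" "c = 1" | "\<alpha> < 1" "1 < c" | "\<alpha> = 1" "c = 1" | "\<alpha> = 1" "1 < c"
    using assms by fastforce
  thus ?thesis
  proof cases
    case 1
    thus ?thesis using linked_acute_rhombic assms by blast
  next
    case 2
    thus ?thesis using linked_acute_long assms by blast
  next
    case 3
    thus ?thesis using linked_hex R by blast
  next
    case 4
    have "cong_pm N p' p" using cong_pm_at_one[of 1 c N p q p'] R attains_one 4 by auto
    then obtain q'' where l: "linked 1 c N p' q' p q''" by (rule linked_cong_pm)
    show ?thesis using linked_via[of 1 c N p q p' q' p q''] linked_isosceles_long 4 R l by blast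
  qed
qed

text \<open>
  In \<open>x\<^sup>2 + 3 y\<^sup>2\<close> only \<open>\<plusminus>(1,0)\<close> has value \<open>1\<close>, so \<open>p\<close>, \<open>q\<close> and \<open>p + q\<close> all agree with \<open>p'\<close> up to sign. Only
  \<open>\<plusminus>(0,1)\<close> has value \<open>3\<close>, and in the hexagonal form \<open>(1,-1)\<close> has value \<open>3\<close> and residue \<open>p - q\<close>.
\<close>
theorem residues_exceptional:
  assumes R: "\<And>v r. attains 1 1 N p q v r \<longleftrightarrow> attains 0 3 N p' q' v r"
  shows "N dvd q - p" "N dvd 3 * p" "cong_pm N p' p" "N dvd q'"
proof -
  have "cong_pm N r p'" if "attains 0 3 N p' q' 1 r" for r using cong_pm_at_one[of 0 3 N p' q' r] that by simp
  hence 1: "cong_pm N p p'" "cong_pm N q p'" "cong_pm N (p + q) p'" using R hex_reps by blast+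
  show "cong_pm N p' p" by (rule cong_pm_sym[OF 1(1)])
  have *: "cong_pm N q p" "cong_pm N (p + q) p" using 1 cong_pm_trans cong_pm_sym by blast+
  have "N dvd q - p \<and> N dvd 3 * p"
    using *(1) unfolding cong_pm_def
  proof
    assume a: "N dvd q - p"
    from *(2) show ?thesis unfolding cong_pm_def
    proof
      assume h: "N dvd p + q - p"
      have "N dvd 3 * p" by (rule dvd_combination[where i="3" and j="-3", OF h a]) (simp add: algebra_simps)
      thus ?thesis using a by blast
    next
      assume h: "N dvd p + q + p"
      have "N dvd 3 * p" by (rule dvd_combination[where i="1" and j="-1", OF h a]) (simp add: algebra_simps)
      thus ?thesis using a by blast
    qed
  next
    assume a: "N dvd q + p"
    from *(2) show ?thesis unfolding cong_pm_def
    proof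
      assume h: "N dvd p + q - p"
      have "N dvd 3 * p" by (rule dvd_combination[where i="-3" and j="3", OF h a]) (simp add: algebra_simps)
      moreover have "N dvd q - p" by (rule dvd_combination[where i="2" and j="-1", OF h a]) (simp add: algebra_simps)
      ultimately show ?thesis by blast
    next
      assume h: "N dvd p + q + p"
      have "N dvd 3 * p" by (rule dvd_combination[where i="3" and j="-3", OF h a]) (simp add: algebra_simps)
      moreover have "N dvd q - p" by (rule dvd_combination[where i="-2" and j="3", OF h a]) (simp add: algebra_simps)
      ultimately show ?thesis by blast
    qed
  qed
  thus qp: "N dvd q - p" and "N dvd 3 * p" by auto
  have r3: "attains 0 3 N p' q' 3 (p - q)" using R hex_reps by blast
  have le: "0 \<le> (0::rat)" "0 \<le> (1::rat)" "1 \<le> (3::rat)" "3 < 4 * 3 - (0::rat)" by auto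
  from le(1-3) r3 le(4) have "cong_pm N (p - q) q'"
  proof (cases rule: attains_cases)
    case (square k)
    hence "is_square 3" unfolding is_square_def by (intro exI[of _ "\<bar>k\<bar>"]) simp
    thus ?thesis using is_square_ge4[of 3] by simp
  next
    case (unit j)
    thus ?thesis by simp
  qed
  thus "N dvd q'" using qp unfolding cong_pm_def
    by (metis dvd_add_right_iff dvd_diff_commute dvd_diff_right_iff)
qed

section \<open>Pairs of ternary forms and the group action\<close>

abbreviation of_int_vec :: "int^3 \<Rightarrow> rat^3" where
  "of_int_vec v \<equiv> (\<chi> i. of_int (v $ i))"

lemmas mat3_simps = vec_eq_iff forall_3 sum_3 matrix_matrix_mult_def vector_matrix_mult_def

text \<open>
  The six entries of a symmetric matrix are read off at the coordinate vectors and their pairwise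
  sums.
\<close>
lemma form_eval_ext:
  assumes "A \<in> tern_forms" "B \<in> tern_forms" "\<And>x. form_eval A x = form_eval B x"
  shows "A = B"
proof -
  have "A$2$1 = A$1$2" "A$3$1 = A$1$3" "A$3$2 = A$2$3" "B$2$1 = B$1$2" "B$3$1 = B$1$3" "B$3$2 = B$2$3"
    using assms(1,2) by (simp_all add: tern_forms_def transpose_def vec_eq_iff)
  moreover have "form_eval A (vector [a,b,c]) = form_eval B (vector [a,b,c])" for a b c
    using assms(3) by blast
  note this[of 1 0 0] this[of 0 1 0] this[of 0 0 1] this[of 1 1 0] this[of 1 0 1] this[of 0 1 1]
  ultimately show ?thesis
    by (simp add: form_eval_def sum_3 vec_eq_iff forall_3)
qed

lemma form_eval_add: "form_eval (A + B) x = form_eval A x + form_eval B x"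
  by (simp add: form_eval_def distrib_right sum.distrib)

lemma form_eval_scale: "form_eval (mat_scale c A) x = c * form_eval A x"
  by (simp add: form_eval_def mat_scale_def map_matrix_def sum_distrib_left mult.assoc)

lemma mat_scale_nth [simp]: "mat_scale c A $ i $ j = c * A $ i $ j"
  by (simp add: mat_scale_def map_matrix_def)

lemma map_matrix_nth [simp]: "map_matrix f A $ i $ j = f (A $ i $ j)"
  by (simp add: map_matrix_def)

lemma tern_forms_iff: "A \<in> tern_forms \<longleftrightarrow> (\<forall>i j. A $ i $ j = A $ j $ i)"
  by (auto simp: tern_forms_def transpose_def vec_eq_iff)

lemma tern_forms_tern_form [simp]: "tern_form a b c d e f \<in> tern_forms"
  by (simp add: tern_forms_iff tern_form_def forall_3)

lemma tern_forms_lin_square [simp]: "lin_square l \<in> tern_forms"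
  by (simp add: tern_forms_iff lin_square_def mult.commute)

lemma tern_forms_combination:
  "A \<in> tern_forms \<Longrightarrow> B \<in> tern_forms \<Longrightarrow> mat_scale c A + mat_scale d B \<in> tern_forms"
  by (auto simp: tern_forms_iff)

lemma tern_forms_subst: "A \<in> tern_forms \<Longrightarrow> subst_form w A \<in> tern_forms"
  by (simp add: tern_forms_def subst_form_def matrix_transpose_mul matrix_mul_assoc)

lemma mat_1_nth [simp]:
  "(mat 1 :: rat^2^2)$1$1 = 1" "(mat 1 :: rat^2^2)$1$2 = 0" "(mat 1 :: rat^2^2)$2$1 = 0" "(mat 1 :: rat^2^2)$2$2 = 1"
  by (simp_all add: mat_def)

lemma pair_act_eval:
  "form_eval (fst (pair_act w g P)) x = g$1$1 * form_eval (fst P) (x v* w) + g$1$2 * form_eval (snd P) (x v* w)"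
  "form_eval (snd (pair_act w g P)) x = g$2$1 * form_eval (fst P) (x v* w) + g$2$2 * form_eval (snd P) (x v* w)"
  by (simp_all add: pair_act_def Let_def form_eval_add form_eval_scale form_eval_subst_form)

lemma pair_act_forms:
  assumes "fst P \<in> tern_forms" "snd P \<in> tern_forms"
  shows "fst (pair_act w g P) \<in> tern_forms" "snd (pair_act w g P) \<in> tern_forms"
  using assms by (simp_all add: pair_act_def Let_def tern_forms_combination tern_forms_subst)

text \<open>
  Equality of pairs of forms is proved by evaluation throughout, which turns the action of
  matrices into substitution of vectors.
\<close>
lemma pair_eqI:
  assumes "fst P \<in> tern_forms" "snd P \<in> tern_forms" "fst Q \<in> tern_forms" "snd Q \<in> tern_forms"
    and "\<And>x. form_eval (fst P) x = g$1$1 * form_eval (fst Q) (x v* w) + g$1$2 * form_eval (snd Q) (x v* w)"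
    and "\<And>x. form_eval (snd P) x = g$2$1 * form_eval (fst Q) (x v* w) + g$2$2 * form_eval (snd Q) (x v* w)"
  shows "P = pair_act w g Q"
  using assms by (intro prod_eqI form_eval_ext) (simp_all add: pair_act_eval pair_act_forms)

lemma pair_act_comp:
  assumes "fst P \<in> tern_forms" "snd P \<in> tern_forms"
  shows "pair_act w g (pair_act w' g' P) = pair_act (w ** w') (g ** g') P"
  using assms
  by (intro pair_eqI)
     (simp_all add: pair_act_eval pair_act_forms vector_matrix_mul_assoc matrix_matrix_mult_def sum_2 algebra_simps)

lemma pair_act_id:
  assumes "fst P \<in> tern_forms" "snd P \<in> tern_forms"
  shows "pair_act (mat 1) (mat 1) P = P"
  by (rule sym, rule pair_eqI) (use assms in auto)

lemma GL3Z_I: "invertible w \<Longrightarrow> map_matrix of_int w \<in> GL3Z"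
  by (auto simp: GL3Z_def)

lemma map_matrix_of_int_mult:
  "map_matrix of_int (A ** B :: int^3^3) = (map_matrix of_int A ** map_matrix of_int B :: rat^3^3)"
  by (simp add: vec_eq_iff matrix_matrix_mult_def)

lemma map_matrix_of_int_1: "map_matrix of_int (mat 1 :: int^3^3) = (mat 1 :: rat^3^3)"
  by (simp add: vec_eq_iff mat_def)

lemma of_int_vec_mult: "of_int_vec (v v* w) = of_int_vec v v* map_matrix of_int w"
  by (simp add: vec_eq_iff vector_matrix_mult_def)

lemma GL3Z_mult: "a \<in> GL3Z \<Longrightarrow> b \<in> GL3Z \<Longrightarrow> a ** b \<in> GL3Z"
proof -
  assume "a \<in> GL3Z" "b \<in> GL3Z"
  then obtain v w :: "int^3^3" where "a = map_matrix of_int v" "b = map_matrix of_int w" "invertible v" "invertible w"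
    by (auto simp: GL3Z_def)
  thus ?thesis by (simp add: map_matrix_of_int_mult [symmetric] GL3Z_I invertible_mult)
qed

lemma GL3Z_1: "mat 1 \<in> GL3Z"
  unfolding map_matrix_of_int_1 [symmetric]
  by (intro GL3Z_I) (auto simp: invertible_def intro: exI[of _ "mat 1"])

lemma GL3Z_inverse:
  assumes "a \<in> GL3Z" obtains b where "b \<in> GL3Z" "a ** b = mat 1" "b ** a = mat 1"
proof -
  obtain w :: "int^3^3" and w' where w: "a = map_matrix of_int w" "w ** w' = mat 1" "w' ** w = mat 1"
    using assms by (auto simp: GL3Z_def invertible_def)
  show ?thesis
  proof (rule that[of "map_matrix of_int w'"])
    show "map_matrix of_int w' \<in> GL3Z" using w by (intro GL3Z_I) (auto simp: invertible_def)
    show "a ** map_matrix of_int w' = mat 1" "map_matrix of_int w' ** a = mat 1"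
      unfolding w(1) map_matrix_of_int_mult [symmetric] w(2,3) map_matrix_of_int_1 by auto
  qed
qed

lemma vector_matrix_mult_nonzero:
  fixes w :: "int^3^3" assumes "invertible w" "v \<noteq> 0" shows "v v* w \<noteq> 0"
proof
  assume *: "v v* w = 0"
  obtain w' where w': "w ** w' = mat 1" using assms(1) by (auto simp: invertible_def)
  have "v = (v v* w) v* w'" by (simp add: vector_matrix_mul_assoc w')
  thus False using * assms(2) by simp
qed

lemma qZ_pair_act_subset:
  assumes "w \<in> GL3Z"
  shows "qZ (pair_act w g P) \<subseteq> (\<lambda>(s, t). (g$1$1 * s + g$1$2 * t, g$2$1 * s + g$2$2 * t)) ` qZ P"
proof
  fix z assume "z \<in> qZ (pair_act w g P)"
  then obtain v :: "int^3" where v: "v \<noteq> 0"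
    "z = (form_eval (fst (pair_act w g P)) (of_int_vec v), form_eval (snd (pair_act w g P)) (of_int_vec v))"
    by (auto simp: qZ_def)
  obtain w' where w': "w = map_matrix of_int w'" "invertible w'" using assms by (auto simp: GL3Z_def)
  have "(form_eval (fst P) (of_int_vec (v v* w')), form_eval (snd P) (of_int_vec (v v* w'))) \<in> qZ P"
    using vector_matrix_mult_nonzero[OF w'(2) v(1)] unfolding qZ_def by blast
  thus "z \<in> (\<lambda>(s, t). (g$1$1 * s + g$1$2 * t, g$2$1 * s + g$2$2 * t)) ` qZ P"
    unfolding v(2) pair_act_eval w'(1) of_int_vec_mult by (rule rev_image_eqI) simp
qed

lemma qZ_GL3Z_subset: "w \<in> GL3Z \<Longrightarrow> qZ (pair_act w (mat 1) P) \<subseteq> qZ P"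
  using qZ_pair_act_subset[of w "mat 1" P] by (simp add: mat_def)

lemma qZ_pair_act:
  assumes "w \<in> GL3Z" "fst P \<in> tern_forms" "snd P \<in> tern_forms"
  shows "qZ (pair_act w g P) = (\<lambda>(s, t). (g$1$1 * s + g$1$2 * t, g$2$1 * s + g$2$2 * t)) ` qZ P"
proof
  show "qZ (pair_act w g P) \<subseteq> (\<lambda>(s, t). (g$1$1 * s + g$1$2 * t, g$2$1 * s + g$2$2 * t)) ` qZ P"
    using qZ_pair_act_subset assms by blast
next
  obtain w' where w': "w' \<in> GL3Z" "w' ** w = mat 1" using GL3Z_inverse assms(1) by metis
  have "P = pair_act w' (mat 1) (pair_act w (mat 1) P)"
    using assms(2,3) by (simp add: pair_act_comp w' pair_act_id)
  hence sub: "qZ P \<subseteq> qZ (pair_act w (mat 1) P)" using qZ_GL3Z_subset[OF w'(1)] by metis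
  have "(\<lambda>(s, t). (g$1$1 * s + g$1$2 * t, g$2$1 * s + g$2$2 * t)) ` qZ (pair_act w (mat 1) P) \<subseteq> qZ (pair_act w g P)"
    unfolding qZ_def pair_act_eval by (force simp: mat_def)
  thus "(\<lambda>(s, t). (g$1$1 * s + g$1$2 * t, g$2$1 * s + g$2$2 * t)) ` qZ P \<subseteq> qZ (pair_act w g P)"
    using sub by blast
qed

lemma qZ_GL3Z:
  assumes "w \<in> GL3Z" "fst P \<in> tern_forms" "snd P \<in> tern_forms"
  shows "qZ (pair_act w (mat 1) P) = qZ P"
  by (simp add: qZ_pair_act[OF assms] mat_def)

lemma invertible_det_unit:
  fixes w :: "int^3^3" assumes "\<bar>det w\<bar> = 1" shows "invertible w"
proof -
  define d where "d = det w"
  have d: "d * d = 1" using assms by (metis abs_mult_self_eq d_def mult_1)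
  define a :: "int^3^3" where "a = vector
     [vector [w$2$2*w$3$3 - w$2$3*w$3$2, w$1$3*w$3$2 - w$1$2*w$3$3, w$1$2*w$2$3 - w$1$3*w$2$2],
      vector [w$2$3*w$3$1 - w$2$1*w$3$3, w$1$1*w$3$3 - w$1$3*w$3$1, w$1$3*w$2$1 - w$1$1*w$2$3],
      vector [w$2$1*w$3$2 - w$2$2*w$3$1, w$1$2*w$3$1 - w$1$1*w$3$2, w$1$1*w$2$2 - w$1$2*w$2$1]]"
  have 1: "w ** a = mat d" "a ** w = mat d"
    by (simp_all add: a_def d_def det_3 mat3_simps mat_def algebra_simps)
  have "w ** (a ** mat d) = mat 1" "(a ** mat d) ** w = mat 1"
  proof -
    have dd: "mat d ** mat d = (mat 1 :: int^3^3)" using d by (simp add: mat3_simps mat_def)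
    have "w ** (a ** mat d) = mat d ** mat d" by (simp add: matrix_mul_assoc 1)
    thus "w ** (a ** mat d) = mat 1" using dd by simp
    have "mat d ** w = w ** mat d" by (simp add: mat3_simps mat_def algebra_simps)
    hence "(a ** mat d) ** w = (a ** w) ** mat d" by (metis matrix_mul_assoc)
    thus "(a ** mat d) ** w = mat 1" using dd 1 by simp
  qed
  thus ?thesis by (auto simp: invertible_def)
qed

text \<open>
  Two steps of the Euclidean algorithm, on the first two and then on the last two coordinates. An
  integral zero of a form thus becomes a multiple of the third basis vector.
\<close>
lemma kernel_basis:
  fixes v :: "int^3"
  obtains w :: "int^3^3" and g where "invertible w" "v = vector [0, 0, g] v* w"
proof -
  have bezout_step: "\<exists>s t s' t' d. s * t' - t * s' = 1 \<and> a * s + b * s' = 0 \<and> a * t + b * t' = (d :: int)" for a b :: int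
  proof (cases "a = 0 \<and> b = 0")
    case True
    thus ?thesis by (intro exI[of _ 1] exI[of _ 0]) auto
  next
    case False
    obtain x y where xy: "a * x + b * y = gcd a b" using bezout_int[of a b] by (metis mult.commute)
    have g: "gcd a b \<noteq> 0" using False by simp
    have ab: "a = gcd a b * (a div gcd a b)" "b = gcd a b * (b div gcd a b)" by simp_all
    define a' b' where "a' = a div gcd a b" and "b' = b div gcd a b"
    have "gcd a b * (a' * x + b' * y) = gcd a b * 1"
      using xy ab unfolding a'_def b'_def by (metis distrib_left mult.assoc mult.right_neutral)
    hence one: "a' * x + b' * y = 1" using g by (simp only: mult_cancel_left) simp
    have "a * b' = b * a'" using ab unfolding a'_def b'_def by (metis mult.commute mult.assoc)
    thus ?thesis using xy one
      by (intro exI[of _ b'] exI[of _ x] exI[of _ "-a'"] exI[of _ y] exI[of _ "gcd a b"]) (simp add: algebra_simps)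
  qed
  obtain s t s' t' d where 1: "s * t' - t * s' = 1" "v$1 * s + v$2 * s' = 0" "v$1 * t + v$2 * t' = d"
    using bezout_step by blast
  obtain p q p' q' e where 2: "p * q' - q * p' = 1" "d * p + v$3 * p' = 0" "d * q + v$3 * q' = e"
    using bezout_step by blast
  define u1 :: "int^3^3" where "u1 = vector [vector [s, t, 0], vector [s', t', 0], vector [0, 0, 1]]"
  define u2 :: "int^3^3" where "u2 = vector [vector [1, 0, 0], vector [0, p, q], vector [0, p', q']]"
  have "det u1 = 1" "det u2 = 1" using 1 2 by (simp_all add: u1_def u2_def det_3)
  hence "invertible (u1 ** u2)" by (intro invertible_mult invertible_det_unit) auto
  then obtain w where w: "invertible w" "(u1 ** u2) ** w = mat 1" by (auto simp: invertible_def)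
  have "v v* u1 = vector [0, d, v$3]" using 1 by (simp add: u1_def mat3_simps mult.commute)
  moreover have "vector [0, d, v$3] v* u2 = vector [0, 0, e]"
    using 2 by (simp add: u2_def mat3_simps mult.commute)
  ultimately have "v v* (u1 ** u2) = vector [0, 0, e]" by (simp add: vector_matrix_mul_assoc [symmetric])
  hence "v = vector [0, 0, e] v* w" using w by (metis vector_matrix_mul_assoc vector_matrix_mul_rid)
  thus ?thesis using that w by blast
qed

section \<open>Reduction of a binary form\<close>

text \<open>
  Among all integral bases, one that minimises the sum of the values at the two basis vectors is
  reduced up to order and sign: adding or subtracting one basis vector to the other one cannot
  decrease the sum, which bounds the mixed coefficient. The minimum exists because the values have
  bounded denominators.
\<close>
lemma gauss_reduction:
  fixes a b c :: rat
  assumes pos: "\<And>x y :: int. (x, y) \<noteq> (0, 0) \<Longrightarrow>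
     a * of_int x ^ 2 + b * of_int x * of_int y + c * of_int y ^ 2 > 0"
  obtains h11 h12 h21 h22 :: int and a' b' c' :: rat
  where "\<bar>h11 * h22 - h12 * h21\<bar> = 1" "0 \<le> b'" "b' \<le> a'" "a' \<le> c'" "0 < a'"
    "\<And>x y. a * (of_int h11 * x + of_int h12 * y) ^ 2
       + b * (of_int h11 * x + of_int h12 * y) * (of_int h21 * x + of_int h22 * y)
       + c * (of_int h21 * x + of_int h22 * y) ^ 2 = a' * x ^ 2 - b' * x * y + c' * y ^ 2"
proof -
  define f :: "int \<Rightarrow> int \<Rightarrow> rat" where
    "f = (\<lambda>x y. a * of_int x ^ 2 + b * of_int x * of_int y + c * of_int y ^ 2)"
  define bb :: "int \<Rightarrow> int \<Rightarrow> int \<Rightarrow> int \<Rightarrow> rat" where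
    "bb = (\<lambda>x y x' y'. 2 * a * of_int x * of_int x' + b * (of_int x * of_int y' + of_int x' * of_int y)
       + 2 * c * of_int y * of_int y')"
  obtain D :: int where D: "D > 0" "of_int D * a \<in> \<int>" "of_int D * b \<in> \<int>" "of_int D * c \<in> \<int>"
  proof -
    obtain a1 a2 where 1: "a = of_int a1 / of_int a2" "a2 > 0" by (metis quotient_of_div quotient_of_denom_pos surj_pair)
    obtain b1 b2 where 2: "b = of_int b1 / of_int b2" "b2 > 0" by (metis quotient_of_div quotient_of_denom_pos surj_pair)
    obtain c1 c2 where 3: "c = of_int c1 / of_int c2" "c2 > 0" by (metis quotient_of_div quotient_of_denom_pos surj_pair)
    have "of_int (a2 * b2 * c2) * a = of_int (a1 * b2 * c2)" "of_int (a2 * b2 * c2) * b = of_int (a2 * b1 * c2)"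
      "of_int (a2 * b2 * c2) * c = of_int (a2 * b2 * c1)" using 1 2 3 by simp_all
    thus ?thesis using that[of "a2 * b2 * c2"] 1 2 3 by (metis Ints_of_int mult_pos_pos)
  qed
  have int: "of_int D * f x y \<in> \<int>" for x y
  proof -
    have "of_int D * f x y = (of_int D * a) * of_int (x^2) + (of_int D * b) * of_int (x * y) + (of_int D * c) * of_int (y^2)"
      by (simp add: f_def algebra_simps)
    thus ?thesis using D by (simp only: Ints_add Ints_mult Ints_of_int)
  qed
  define B where "B = (\<lambda>(x, y, x', y'). \<bar>x * y' - x' * y\<bar> = (1 :: int))"
  define m where "m = (\<lambda>(x, y, x', y'). nat \<lfloor>of_int D * (f x y + f x' y')\<rfloor>)"
  have "B (1, 0, 0, 1)" by (simp add: B_def)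
  then obtain u where u: "B u" "\<And>v. B v \<Longrightarrow> m u \<le> m v"
    using ex_has_least_nat[of B _ m] by blast
  obtain x y x' y' where u_def: "u = (x, y, x', y')" using prod_cases4 by blast
  have nz: "(s, t) \<noteq> (0, 0) \<and> (s', t') \<noteq> (0, 0)" if "B (s, t, s', t')" for s t s' t'
    using that by (auto simp: B_def)
  have fpos: "f s t > 0" if "(s, t) \<noteq> (0, 0)" for s t using pos that by (simp add: f_def)
  have min: "f x y + f x' y' \<le> f s t + f s' t'" if "B (s, t, s', t')" for s t s' t'
  proof -
    obtain i where i: "of_int D * (f x y + f x' y') = of_int i"
      using int[of x y] int[of x' y'] by (metis Ints_add Ints_cases distrib_left)
    obtain j where j: "of_int D * (f s t + f s' t') = of_int j"
      using int[of s t] int[of s' t'] by (metis Ints_add Ints_cases distrib_left)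
    have "0 < of_int D * (f s t + f s' t')" using fpos nz[OF that] D by (simp add: add_pos_pos)
    hence "j > 0" using j by simp
    moreover have "nat i \<le> nat j" using u(2)[OF that] i j by (simp add: m_def u_def)
    ultimately have "i \<le> j" by simp
    hence "of_int D * (f x y + f x' y') \<le> of_int D * (f s t + f s' t')" using i j by simp
    thus ?thesis using D by simp
  qed
  have Bu: "B (x, y, x', y')" using u u_def by simp
  have exp: "f (x + e * x') (y + e * y') = f x y + of_int e * bb x y x' y' + of_int (e^2) * f x' y'"
    "f (x' + e * x) (y' + e * y) = f x' y' + of_int e * bb x y x' y' + of_int (e^2) * f x y" for e
    by (simp_all add: f_def bb_def power2_eq_square algebra_simps)
  have "\<bar>bb x y x' y'\<bar> \<le> f x y" "\<bar>bb x y x' y'\<bar> \<le> f x' y'"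
  proof -
    have "B (x, y, x' + e * x, y' + e * y)" "B (x + e * x', y + e * y', x', y')" for e
      using Bu by (simp_all add: B_def algebra_simps)
    from min[OF this(1), of 1] min[OF this(1), of "-1"] min[OF this(2), of 1] min[OF this(2), of "-1"]
    show "\<bar>bb x y x' y'\<bar> \<le> f x y" "\<bar>bb x y x' y'\<bar> \<le> f x' y'"
      unfolding exp by (simp_all add: abs_le_iff)
  qed
  hence "\<exists>s t s' t'. B (s, t, s', t') \<and> \<bar>bb s t s' t'\<bar> \<le> f s t \<and> f s t \<le> f s' t'"
  proof (cases "f x y \<le> f x' y'")
    case False
    have "B (x', y', x, y)" "bb x' y' x y = bb x y x' y'"
      using Bu by (auto simp: B_def bb_def algebra_simps)
    thus ?thesis using \<open>\<bar>bb x y x' y'\<bar> \<le> f x' y'\<close> False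
      by (intro exI[of _ x'] exI[of _ y'] exI[of _ x] exI[of _ y]) auto
  qed (use Bu in blast)
  then obtain s t s' t' where st: "B (s, t, s', t')" "\<bar>bb s t s' t'\<bar> \<le> f s t" "f s t \<le> f s' t'" by blast
  hence "\<exists>s' t'. B (s, t, s', t') \<and> bb s t s' t' \<le> 0 \<and> - bb s t s' t' \<le> f s t \<and> f s t \<le> f s' t'"
  proof (cases "bb s t s' t' \<le> 0")
    case False
    have "s * - t' - - s' * t = - (s * t' - s' * t)" by simp
    hence "B (s, t, -s', -t')" using st(1) by (simp only: B_def prod.case abs_minus_cancel)
    moreover have "bb s t (-s') (-t') = - bb s t s' t'" "f (-s') (-t') = f s' t'"
      by (simp_all add: bb_def f_def algebra_simps)
    ultimately show ?thesis using st False by (intro exI[of _ "-s'"] exI[of _ "-t'"]) auto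
  qed (use st in auto)
  then obtain s' t' where st: "B (s, t, s', t')" "bb s t s' t' \<le> 0" "- bb s t s' t' \<le> f s t" "f s t \<le> f s' t'"
    by blast
  show ?thesis
  proof (rule that[of s t' s' t "- bb s t s' t'" "f s t" "f s' t'"])
    show "\<bar>s * t' - s' * t\<bar> = 1" using st by (simp add: B_def)
    show "0 < f s t" using fpos nz st by blast
    fix x y :: rat
    show "a * (of_int s * x + of_int s' * y) ^ 2
       + b * (of_int s * x + of_int s' * y) * (of_int t * x + of_int t' * y)
       + c * (of_int t * x + of_int t' * y) ^ 2 = f s t * x ^ 2 - - bb s t s' t' * x * y + f s' t' * y ^ 2"
      by (simp add: f_def bb_def power2_eq_square algebra_simps)
  qed (use st in auto)
qed

section \<open>A normal form for pairs containing a square\<close>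

text \<open>
  The substitution \<open>x \<mapsto> h x\<close> in the first two variables together with \<open>z \<mapsto> s x + t y + e z\<close>. The
  substitutions that preserve the kernel direction of the semidefinite form have this shape.
\<close>
definition block_matrix :: "int \<Rightarrow> int \<Rightarrow> int \<Rightarrow> int \<Rightarrow> int \<Rightarrow> int \<Rightarrow> int \<Rightarrow> rat^3^3" where
  "block_matrix h11 h12 h21 h22 s t e = map_matrix of_int
     (vector [vector [h11, h21, s], vector [h12, h22, t], vector [0, 0, e]] :: int^3^3)"

lemma block_matrix_GL3Z:
  assumes "\<bar>h11 * h22 - h12 * h21\<bar> = 1" "\<bar>e\<bar> = 1" shows "block_matrix h11 h12 h21 h22 s t e \<in> GL3Z"
  unfolding block_matrix_def
proof (intro GL3Z_I invertible_det_unit)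
  have "det (vector [vector [h11, h21, s], vector [h12, h22, t], vector [0, 0, e]] :: int^3^3)
      = (h11 * h22 - h12 * h21) * e" by (simp add: det_3 algebra_simps)
  thus "\<bar>det (vector [vector [h11, h21, s], vector [h12, h22, t], vector [0, 0, e]] :: int^3^3)\<bar> = 1"
    using assms by (simp add: abs_mult)
qed

lemma block_matrix_act:
  "x v* block_matrix h11 h12 h21 h22 s t e = vector [of_int h11 * x$1 + of_int h12 * x$2,
     of_int h21 * x$1 + of_int h22 * x$2, of_int s * x$1 + of_int t * x$2 + of_int e * x$3]"
  by (simp add: block_matrix_def mat3_simps)

lemma bounded_below_linear:
  fixes a d :: rat assumes "\<And>n :: int. 0 \<le> a + d * of_int n" shows "d = 0"
proof (rule ccontr)
  assume d: "d \<noteq> 0"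
  obtain n :: int where n: "\<bar>a\<bar> / \<bar>d\<bar> < of_int n" using ex_less_of_int by blast
  have "\<bar>a\<bar> < \<bar>d\<bar> * of_int n" using n d by (simp add: field_simps)
  thus False using assms[of n] assms[of "-n"] d by (cases "d > 0") auto
qed

lemma form_eval_sym:
  assumes "A \<in> tern_forms"
  shows "form_eval A x = A$1$1 * (x$1)^2 + A$2$2 * (x$2)^2 + A$3$3 * (x$3)^2
    + 2 * A$1$2 * x$1 * x$2 + 2 * A$1$3 * x$1 * x$3 + 2 * A$2$3 * x$2 * x$3"
proof -
  have "A$2$1 = A$1$2" "A$3$1 = A$1$3" "A$3$2 = A$2$3" using assms by (simp_all add: tern_forms_iff)
  thus ?thesis by (simp add: form_eval_def sum_3 power2_eq_square algebra_simps)
qed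

lemma lin_square_eval3: "form_eval (lin_square l) x = (l$1 * x$1 + l$2 * x$2 + l$3 * x$3)^2"
  by (simp add: form_eval_lin_square sum_3)

text \<open>
  The hypotheses on \<open>A\<close> are conditions on the set of values, so they pass to every pair with the
  same values. Non-negativity makes the zero of \<open>A\<close> a vector of the radical, hence the third
  variable disappears from \<open>A\<close> once the zero lies on the third axis. That \<open>A\<close> and \<open>l\<close> have no common
  zero gives \<open>N \<noteq> 0\<close> and the definiteness of the binary form that is left.
\<close>
lemma normal_form:
  fixes A :: "rat^3^3" and l :: "int^3"
  assumes A: "A \<in> tern_forms"
    and val: "\<And>s t. (s, t) \<in> qZ (A, lin_square (of_int_vec l)) \<Longrightarrow> 0 \<le> s \<and> (s, t) \<noteq> (0, 0)"
    and zero: "(0, t0) \<in> qZ (A, lin_square (of_int_vec l))"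
  obtains w a b c p q N where "w \<in> GL3Z" "0 \<le> b" "b \<le> a" "a \<le> c" "0 < a" "0 < N"
    "(A, lin_square (of_int_vec l)) = pair_act w (mat 1)
       (tern_form a c 0 (-b) 0 0, lin_square (of_int_vec (vector [p, q, N])))"
proof -
  define P where "P = (A, lin_square (of_int_vec l))"
  have P: "fst P \<in> tern_forms" "snd P \<in> tern_forms" using A by (simp_all add: P_def)
  obtain k :: "int^3" where k: "k \<noteq> 0" "form_eval A (of_int_vec k) = 0"
    using zero by (auto simp: qZ_def)
  obtain u :: "int^3^3" and g where u: "invertible u" "k = vector [0, 0, g] v* u"
    using kernel_basis by blast
  define u' :: "rat^3^3" where "u' = map_matrix of_int u"
  have u': "u' \<in> GL3Z" using u by (simp add: u'_def GL3Z_I)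
  define A' where "A' = fst (pair_act u' (mat 1) P)"
  define m where "m = u *v l"
  have A': "A' \<in> tern_forms" using P by (simp add: A'_def pair_act_forms)
  have P': "pair_act u' (mat 1) P = (A', lin_square (of_int_vec m))"
    by (rule sym, rule pair_eqI)
       (use P A' in \<open>simp_all add: A'_def pair_act_eval P_def lin_square_eval3 m_def u'_def
          matrix_vector_mult_def vector_matrix_mult_def sum_3 algebra_simps\<close>)
  have val': "0 \<le> form_eval A' (of_int_vec v) \<and>
      (form_eval A' (of_int_vec v) \<noteq> 0 \<or> m$1 * v$1 + m$2 * v$2 + m$3 * v$3 \<noteq> 0)" if "v \<noteq> 0" for v :: "int^3"
  proof -
    have "(form_eval A' (of_int_vec v), form_eval (lin_square (of_int_vec m)) (of_int_vec v)) \<in> qZ P"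
      using that unfolding qZ_GL3Z[OF u' P, symmetric] P' by (auto simp: qZ_def)
    from val[OF this[unfolded P_def]] show ?thesis by (auto simp: lin_square_eval3 simp flip: of_int_mult of_int_add)
  qed
  have "form_eval A' (of_int_vec (vector [0, 0, g])) = 0"
    using k(2) by (simp add: A'_def pair_act_eval P_def u'_def u(2) of_int_vec_mult)
  moreover have "g \<noteq> 0"
  proof
    assume "g = 0"
    hence "k = 0" unfolding u(2) by (simp add: mat3_simps)
    thus False using k by simp
  qed
  ultimately have A33: "A'$3$3 = 0" by (simp add: form_eval_sym[OF A'])
  have ne: "(vector [x, y, z] :: int^3) \<noteq> 0 \<longleftrightarrow> x \<noteq> 0 \<or> y \<noteq> 0 \<or> z \<noteq> 0" for x y z
    by (auto simp: vec_eq_iff forall_3)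
  have A13: "A'$1$3 = 0"
  proof -
    have "0 \<le> A'$1$1 + (2 * A'$1$3) * of_int n" for n
      using val'[of "vector [1, 0, n]"] A33 by (simp add: ne form_eval_sym[OF A'])
    thus ?thesis using bounded_below_linear by fastforce
  qed
  have A23: "A'$2$3 = 0"
  proof -
    have "0 \<le> A'$2$2 + (2 * A'$2$3) * of_int n" for n
      using val'[of "vector [0, 1, n]"] A33 by (simp add: ne form_eval_sym[OF A'])
    thus ?thesis using bounded_below_linear by fastforce
  qed
  have m3: "m$3 \<noteq> 0" using val'[of "vector [0, 0, 1]"] A33 by (simp add: ne form_eval_sym[OF A'])
  have pos: "A'$1$1 * of_int x ^ 2 + 2 * A'$1$2 * of_int x * of_int y + A'$2$2 * of_int y ^ 2 > 0"
    if "(x, y) \<noteq> (0, 0)" for x y :: int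
  proof -
    \<comment> \<open>a lift of a multiple of \<open>(x, y)\<close> to the kernel of the linear form\<close>
    define v :: "int^3" where "v = vector [m$3 * x, m$3 * y, - (m$1 * x + m$2 * y)]"
    have "v \<noteq> 0" using that m3 by (auto simp: v_def ne)
    moreover have "m$1 * v$1 + m$2 * v$2 + m$3 * v$3 = 0" by (simp add: v_def algebra_simps)
    ultimately have "form_eval A' (of_int_vec v) > 0" using val'[of v] by auto
    moreover have "form_eval A' (of_int_vec v) = of_int (m$3)^2 *
       (A'$1$1 * of_int x ^ 2 + 2 * A'$1$2 * of_int x * of_int y + A'$2$2 * of_int y ^ 2)"
      by (simp add: form_eval_sym[OF A'] A33 A13 A23 v_def power2_eq_square algebra_simps)
    ultimately show ?thesis by (simp add: zero_less_mult_iff)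
  qed
  obtain h11 h12 h21 h22 a b c where h: "\<bar>h11 * h22 - h12 * h21\<bar> = 1" and abc: "0 \<le> b" "b \<le> a" "a \<le> c" "0 < a"
    and eq: "\<And>x y. A'$1$1 * (of_int h11 * x + of_int h12 * y) ^ 2
       + (2 * A'$1$2) * (of_int h11 * x + of_int h12 * y) * (of_int h21 * x + of_int h22 * y)
       + A'$2$2 * (of_int h21 * x + of_int h22 * y) ^ 2 = a * x ^ 2 - b * x * y + c * y ^ 2"
  proof -
    show thesis by (rule gauss_reduction[OF pos], assumption) (rule that)
  qed
  define w where "w = block_matrix h11 h12 h21 h22 0 0 (sgn (m$3))"
  have w: "w \<in> GL3Z" unfolding w_def using h m3 by (intro block_matrix_GL3Z) (auto simp: abs_sgn_eq_1)
  define Q where "Q = (tern_form a c 0 (-b) 0 0, lin_square (of_int_vec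
    (vector [m$1 * h11 + m$2 * h21, m$1 * h12 + m$2 * h22, m$3 * sgn (m$3)])))"
  have Q: "fst Q \<in> tern_forms" "snd Q \<in> tern_forms" by (simp_all add: Q_def)
  have "Q = pair_act w (mat 1) (A', lin_square (of_int_vec m))"
  proof (rule pair_eqI)
    fix x
    show "form_eval (fst Q) x = (mat 1 :: rat^2^2)$1$1 * form_eval (fst (A', lin_square (of_int_vec m))) (x v* w) +
        (mat 1 :: rat^2^2)$1$2 * form_eval (snd (A', lin_square (of_int_vec m))) (x v* w)"
      using eq[of "x$1" "x$2"] by (simp add: Q_def form_eval_tern_form w_def block_matrix_act form_eval_sym[OF A'] A33 A13 A23)
    show "form_eval (snd Q) x = (mat 1 :: rat^2^2)$2$1 * form_eval (fst (A', lin_square (of_int_vec m))) (x v* w) +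
        (mat 1 :: rat^2^2)$2$2 * form_eval (snd (A', lin_square (of_int_vec m))) (x v* w)"
      by (simp add: Q_def lin_square_eval3 w_def block_matrix_act algebra_simps)
  qed (use A' Q in simp_all)
  hence Q_eq: "Q = pair_act (w ** u') (mat 1) P"
    using P by (simp add: P' [symmetric] pair_act_comp)
  obtain z where z: "z \<in> GL3Z" "z ** (w ** u') = mat 1" using GL3Z_inverse GL3Z_mult[OF w u'] by metis
  have "P = pair_act z (mat 1) Q" unfolding Q_eq using P by (simp add: pair_act_comp z pair_act_id)
  hence "(A, lin_square (of_int_vec l)) = pair_act z (mat 1) Q" by (simp add: P_def)
  moreover have "0 < m$3 * sgn (m$3)" using m3 by (metis abs_sgn zero_less_abs_iff)
  ultimately show ?thesis using that[OF z(1) abc] unfolding Q_def by blast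
qed

section \<open>Multiple roots and forms of rank one\<close>

text \<open>
  Every row is a multiple of a row with nonzero diagonal entry, so the form is a multiple of the
  square of that row.
\<close>
lemma rank_one_lin_square:
  fixes E :: "rat^3^3"
  assumes E: "E \<in> tern_forms" "E \<noteq> 0"
    and minors: "\<And>i j k l. E$i$j * E$k$l = E$i$l * E$k$j"
  obtains e and l :: "int^3" where "e \<noteq> 0" "l \<noteq> 0" "E = mat_scale e (lin_square (\<chi> i. of_int (l $ i)))"
proof -
  have sym: "E$i$j = E$j$i" for i j using E(1) by (simp add: tern_forms_iff)
  obtain i j where ij: "E$i$j \<noteq> 0" using E(2) by (auto simp: vec_eq_iff)
  have ii: "E$i$i \<noteq> 0"
  proof
    assume "E$i$i = 0"
    hence "E$i$j * E$j$i = 0" using minors[of i j j i] by simp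
    thus False using ij sym[of i j] by simp
  qed
  define D :: int where "D = (\<Prod>k\<in>UNIV. snd (quotient_of (E$i$k)))"
  have D: "D > 0" unfolding D_def by (intro prod_pos) (auto simp: quotient_of_denom_pos')
  have "\<exists>n :: int. of_int D * E$i$k = of_int n" for k
  proof -
    obtain m where m: "D = snd (quotient_of (E$i$k)) * m"
      using dvd_prodI[of UNIV k "\<lambda>k. snd (quotient_of (E$i$k))"] unfolding D_def by (auto elim: dvdE)
    have "E$i$k = of_int (fst (quotient_of (E$i$k))) / of_int (snd (quotient_of (E$i$k)))"
      by (metis prod.collapse quotient_of_div)
    moreover have "snd (quotient_of (E$i$k)) > 0" by (rule quotient_of_denom_pos')
    ultimately have "of_int D * E$i$k = of_int (m * fst (quotient_of (E$i$k)))"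
      unfolding m by (simp add: field_simps)
    thus ?thesis by blast
  qed
  then obtain n where n: "\<And>k. of_int D * E$i$k = of_int (n k)" by metis
  define l :: "int^3" where "l = (\<chi> k. n k)"
  have l: "of_int (l$k) = of_int D * E$i$k" for k by (simp add: l_def n)
  show ?thesis
  proof (rule that[of "1 / (E$i$i * of_int D ^ 2)" l])
    show "1 / (E$i$i * of_int D ^ 2) \<noteq> 0" using ii D by simp
    have "of_int (l$i) \<noteq> (0 :: rat)" using l[of i] ii D by simp
    thus "l \<noteq> 0" by auto
    have "E$j$k * E$i$i = E$i$j * E$i$k" for j k using minors[of j k i i] sym[of j i] by simp
    thus "E = mat_scale (1 / (E$i$i * of_int D ^ 2)) (lin_square (\<chi> i. of_int (l $ i)))"
      using ii D by (simp add: vec_eq_iff lin_square_def l field_simps power2_eq_square)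
  qed
qed

text \<open>
  The trace of \<open>adj E\<close> times \<open>C\<close> for symmetric matrices, which is the linear coefficient of
  \<open>det (t C + E)\<close>.
\<close>
definition adj_trace :: "'a::comm_ring_1^3^3 \<Rightarrow> 'a^3^3 \<Rightarrow> 'a" where
  "adj_trace E C = C$1$1 * (E$2$2 * E$3$3 - E$2$3^2) + C$2$2 * (E$1$1 * E$3$3 - E$1$3^2)
     + C$3$3 * (E$1$1 * E$2$2 - E$1$2^2)
     + 2 * C$1$2 * (E$1$3 * E$2$3 - E$1$2 * E$3$3)
     + 2 * C$1$3 * (E$1$2 * E$2$3 - E$1$3 * E$2$2)
     + 2 * C$2$3 * (E$1$2 * E$1$3 - E$2$3 * E$1$1)"

lemma det_pencil:
  fixes C E :: "'a::comm_ring_1^3^3"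
  assumes "\<And>i j. C$i$j = C$j$i" "\<And>i j. E$i$j = E$j$i"
  shows "det (mat_scale t C + E) = det C * t^3 + adj_trace C E * t^2 + adj_trace E C * t + det E"
proof -
  note s = assms(1)[of 2 1] assms(1)[of 3 1] assms(1)[of 3 2] assms(2)[of 2 1] assms(2)[of 3 1] assms(2)[of 3 2]
  show ?thesis
    by (simp add: s mat_scale_def map_matrix_def det_3 adj_trace_def power2_eq_square power3_eq_cube algebra_simps)
qed

text \<open>
  A double root at \<open>E\<close> means \<open>det E = 0\<close> and \<open>tr (adj E C) = 0\<close>. As \<open>det E = 0\<close>, the adjugate has rank at
  most one, so each of its rows \<open>v\<close> satisfies \<open>C(v) = v\<^sub>i tr (adj E C)\<close> with \<open>v\<^sub>i\<close> the diagonal entry.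
  Since \<open>C\<close> is definite, the adjugate vanishes.
\<close>
lemma double_root_minors_vanish:
  assumes C: "C \<in> tern_forms" "pos_def C" and E: "E \<in> tern_forms" and det: "det E = 0" and tr: "adj_trace E C = 0"
  shows "E$i$j * E$k$l = E$i$l * E$k$j"
proof -
  have s: "E$2$1 = E$1$2" "E$3$1 = E$1$3" "E$3$2 = E$2$3" using E by (simp_all add: tern_forms_iff)
  have cs: "C$2$1 = C$1$2" "C$3$1 = C$1$3" "C$3$2 = C$2$3" using C by (simp_all add: tern_forms_iff)
  define a where "a = E$2$2 * E$3$3 - E$2$3^2"
  define b where "b = E$1$1 * E$3$3 - E$1$3^2"
  define c where "c = E$1$1 * E$2$2 - E$1$2^2"
  define d where "d = E$1$3 * E$2$3 - E$1$2 * E$3$3"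
  define e where "e = E$1$2 * E$2$3 - E$1$3 * E$2$2"
  define f where "f = E$1$2 * E$1$3 - E$2$3 * E$1$1"
  have det': "E$1$1 * E$2$2 * E$3$3 + 2 * E$1$2 * E$1$3 * E$2$3 - E$1$1 * E$2$3^2 - E$2$2 * E$1$3^2 - E$3$3 * E$1$2^2 = 0"
    using det by (simp add: det_3 s power2_eq_square algebra_simps)
  define \<Delta> where "\<Delta> = E$1$1 * E$2$2 * E$3$3 + 2 * E$1$2 * E$1$3 * E$2$3 - E$1$1 * E$2$3^2 - E$2$2 * E$1$3^2 - E$3$3 * E$1$2^2"
  have "a * b - d^2 = E$3$3 * \<Delta>" "a * c - e^2 = E$2$2 * \<Delta>" "b * c - f^2 = E$1$1 * \<Delta>"
    "a * f - d * e = - E$2$3 * \<Delta>" "b * e - d * f = - E$1$3 * \<Delta>" "c * d - e * f = - E$1$2 * \<Delta>"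
    unfolding a_def b_def c_def d_def e_def f_def \<Delta>_def
    by (simp_all add: power2_eq_square algebra_simps)
  hence m: "d^2 = a * b" "e^2 = a * c" "f^2 = b * c" "d * e = a * f" "d * f = b * e" "e * f = c * d"
    using det' by (simp_all add: \<Delta>_def)
  have tr': "C$1$1 * a + C$2$2 * b + C$3$3 * c + 2 * C$1$2 * d + 2 * C$1$3 * e + 2 * C$2$3 * f = 0"
    using tr by (simp add: adj_trace_def a_def b_def c_def d_def e_def f_def)
  have ev: "form_eval C (vector [x, y, z]) = C$1$1 * x^2 + C$2$2 * y^2 + C$3$3 * z^2
      + 2 * C$1$2 * x * y + 2 * C$1$3 * x * z + 2 * C$2$3 * y * z" for x y z
    by (simp add: form_eval_def sum_3 cs power2_eq_square algebra_simps)
  have zero: "x = 0 \<and> y = 0 \<and> z = 0" if "form_eval C (vector [x, y, z]) = 0" for x y z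
  proof -
    have "(vector [x, y, z] :: rat^3) = 0"
      using C(2) that unfolding pos_def_def by (metis less_irrefl)
    thus ?thesis by (simp add: vec_eq_iff forall_3)
  qed
  have "form_eval C (vector [a, d, e]) = 0"
  proof -
    have "form_eval C (vector [a, d, e]) = C$1$1 * a^2 + C$2$2 * d^2 + C$3$3 * e^2
      + 2 * C$1$2 * a * d + 2 * C$1$3 * a * e + 2 * C$2$3 * (d * e)" by (simp add: ev)
    also have "\<dots> = a * (C$1$1 * a + C$2$2 * b + C$3$3 * c + 2 * C$1$2 * d + 2 * C$1$3 * e + 2 * C$2$3 * f)"
      unfolding m by (simp add: power2_eq_square algebra_simps)
    finally show ?thesis using tr' by simp
  qed
  hence a: "a = 0" "d = 0" "e = 0" using zero by blast+
  have "form_eval C (vector [d, b, f]) = 0"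
  proof -
    have "form_eval C (vector [d, b, f]) = C$1$1 * d^2 + C$2$2 * b^2 + C$3$3 * f^2
      + 2 * C$1$2 * d * b + 2 * C$1$3 * (d * f) + 2 * C$2$3 * b * f" by (simp add: ev)
    also have "\<dots> = b * (C$1$1 * a + C$2$2 * b + C$3$3 * c + 2 * C$1$2 * d + 2 * C$1$3 * e + 2 * C$2$3 * f)"
      unfolding m by (simp add: power2_eq_square algebra_simps)
    finally show ?thesis using tr' by simp
  qed
  hence b: "b = 0" "f = 0" using zero by blast+
  have "form_eval C (vector [e, f, c]) = 0"
  proof -
    have "form_eval C (vector [e, f, c]) = C$1$1 * e^2 + C$2$2 * f^2 + C$3$3 * c^2
      + 2 * C$1$2 * (e * f) + 2 * C$1$3 * e * c + 2 * C$2$3 * f * c" by (simp add: ev)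
    also have "\<dots> = c * (C$1$1 * a + C$2$2 * b + C$3$3 * c + 2 * C$1$2 * d + 2 * C$1$3 * e + 2 * C$2$3 * f)"
      unfolding m by (simp add: power2_eq_square algebra_simps)
    finally show ?thesis using tr' by simp
  qed
  hence c: "c = 0" using zero by blast
  have "E$2$2 * E$3$3 = E$2$3 * E$2$3" "E$1$1 * E$3$3 = E$1$3 * E$1$3" "E$1$1 * E$2$2 = E$1$2 * E$1$2"
    "E$1$3 * E$2$3 = E$1$2 * E$3$3" "E$1$2 * E$2$3 = E$1$3 * E$2$2" "E$1$2 * E$1$3 = E$2$3 * E$1$1"
    using a b c by (simp_all add: a_def b_def c_def d_def e_def f_def power2_eq_square)
  moreover have "i = 1 \<or> i = 2 \<or> i = 3" "j = 1 \<or> j = 2 \<or> j = 3" "k = 1 \<or> k = 2 \<or> k = 3" "l = 1 \<or> l = 2 \<or> l = 3"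
    by (rule exhaust_3)+
  ultimately show ?thesis by (elim disjE) (simp_all add: s mult.commute)
qed

lemma cubic_coeffs:
  fixes a0 a1 a2 a3 u w l m :: "'a :: field_char_0"
  assumes "\<And>t. a3 * t^3 + a2 * t^2 + a1 * t + a0 = (u * t + w)^2 * (l * t + m)"
  shows "a3 = u^2 * l" "a2 = u^2 * m + 2 * u * w * l" "a1 = 2 * u * w * m + w^2 * l" "a0 = w^2 * m"
proof -
  have "poly [:a0, a1, a2, a3:] t = poly ([:w, u:]^2 * [:m, l:]) t" for t
    using assms[of t] by (simp add: power2_eq_square power3_eq_cube algebra_simps)
  hence "[:a0, a1, a2, a3:] = [:w, u:]^2 * [:m, l:]" by (simp add: poly_eq_poly_eq_iff [symmetric] fun_eq_iff)
  thus "a3 = u^2 * l" "a2 = u^2 * m + 2 * u * w * l" "a1 = 2 * u * w * m + w^2 * l" "a0 = w^2 * m"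
    by (simp_all add: power2_eq_square algebra_simps)
qed

text \<open>
  The double root of \<open>a\<^sub>3 t\<^sup>3 + a\<^sub>2 t\<^sup>2 + a\<^sub>1 t + a\<^sub>0\<close> is
  \<open>(9 a\<^sub>3 a\<^sub>0 - a\<^sub>1 a\<^sub>2) / (2 (a\<^sub>2\<^sup>2 - 3 a\<^sub>3 a\<^sub>1))\<close>, and \<open>- a\<^sub>2 / (3 a\<^sub>3)\<close> if that denominator
  vanishes, when the root is triple. Both are rational.
\<close>
lemma rational_double_root:
  fixes a0 a1 a2 a3 :: rat and u w l m :: "rat alg_closure"
  assumes "u \<noteq> 0" "a3 \<noteq> 0"
    and eq: "\<And>t. to_ac a3 * t^3 + to_ac a2 * t^2 + to_ac a1 * t + to_ac a0 = (u * t + w)^2 * (l * t + m)"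
  obtains r where "a3 * r^3 + a2 * r^2 + a1 * r + a0 = 0" "3 * a3 * r^2 + 2 * a2 * r + a1 = 0"
proof -
  note c = cubic_coeffs[OF eq] and result = that
  have rat: ?thesis if r: "u * to_ac r = - w" for r
  proof (rule result)
    have "to_ac (a3 * r^3 + a2 * r^2 + a1 * r + a0) = 0"
      using eq[of "to_ac r"] r by simp
    thus "a3 * r^3 + a2 * r^2 + a1 * r + a0 = 0" by (simp only: to_ac_eq_0_iff)
    have "to_ac (3 * a3 * r^2 + 2 * a2 * r + a1) = 3 * to_ac a3 * to_ac r^2 + 2 * to_ac a2 * to_ac r + to_ac a1"
      by simp
    also have "\<dots> = 0" unfolding c
    proof -
      have "3 * (u^2 * l) * to_ac r^2 + 2 * (u^2 * m + 2 * u * w * l) * to_ac r + (2 * u * w * m + w^2 * l)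
        = 3 * l * (u * to_ac r)^2 + 2 * m * u * (u * to_ac r) + 4 * w * l * (u * to_ac r) + 2 * u * w * m + w^2 * l"
        by (simp add: power2_eq_square algebra_simps)
      also have "\<dots> = 0" unfolding r by (simp add: power2_eq_square algebra_simps)
      finally show "3 * (u^2 * l) * to_ac r^2 + 2 * (u^2 * m + 2 * u * w * l) * to_ac r + (2 * u * w * m + w^2 * l) = 0" .
    qed
    finally show "3 * a3 * r^2 + 2 * a2 * r + a1 = 0" by (simp only: to_ac_eq_0_iff)
  qed
  show ?thesis
  proof (cases "a2^2 = 3 * a3 * a1")
    case True
    hence "to_ac (a2^2) = to_ac (3 * a3 * a1)" by simp
    hence "to_ac a2^2 = 3 * to_ac a3 * to_ac a1" by simp
    moreover have "to_ac a2^2 - 3 * to_ac a3 * to_ac a1 = u^2 * (u * m - w * l)^2"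
      unfolding c by (simp add: power2_eq_square algebra_simps)
    ultimately have um: "u * m = w * l" using assms(1) by simp
    have "to_ac a2 = u * (u * m) + 2 * u * w * l" unfolding c by (simp add: power2_eq_square algebra_simps)
    also have "\<dots> = 3 * u * w * l" unfolding um by (simp add: algebra_simps)
    finally have "to_ac a2 * u = 3 * to_ac a3 * w" by (simp add: c power2_eq_square algebra_simps)
    moreover have "to_ac a3 \<noteq> 0" using assms(2) by simp
    ultimately have "u * to_ac (- a2 / (3 * a3)) = - w" by (simp add: field_simps)
    thus ?thesis by (rule rat)
  next
    case False
    hence nz: "a2^2 - 3 * a3 * a1 \<noteq> 0" by simp
    have "to_ac (a2^2 - 3 * a3 * a1) * (2 * w) = - u * to_ac (9 * a3 * a0 - a1 * a2)"
      unfolding to_ac_diff to_ac_mult to_ac_power to_ac_numeral c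
      by (simp add: power2_eq_square algebra_simps)
    moreover have "to_ac (a2^2 - 3 * a3 * a1) \<noteq> 0" using nz by (simp only: to_ac_eq_0_iff) simp
    ultimately have "u * to_ac ((9 * a3 * a0 - a1 * a2) / (2 * (a2^2 - 3 * a3 * a1))) = - w"
      unfolding to_ac_divide to_ac_mult[of 2] to_ac_numeral by (simp add: field_simps)
    thus ?thesis by (rule rat)
  qed
qed

lemma pos_def_invertible:
  assumes "C \<in> tern_forms" "pos_def C" obtains Ci where "C ** Ci = mat 1" "det C \<noteq> 0"
proof -
  have "x = 0" if "C *v x = 0" for x
  proof (rule ccontr)
    assume "x \<noteq> 0"
    moreover have "form_eval C x = (\<Sum>i\<in>UNIV. x$i * (C *v x)$i)"
      by (simp add: form_eval_def matrix_vector_mult_def sum_distrib_left mult.assoc mult.commute mult.left_commute)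
    ultimately show False using assms(2) that unfolding pos_def_def by fastforce
  qed
  hence "\<exists>B. B ** C = mat 1" by (simp add: matrix_left_invertible_ker)
  hence inv: "invertible C" by (simp add: invertible_left_inverse)
  then obtain Ci where "C ** Ci = mat 1" by (auto simp: invertible_def)
  moreover have "det C \<noteq> 0" using inv invertible_det_nz by blast
  ultimately show ?thesis by (rule that)
qed

text \<open>
  The member \<open>C\<close> of the pencil will be the definite one. The parametrisation \<open>t C + D\<close> puts it at
  infinity, so that no root is lost and the cubic has degree three in \<open>t\<close>.
\<close>
lemma det_cubic_line:
  fixes c d :: rat
  assumes A: "A \<in> tern_forms" and B: "B \<in> tern_forms"
  defines "C \<equiv> mat_scale c A + mat_scale d B" and "D \<equiv> mat_scale (-d) A + mat_scale c B"
  shows "det_cubic (A, B) (t * to_ac c - to_ac d) (- (t * to_ac d + to_ac c)) =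
    to_ac (det C) * t^3 + to_ac (adj_trace C D) * t^2 + to_ac (adj_trace D C) * t + to_ac (det D)"
proof -
  define C' where "C' = map_matrix to_ac C"
  define D' where "D' = map_matrix to_ac D"
  have *: "mat_scale (t * to_ac c - to_ac d) (map_matrix to_ac A) - mat_scale (- (t * to_ac d + to_ac c)) (map_matrix to_ac B)
      = mat_scale t C' + D'"
    by (simp add: vec_eq_iff C'_def D'_def C_def D_def mat_scale_def map_matrix_def algebra_simps)
  have sym: "C'$i$j = C'$j$i" "D'$i$j = D'$j$i" for i j
    using A B by (auto simp: C'_def D'_def C_def D_def tern_forms_iff)
  have "det C' = to_ac (det C)" "det D' = to_ac (det D)"
    by (simp_all add: det_3 C'_def D'_def)
  moreover have "adj_trace C' D' = to_ac (adj_trace C D)" "adj_trace D' C' = to_ac (adj_trace D C)"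
    by (simp_all add: adj_trace_def C'_def D'_def)
  ultimately show ?thesis
    using det_pencil[of C' D' t] sym unfolding det_cubic_def fst_conv snd_conv * by simp
qed

lemma adj_trace_shift:
  assumes "C \<in> tern_forms" "D \<in> tern_forms"
  shows "adj_trace (mat_scale r C + D) C = 3 * det C * r^2 + 2 * adj_trace C D * r + adj_trace D C"
proof -
  have "C$2$1 = C$1$2" "C$3$1 = C$1$3" "C$3$2 = C$2$3" "D$2$1 = D$1$2" "D$3$1 = D$1$3" "D$3$2 = D$2$3"
    using assms by (simp_all add: tern_forms_iff)
  thus ?thesis by (simp add: det_3 adj_trace_def power2_eq_square algebra_simps)
qed

lemma pencil_rank_one:
  assumes A: "A \<in> tern_forms" and B: "B \<in> tern_forms" and ind: "lin_indep_pair A B"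
    and C: "C = mat_scale c A + mat_scale d B" "pos_def C"
    and root: "has_multiple_root (det_cubic (A, B))"
  obtains r e and l :: "int^3" where "e \<noteq> 0" "l \<noteq> 0" "c^2 + d^2 \<noteq> 0"
    "mat_scale (r * c - d) A + mat_scale (r * d + c) B = mat_scale e (lin_square (of_int_vec l))"
proof -
  \<comment> \<open>any second member of the pencil would do; this one is independent of \<open>C\<close> because \<open>c\<^sup>2 + d\<^sup>2 \<noteq> 0\<close>\<close>
  define D where "D = mat_scale (-d) A + mat_scale c B"
  have CD: "C \<in> tern_forms" "D \<in> tern_forms" using A B by (simp_all add: C D_def tern_forms_combination)
  have dC: "det C \<noteq> 0" using pos_def_invertible[OF CD(1) C(2)] by blast
  obtain a0 b0 l m where F: "\<And>x y. det_cubic (A, B) x y = (b0 * x - a0 * y)^2 * (l * x + m * y)"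
    using root by (auto simp: has_multiple_root_def multiple_root_at_def)
  define u where "u = b0 * to_ac c + a0 * to_ac d"
  define w where "w = a0 * to_ac c - b0 * to_ac d"
  define l' where "l' = l * to_ac c - m * to_ac d"
  define m' where "m' = - (l * to_ac d + m * to_ac c)"
  have eq: "to_ac (det C) * t^3 + to_ac (adj_trace C D) * t^2 + to_ac (adj_trace D C) * t + to_ac (det D)
     = (u * t + w)^2 * (l' * t + m')" for t
  proof -
    have "b0 * (t * to_ac c - to_ac d) - a0 * (- (t * to_ac d + to_ac c)) = u * t + w"
      "l * (t * to_ac c - to_ac d) + m * (- (t * to_ac d + to_ac c)) = l' * t + m'"
      by (simp_all add: u_def w_def l'_def m'_def algebra_simps)
    thus ?thesis using det_cubic_line[OF A B, of t c d] F unfolding C D_def by metis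
  qed
  have u: "u \<noteq> 0" using cubic_coeffs(1)[OF eq] dC by auto
  obtain r where r: "det C * r^3 + adj_trace C D * r^2 + adj_trace D C * r + det D = 0"
    "3 * det C * r^2 + 2 * adj_trace C D * r + adj_trace D C = 0"
    using rational_double_root[OF u dC eq] by blast
  define E where "E = mat_scale r C + D"
  have E: "E \<in> tern_forms" using CD by (auto simp: E_def tern_forms_iff)
  have E_eq: "E = mat_scale (r * c - d) A + mat_scale (r * d + c) B"
    by (simp add: vec_eq_iff E_def C D_def algebra_simps)
  have "det E = 0" using det_pencil[of C D r] CD r(1) by (simp add: E_def tern_forms_iff)
  moreover have "adj_trace E C = 0" using adj_trace_shift[OF CD] r(2) by (simp add: E_def)
  ultimately have minors: "E$i$j * E$k$l = E$i$l * E$k$j" for i j k l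
    using double_root_minors_vanish[OF CD(1) C(2) E] by blast
  have cd: "c^2 + d^2 \<noteq> 0"
  proof
    assume "c^2 + d^2 = 0"
    hence "c = 0" "d = 0" by (simp_all add: sum_power2_eq_zero_iff)
    hence "det C = 0" by (simp add: C det_3)
    thus False using dC by simp
  qed
  have "E \<noteq> 0"
  proof
    assume "E = 0"
    hence *: "r * c - d = 0" "r * d + c = 0" using ind E_eq unfolding lin_indep_pair_def by metis+
    have "c^2 + d^2 = c * (r * d + c) - d * (r * c - d)" by (simp add: power2_eq_square algebra_simps)
    thus False using cd * by simp
  qed
  then obtain e and k :: "int^3" where "e \<noteq> 0" "k \<noteq> 0" "E = mat_scale e (lin_square (of_int_vec k))"
    using rank_one_lin_square[OF E _ minors] by blast
  thus ?thesis using that cd E_eq by metis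
qed

lemma clear_denominators:
  fixes x :: "rat^3" obtains D :: int and v :: "int^3" where "D > 0" "of_int_vec v = of_int D *s x"
proof -
  have "\<exists>n d :: int. d > 0 \<and> of_int d * y = of_int n" for y :: rat
    by (metis quotient_of_div quotient_of_denom_pos surj_pair nonzero_mult_div_cancel_left
        times_divide_eq_right of_int_eq_0_iff less_irrefl)
  then obtain n d :: "rat \<Rightarrow> int" where nd: "\<And>y. d y > 0" "\<And>y. of_int (d y) * y = of_int (n y)" by metis
  define D where "D = d (x$1) * d (x$2) * d (x$3)"
  have "of_int_vec (vector [n (x$1) * d (x$2) * d (x$3), n (x$2) * d (x$1) * d (x$3), n (x$3) * d (x$1) * d (x$2)])
     = of_int D *s x"
    by (simp add: vec_eq_iff forall_3 D_def nd(2) [symmetric])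
  moreover have "D > 0" using nd(1) by (simp add: D_def)
  ultimately show ?thesis using that by blast
qed

lemma form_eval_smult: "form_eval A (c *s x) = c^2 * form_eval A x"
  by (simp add: form_eval_def sum_distrib_left power2_eq_square ac_simps)

text \<open>
  Let \<open>C\<close> be definite and \<open>u\<close> the vector with \<open>C u = l\<close>. Then
  \<open>C(x - (l(x) / l(u)) u) = C(x) - l(x)\<^sup>2 / l(u)\<close>. So \<open>C\<close> minus a multiple of \<open>l\<^sup>2\<close> is non-negative and
  vanishes only on the line of \<open>u\<close>, where \<open>l\<close> does not vanish.
\<close>
lemma multiple_root_reduction:
  assumes A: "A \<in> tern_forms" and B: "B \<in> tern_forms" and ind: "lin_indep_pair A B"
    and pd: "\<exists>c d. pos_def (mat_scale c A + mat_scale d B)"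
    and root: "has_multiple_root (det_cubic (A, B))"
  obtains h :: "rat^2^2" and A' and l :: "int^3" and t0 where "invertible h" "A' \<in> tern_forms"
    "pair_act (mat 1) h (A, B) = (A', lin_square (of_int_vec l))"
    "\<And>s t. (s, t) \<in> qZ (A', lin_square (of_int_vec l)) \<Longrightarrow> 0 \<le> s \<and> (s, t) \<noteq> (0, 0)"
    "(0, t0) \<in> qZ (A', lin_square (of_int_vec l))"
proof -
  obtain c d where pd: "pos_def (mat_scale c A + mat_scale d B)" using pd by blast
  define C where "C = mat_scale c A + mat_scale d B"
  have C: "C \<in> tern_forms" "pos_def C" using A B pd by (simp_all add: C_def tern_forms_combination)
  obtain r e and l :: "int^3" where e: "e \<noteq> 0" and l: "l \<noteq> 0" and cd: "c^2 + d^2 \<noteq> 0" and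
    E: "mat_scale (r * c - d) A + mat_scale (r * d + c) B = mat_scale e (lin_square (of_int_vec l))"
  proof -
    show thesis by (rule pencil_rank_one[OF A B ind C_def C(2) root]) (rule that)
  qed
  define l' where "l' = of_int_vec l"
  define L where "L x = l'$1 * x$1 + l'$2 * x$2 + l'$3 * x$3" for x :: "rat^3"
  have l': "l' \<noteq> 0" using l by (auto simp: l'_def vec_eq_iff)
  obtain Ci where Ci: "C ** Ci = mat 1" using pos_def_invertible[OF C] by blast
  define u where "u = Ci *v l'"
  have Cu: "C *v u = l'" by (simp add: u_def matrix_vector_mul_assoc Ci)
  have u: "u \<noteq> 0" using Cu l' by auto
  have s: "C$2$1 = C$1$2" "C$3$1 = C$1$3" "C$3$2 = C$2$3" using C(1) by (simp_all add: tern_forms_iff)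
  have polar: "form_eval C (x - k *s u) = form_eval C x - 2 * k * L x + k^2 * L u" for x k
    unfolding L_def Cu [symmetric]
    by (simp add: form_eval_def matrix_vector_mult_def sum_3 s power2_eq_square algebra_simps)
  have "form_eval C (u - 1 *s u) = form_eval C u - 2 * 1 * L u + 1^2 * L u" by (rule polar)
  hence Lu: "L u = form_eval C u" by (simp add: form_eval_def)
  hence Lpos: "L u > 0" using u C(2) by (simp add: pos_def_def)
  define \<mu> where "\<mu> = 1 / (L u * e)"
  define h :: "rat^2^2" where "h = vector [vector [c - \<mu> * (r * c - d), d - \<mu> * (r * d + c)],
     vector [(r * c - d) / e, (r * d + c) / e]]"
  have "det h = (c^2 + d^2) / e"
    using e by (simp add: h_def det_2 \<mu>_def field_simps power2_eq_square)
  hence h: "invertible h" using cd e by (simp add: invertible_det_nz)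
  define A' where "A' = fst (pair_act (mat 1) h (A, B))"
  have A': "A' \<in> tern_forms" using A B by (simp add: A'_def pair_act_forms)
  have Eev: "(r * c - d) * form_eval A x + (r * d + c) * form_eval B x = e * (L x)^2" for x
    using arg_cong[OF E, of "\<lambda>M. form_eval M x"]
    by (simp add: form_eval_add form_eval_scale lin_square_eval3 L_def l'_def)
  have B': "pair_act (mat 1) h (A, B) = (A', lin_square l')"
  proof (intro prod_eqI)
    show "snd (pair_act (mat 1) h (A, B)) = snd (A', lin_square l')"
      unfolding snd_conv
    proof (rule form_eval_ext)
      fix x
      have "form_eval (lin_square l') x = (L x)^2" by (simp add: lin_square_eval3 L_def)
      thus "form_eval (snd (pair_act (mat 1) h (A, B))) x = form_eval (lin_square l') x"
        using Eev[of x] e by (simp add: pair_act_eval h_def field_simps)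
    qed (use A B in \<open>simp_all add: pair_act_forms\<close>)
  qed (simp add: A'_def)
  have A'ev: "form_eval A' x = form_eval C (x - (L x / L u) *s u)" for x
  proof -
    have "form_eval A' x = form_eval C x - \<mu> * ((r * c - d) * form_eval A x + (r * d + c) * form_eval B x)"
      by (simp add: A'_def pair_act_eval h_def C_def form_eval_add form_eval_scale algebra_simps)
    also have "\<dots> = form_eval C x - (L x)^2 / L u" unfolding Eev using e by (simp add: \<mu>_def)
    also have "\<dots> = form_eval C (x - (L x / L u) *s u)"
      unfolding polar using Lpos by (simp add: field_simps power2_eq_square)
    finally show ?thesis .
  qed
  have nonneg: "0 \<le> form_eval C x" for x
    using C(2) unfolding pos_def_def by (cases "x = 0") (auto simp: form_eval_def less_imp_le)
  have pos: "0 \<le> form_eval A' x" for x unfolding A'ev by (rule nonneg)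
  have aniso: "x = 0" if "form_eval A' x = 0" "L x = 0" for x
    using that C(2) unfolding A'ev pos_def_def by (cases "x = 0") auto
  obtain D :: int and v :: "int^3" where D: "D > 0" "of_int_vec v = of_int D *s u" by (rule clear_denominators)
  have "form_eval A' u = 0" unfolding A'ev using Lpos by (simp add: form_eval_def)
  hence v0: "form_eval A' (of_int_vec v) = 0" unfolding D form_eval_smult by simp
  have "v \<noteq> 0" using D u by (fastforce simp: vec_eq_iff)
  show ?thesis
  proof (rule that[OF h A'])
    show "pair_act (mat 1) h (A, B) = (A', lin_square (of_int_vec l))" using B' by (simp add: l'_def)
    show "(0, form_eval (lin_square (of_int_vec l)) (of_int_vec v)) \<in> qZ (A', lin_square (of_int_vec l))"
      unfolding qZ_def using v0 \<open>v \<noteq> 0\<close> by force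
    fix s t assume "(s, t) \<in> qZ (A', lin_square (of_int_vec l))"
    then obtain w :: "int^3" where w: "w \<noteq> 0" "s = form_eval A' (of_int_vec w)" "t = (L (of_int_vec w))^2"
      by (auto simp: qZ_def lin_square_eval3 L_def l'_def)
    have "of_int_vec w \<noteq> 0" using w(1) by (auto simp: vec_eq_iff)
    thus "0 \<le> s \<and> (s, t) \<noteq> (0, 0)" using pos aniso w(2,3) by auto
  qed
qed

section \<open>Forms all of whose values are squares\<close>

text \<open>
  Multiplying by \<open>4 \<alpha>\<^sup>2\<close> writes a square as \<open>(2 \<alpha>\<^sup>2 x + b)\<^sup>2 + K\<close> with \<open>K\<close> independent of \<open>x\<close>. For large \<open>x\<close>
  two different squares of this size are further apart than \<open>\<bar>K\<bar>\<close>, so \<open>K = 0\<close>. If \<open>\<alpha> = 0\<close>, a linear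
  function without negative values is constant.
\<close>
lemma square_quadratic_discriminant:
  fixes \<alpha> b c :: int
  assumes sq: "\<And>x :: int. \<exists>m. \<alpha>^2 * x^2 + b * x + c = m^2"
  shows "b^2 = 4 * \<alpha>^2 * c"
proof (cases "\<alpha> = 0")
  case True
  have nonneg: "0 \<le> b * x + c" for x using sq[of x] True by auto
  have "b = 0"
  proof (rule ccontr)
    assume "b \<noteq> 0"
    hence "1 \<le> \<bar>b\<bar>" by simp
    hence ge: "1 * (\<bar>c\<bar> + 1) \<le> \<bar>b\<bar> * (\<bar>c\<bar> + 1)" by (rule mult_right_mono) simp
    have "b * (- sgn b * (\<bar>c\<bar> + 1)) = - (\<bar>b\<bar> * (\<bar>c\<bar> + 1))" by (simp add: abs_sgn algebra_simps)
    with nonneg[of "- sgn b * (\<bar>c\<bar> + 1)"] have le: "0 \<le> - (\<bar>b\<bar> * (\<bar>c\<bar> + 1)) + c" by (simp only:)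
    define t where "t = \<bar>b\<bar> * (\<bar>c\<bar> + 1)"
    have "\<bar>c\<bar> + 1 \<le> t" "0 \<le> - t + c" using ge le by (simp_all add: t_def)
    thus False by linarith
  qed
  thus ?thesis using True by simp
next
  case False
  define K where "K = 4 * \<alpha>^2 * c - b^2"
  \<comment> \<open>large enough for \<open>Y > \<bar>K\<bar>\<close> below\<close>
  define x where "x = \<bar>K\<bar> + \<bar>b\<bar> + 1"
  define Y where "Y = 2 * \<alpha>^2 * x + b"
  obtain m where m: "\<alpha>^2 * x^2 + b * x + c = m^2" using sq by blast
  define Z where "Z = \<bar>2 * \<alpha> * m\<bar>"
  have "Z^2 = 4 * \<alpha>^2 * m^2" by (simp add: Z_def power_mult_distrib)
  also have "\<dots> = Y^2 + K" unfolding m [symmetric] Y_def K_def by (simp add: power2_eq_square algebra_simps)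
  finally have XY: "(Z - Y) * (Z + Y) = K" by (simp add: power2_eq_square algebra_simps)
  have "1 \<le> \<alpha>^2" using False by (simp add: int_one_le_iff_zero_less)
  hence "x \<le> \<alpha>^2 * x" by (simp add: x_def mult_le_cancel_right1)
  hence Y: "\<bar>K\<bar> < Y" unfolding Y_def x_def by linarith
  have "K = 0"
  proof (rule ccontr)
    assume "K \<noteq> 0"
    hence "Z - Y \<noteq> 0" using XY by auto
    hence "1 * \<bar>Z + Y\<bar> \<le> \<bar>Z - Y\<bar> * \<bar>Z + Y\<bar>" by (intro mult_right_mono) auto
    hence "\<bar>Z + Y\<bar> \<le> \<bar>K\<bar>" using XY by (simp add: abs_mult [symmetric])
    moreover have "0 \<le> Z" by (simp add: Z_def)
    ultimately show False using Y by linarith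
  qed
  thus ?thesis by (simp add: K_def)
qed

lemma form_eval_ext_int:
  assumes "A \<in> tern_forms" "B \<in> tern_forms" "\<And>v :: int^3. form_eval A (of_int_vec v) = form_eval B (of_int_vec v)"
  shows "A = B"
proof (rule form_eval_ext[OF assms(1,2)])
  fix x
  obtain D :: int and v :: "int^3" where D: "D > 0" "of_int_vec v = of_int D *s x" by (rule clear_denominators)
  have "of_int D ^ 2 * form_eval A x = of_int D ^ 2 * form_eval B x"
    unfolding form_eval_smult [symmetric] D(2) [symmetric] by (rule assms(3))
  thus "form_eval A x = form_eval B x" using D(1) by simp
qed

lemma form_eval_shift:
  assumes "B \<in> tern_forms"
  shows "form_eval B (k *s axis i 1 + y) = B$i$i * k^2 + 2 * k * (B$i$1 * y$1 + B$i$2 * y$2 + B$i$3 * y$3) + form_eval B y"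
proof -
  have s: "B$2$1 = B$1$2" "B$3$1 = B$1$3" "B$3$2 = B$2$3" using assms by (simp_all add: tern_forms_iff)
  show ?thesis
    using exhaust_3[of i] by (elim disjE) (simp_all add: form_eval_def sum_3 s axis_def power2_eq_square algebra_simps)
qed

text \<open>
  Along each line \<open>k e\<^sub>i + v\<close> the values are squares, so the discriminant vanishes there. So the
  linear form given by row \<open>i\<close> has the square \<open>B\<^sub>i\<^sub>i B(v)\<close> at \<open>v\<close>.
\<close>
lemma square_valued_form:
  assumes B: "B \<in> tern_forms" and sq: "\<And>v :: int^3. \<exists>n :: int. form_eval B (of_int_vec v) = of_int n ^ 2"
  obtains l :: "int^3" where "B = lin_square (of_int_vec l)"
proof -
  define L where "L i y = B$i$1 * y$1 + B$i$2 * y$2 + B$i$3 * y$3" for i and y :: "rat^3"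
  have diag: "\<exists>n :: int. B$i$i = of_int n ^ 2" for i
  proof -
    have "of_int_vec (axis i 1) = axis i 1" by (simp add: vec_eq_iff axis_def)
    moreover have "form_eval B (axis i 1) = B$i$i"
      using form_eval_shift[OF B, of 1 i 0] by (simp add: form_eval_def)
    ultimately show ?thesis using sq[of "axis i 1"] by simp
  qed
  have disc: "(L i (of_int_vec v))^2 = B$i$i * form_eval B (of_int_vec v)" for i and v :: "int^3"
  proof -
    obtain \<alpha> c :: int where ac: "B$i$i = of_int \<alpha> ^ 2" "form_eval B (of_int_vec v) = of_int c ^ 2"
      using diag sq by blast
    have ev: "form_eval B (of_int_vec (x *s axis i 1 + v)) =
       of_int (\<alpha>^2 * x^2) + 2 * of_int x * L i (of_int_vec v) + of_int (c^2)" for x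
    proof -
      have "of_int_vec (x *s axis i 1 + v) = of_int x *s axis i 1 + of_int_vec v"
        by (simp add: vec_eq_iff axis_def)
      thus ?thesis using form_eval_shift[OF B, of "of_int x" i "of_int_vec v"] ac by (simp add: L_def)
    qed
    obtain n :: int where n: "form_eval B (of_int_vec (1 *s axis i 1 + v)) = of_int n ^ 2" using sq by blast
    define b where "b = n^2 - \<alpha>^2 - c^2"
    have b: "2 * L i (of_int_vec v) = of_int b" using ev[of 1] n by (simp add: b_def)
    have "\<exists>m. \<alpha>^2 * x^2 + b * x + c^2 = m^2" for x
    proof -
      obtain m :: int where "form_eval B (of_int_vec (x *s axis i 1 + v)) = of_int m ^ 2" using sq by blast
      hence "of_int (\<alpha>^2 * x^2 + b * x + c^2) = (of_int (m^2) :: rat)"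
        unfolding ev using b by (simp add: algebra_simps)
      thus ?thesis by (metis of_int_eq_iff)
    qed
    hence "b^2 = 4 * \<alpha>^2 * c^2" by (rule square_quadratic_discriminant)
    hence "of_int (b^2) = (of_int (4 * \<alpha>^2 * c^2) :: rat)" by (simp only:)
    hence "(2 * L i (of_int_vec v))^2 = 4 * of_int \<alpha>^2 * of_int c^2" by (simp add: b)
    thus ?thesis by (simp add: ac power_mult_distrib)
  qed
  show ?thesis
  proof (cases "\<exists>i. B$i$i \<noteq> 0")
    case True
    then obtain i where i: "B$i$i \<noteq> 0" by blast
    obtain \<alpha> :: int where \<alpha>: "B$i$i = of_int \<alpha> ^ 2" using diag by blast
    have \<alpha>0: "\<alpha> \<noteq> 0" using i \<alpha> by auto
    have "\<exists>k :: int. B$i$j = of_int \<alpha> * of_int k" for j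
    proof -
      obtain m :: int where m: "B$j$j = of_int m ^ 2" using diag by blast
      have "L i (of_int_vec (axis j 1)) = B$i$j"
        using exhaust_3[of j] by (elim disjE) (simp_all add: L_def axis_def)
      moreover have "form_eval B (of_int_vec (axis j 1)) = B$j$j"
      proof -
        have "of_int_vec (axis j 1) = axis j 1" by (simp add: vec_eq_iff axis_def)
        thus ?thesis using form_eval_shift[OF B, of 1 j 0] by (simp add: form_eval_def)
      qed
      ultimately have "(B$i$j)^2 = (of_int \<alpha> * of_int m)^2" using disc[of i "axis j 1"] \<alpha> m by (simp add: power_mult_distrib)
      hence "B$i$j = of_int \<alpha> * of_int m \<or> B$i$j = of_int \<alpha> * of_int (-m)" by (simp add: power2_eq_iff)
      thus ?thesis by blast
    qed
    then obtain k where k: "\<And>j. B$i$j = of_int \<alpha> * of_int (k j)" by metis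
    have "B = lin_square (of_int_vec (\<chi> j. k j))"
    proof (rule form_eval_ext_int[OF B])
      fix v :: "int^3"
      have "L i (of_int_vec v) = of_int \<alpha> * (of_int (k 1) * of_int (v$1) + of_int (k 2) * of_int (v$2) + of_int (k 3) * of_int (v$3))"
        by (simp add: L_def k algebra_simps)
      thus "form_eval B (of_int_vec v) = form_eval (lin_square (of_int_vec (\<chi> j. k j))) (of_int_vec v)"
        using disc[of i v] \<alpha> \<alpha>0 by (simp add: lin_square_eval3 power_mult_distrib)
    qed simp
    thus ?thesis by (rule that)
  next
    case False
    have "B$i$j = 0" for i j
    proof -
      have "L i (of_int_vec (axis j 1)) = B$i$j"
        using exhaust_3[of j] by (elim disjE) (simp_all add: L_def axis_def)
      thus ?thesis using disc[of i "axis j 1"] False by simp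
    qed
    hence "B = lin_square (of_int_vec 0)" by (simp add: vec_eq_iff lin_square_def)
    thus ?thesis by (rule that)
  qed
qed

section \<open>Pairs in normal form with the same values\<close>

lemma qZ_normal:
  "(s, t) \<in> qZ (tern_form a c 0 (-b) 0 0, lin_square (of_int_vec (vector [p, q, N]))) \<longleftrightarrow>
   (\<exists>x y z :: int. (x, y, z) \<noteq> (0, 0, 0) \<and>
      s = a * of_int x ^ 2 - b * of_int x * of_int y + c * of_int y ^ 2 \<and> t = of_int (p * x + q * y + N * z) ^ 2)"
  (is "?l \<longleftrightarrow> ?r")
proof
  assume ?l
  then obtain v :: "int^3" where v: "v \<noteq> 0" "s = form_eval (tern_form a c 0 (-b) 0 0) (of_int_vec v)"
    "t = form_eval (lin_square (of_int_vec (vector [p, q, N]))) (of_int_vec v)"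
    by (auto simp: qZ_def)
  have "(v$1, v$2, v$3) \<noteq> (0, 0, 0)" using v(1) by (auto simp: vec_eq_iff forall_3)
  thus ?r using v(2,3)
    by (intro exI[of _ "v$1"] exI[of _ "v$2"] exI[of _ "v$3"]) (simp add: form_eval_tern_form lin_square_eval3)
next
  assume ?r
  then obtain x y z :: int where *: "(x, y, z) \<noteq> (0, 0, 0)"
      "s = a * of_int x ^ 2 - b * of_int x * of_int y + c * of_int y ^ 2" "t = of_int (p * x + q * y + N * z) ^ 2"
    by blast
  have "(vector [x, y, z] :: int^3) \<noteq> 0" using *(1) by (auto simp: vec_eq_iff forall_3)
  moreover have "s = form_eval (tern_form a c 0 (-b) 0 0) (of_int_vec (vector [x, y, z]))"
    "t = form_eval (lin_square (of_int_vec (vector [p, q, N]))) (of_int_vec (vector [x, y, z]))"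
    using *(2,3) by (simp_all add: form_eval_tern_form lin_square_eval3)
  ultimately show ?l unfolding qZ_def by force
qed

definition normal_pair :: "rat \<Rightarrow> rat \<Rightarrow> int \<Rightarrow> int \<Rightarrow> int \<Rightarrow> (rat^3^3) \<times> (rat^3^3)" where
  "normal_pair \<alpha> c N p q = (tern_form 1 c 0 (-\<alpha>) 0 0, lin_square (of_int_vec (vector [p, q, N])))"

lemma normal_pair_forms [simp]:
  "fst (normal_pair \<alpha> c N p q) \<in> tern_forms" "snd (normal_pair \<alpha> c N p q) \<in> tern_forms"
  by (simp_all add: normal_pair_def)

lemma qZ_normal_pair:
  "(s, t) \<in> qZ (normal_pair \<alpha> c N p q) \<longleftrightarrow>
   (\<exists>x y z :: int. (x, y, z) \<noteq> (0, 0, 0) \<and> s = binform \<alpha> c x y \<and> t = of_int (p * x + q * y + N * z) ^ 2)"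
  by (simp only: normal_pair_def qZ_normal binform_def mult_1)

lemma binform_ge_1:
  assumes "0 \<le> \<alpha>" "\<alpha> \<le> 1" "1 \<le> c" "(x, y) \<noteq> (0, 0)"
  shows "1 \<le> binform \<alpha> c x y"
proof (cases "y = 0")
  case True
  hence "of_int 1 \<le> (of_int (x^2) :: rat)" using assms(4) by (simp only: of_int_le_iff) (simp add: int_one_le_iff_zero_less)
  thus ?thesis using True by simp
next
  case False
  show ?thesis
  proof (cases "y = 1 \<or> y = -1")
    case True
    thus ?thesis using unit_ge[OF assms(1,2), of c "x * y"] assms(3) unfolding binform_unit[OF True] by simp
  next
    case False
    thus ?thesis using binform_ge[OF assms(1-3), of y x] \<open>y \<noteq> 0\<close> assms by auto
  qed
qed

text \<open>
  The values \<open>(0, t)\<close> occur exactly at multiples of the third basis vector, which shows \<open>N\<close> in the set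
  of values.
\<close>
lemma qZ_normal_level_dvd:
  assumes 1: "0 \<le> \<alpha>" "\<alpha> \<le> 1" "1 \<le> c" and 2: "0 \<le> \<beta>" "\<beta> \<le> 1" "1 \<le> d" and N: "0 < N"
    and eq: "qZ (normal_pair \<alpha> c N p q) = qZ (normal_pair \<beta> d M p' q')"
  shows "M dvd N"
proof -
  have "(0, of_int N ^ 2) \<in> qZ (normal_pair \<alpha> c N p q)"
    unfolding qZ_normal_pair using N by (intro exI[of _ 0] exI[of _ 1]) (simp add: binform_def)
  then obtain x y z :: int where *: "0 = binform \<beta> d x y" "of_int N ^ 2 = (of_int (p' * x + q' * y + M * z) ^ 2 :: rat)"
    unfolding eq qZ_normal_pair by blast
  have "x = 0" "y = 0" using binform_ge_1[OF 2, of x y] *(1) by auto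
  hence "(of_int (N ^ 2) :: rat) = of_int ((M * z) ^ 2)" using *(2) by simp
  hence "N ^ 2 = (M * z) ^ 2" by (simp only: of_int_eq_iff)
  hence "N = M * z \<or> N = - (M * z)" by (simp add: power2_eq_iff)
  thus ?thesis by auto
qed

text \<open>
  Adding a multiple of the third basis vector changes the linear form by a multiple of \<open>N\<close>.
  Therefore a value \<open>(v, r\<^sup>2)\<close> of the pair is the same as the residue \<open>\<plusminus>r\<close> at a vector of value \<open>v\<close> of
  the binary form.
\<close>
lemma qZ_normal_attains:
  assumes 1: "0 \<le> \<alpha>" "\<alpha> \<le> 1" "1 \<le> c" and 2: "0 \<le> \<beta>" "\<beta> \<le> 1" "1 \<le> d" and N: "0 < N"
    and sub: "qZ (normal_pair \<alpha> c N p q) \<subseteq> qZ (normal_pair \<beta> d N p' q')"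
    and r: "attains \<alpha> c N p q v r"
  shows "attains \<beta> d N p' q' v r"
proof -
  obtain x y where xy: "binform \<alpha> c x y = v" "N dvd r - (p * x + q * y)" using r by (auto simp: attains_def)
  obtain z where z: "r - (p * x + q * y) = N * z" using xy(2) by (elim dvdE)
  hence r_eq: "r = p * x + q * y + N * z" by simp
  show ?thesis
  proof (cases "(x, y, z) = (0, 0, 0)")
    case True
    hence "v = binform \<beta> d 0 0" "r = 0" using xy r_eq by (auto simp: binform_def)
    thus ?thesis unfolding attains_def by (intro exI[of _ 0]) simp
  next
    case False
    hence "(v, of_int r ^ 2) \<in> qZ (normal_pair \<alpha> c N p q)" unfolding qZ_normal_pair using xy(1) r_eq by blast
    hence "(v, of_int r ^ 2) \<in> qZ (normal_pair \<beta> d N p' q')" using sub by blast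
    then obtain x' y' z' where *: "v = binform \<beta> d x' y'" "of_int r ^ 2 = (of_int (p' * x' + q' * y' + N * z') ^ 2 :: rat)"
      unfolding qZ_normal_pair by blast
    have "(of_int (r ^ 2) :: rat) = of_int ((p' * x' + q' * y' + N * z') ^ 2)" using *(2) by simp
    hence "r ^ 2 = (p' * x' + q' * y' + N * z') ^ 2" by (simp only: of_int_eq_iff)
    hence "r = p' * x' + q' * y' + N * z' \<or> r = - (p' * x' + q' * y' + N * z')" by (simp only: power2_eq_iff)
    thus ?thesis
    proof
      assume "r = p' * x' + q' * y' + N * z'"
      thus ?thesis unfolding attains_def using *(1) by (intro exI[of _ x'] exI[of _ y']) simp
    next
      assume "r = - (p' * x' + q' * y' + N * z')"
      hence "r - (p' * (- x') + q' * (- y')) = N * (- z')" by simp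
      thus ?thesis unfolding attains_def using *(1) binform_uminus by (intro exI[of _ "- x'"] exI[of _ "- y'"]) (metis dvd_triv_left)
    qed
  qed
qed

lemma attains_binvalue: "binvalue \<alpha> c v \<longleftrightarrow> (\<exists>r. attains \<alpha> c N p q v r)"
  unfolding binvalue_def attains_def by (metis diff_self dvd_0_right)

text \<open>
  The automorphism of the binary form extends to three variables: the third one absorbs the
  discrepancy of the functionals, which is divisible by \<open>N\<close>.
\<close>
lemma linked_pair_act:
  assumes "linked \<alpha> c N p q p' q'"
  obtains w where "w \<in> GL3Z" "normal_pair \<alpha> c N p' q' = pair_act w (mat 1) (normal_pair \<alpha> c N p q)"
proof -
  obtain h11 h12 h21 h22 :: int where h: "\<bar>h11 * h22 - h12 * h21\<bar> = 1"
    "\<And>x y. binform \<alpha> c (h11 * x + h12 * y) (h21 * x + h22 * y) = binform \<alpha> c x y"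
    "N dvd p * h11 + q * h21 - p'" "N dvd p * h12 + q * h22 - q'"
    using assms unfolding linked_def by blast
  obtain s t where st: "p * h11 + q * h21 - p' = N * s" "p * h12 + q * h22 - q' = N * t"
    using h(3,4) by (elim dvdE)
  define w where "w = block_matrix h11 h12 h21 h22 (- s) (- t) 1"
  have inv: "(of_int h11 * x + of_int h12 * y)^2 - \<alpha> * (of_int h11 * x + of_int h12 * y) * (of_int h21 * x + of_int h22 * y)
      + c * (of_int h21 * x + of_int h22 * y)^2 = x^2 - \<alpha> * x * y + c * y^2" for x y :: rat
  proof -
    define A B C where "A = of_int h11 ^ 2 - \<alpha> * of_int h11 * of_int h21 + c * of_int h21 ^ 2"
      and "B = 2 * of_int h11 * of_int h12 - \<alpha> * (of_int h11 * of_int h22 + of_int h12 * of_int h21) + 2 * c * of_int h21 * of_int h22"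
      and "C = of_int h12 ^ 2 - \<alpha> * of_int h12 * of_int h22 + c * of_int h22 ^ 2"
    have *: "(of_int h11 * x + of_int h12 * y)^2 - \<alpha> * (of_int h11 * x + of_int h12 * y) * (of_int h21 * x + of_int h22 * y)
      + c * (of_int h21 * x + of_int h22 * y)^2 = A * x^2 + B * x * y + C * y^2" for x y :: rat
      by (simp add: A_def B_def C_def power2_eq_square algebra_simps)
    have e: "A * of_int x^2 + B * of_int x * of_int y + C * of_int y^2 = of_int x^2 - \<alpha> * of_int x * of_int y + c * of_int y^2" for x y :: int
      using h(2)[of x y] unfolding binform_def of_int_add of_int_mult * .
    have "A = 1" "C = c" using e[of 1 0] e[of 0 1] by simp_all
    moreover have "B = - \<alpha>" using e[of 1 1] calculation by simp
    ultimately show ?thesis unfolding * by simp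
  qed
  have "of_int (p * h11 + q * h21 - N * s) = (of_int p' :: rat)" "of_int (p * h12 + q * h22 - N * t) = (of_int q' :: rat)"
    using st by (simp_all only: of_int_eq_iff)
  hence pq: "of_int p' = of_int p * of_int h11 + of_int q * of_int h21 - of_int N * (of_int s :: rat)"
    "of_int q' = of_int p * of_int h12 + of_int q * of_int h22 - of_int N * (of_int t :: rat)" by simp_all
  have "normal_pair \<alpha> c N p' q' = pair_act w (mat 1) (normal_pair \<alpha> c N p q)"
  proof (rule pair_eqI)
    fix x
    show "form_eval (fst (normal_pair \<alpha> c N p' q')) x =
        (mat 1 :: rat^2^2)$1$1 * form_eval (fst (normal_pair \<alpha> c N p q)) (x v* w) +
        (mat 1 :: rat^2^2)$1$2 * form_eval (snd (normal_pair \<alpha> c N p q)) (x v* w)"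
      using inv[of "x$1" "x$2"] by (simp add: normal_pair_def form_eval_tern_form w_def block_matrix_act)
    show "form_eval (snd (normal_pair \<alpha> c N p' q')) x =
        (mat 1 :: rat^2^2)$2$1 * form_eval (fst (normal_pair \<alpha> c N p q)) (x v* w) +
        (mat 1 :: rat^2^2)$2$2 * form_eval (snd (normal_pair \<alpha> c N p q)) (x v* w)"
      by (simp add: normal_pair_def lin_square_eval3 w_def block_matrix_act pq algebra_simps)
  qed simp_all
  moreover have "w \<in> GL3Z" unfolding w_def using h(1) by (intro block_matrix_GL3Z) auto
  ultimately show ?thesis using that by blast
qed

definition diag2 :: "rat \<Rightarrow> rat \<Rightarrow> rat^2^2" where
  "diag2 a b = vector [vector [a, 0], vector [0, b]]"

lemma diag2_nth [simp]: "diag2 a b $1$1 = a" "diag2 a b $1$2 = 0" "diag2 a b $2$1 = 0" "diag2 a b $2$2 = b"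
  by (simp_all add: diag2_def)

lemma invertible_diag2: "a \<noteq> 0 \<Longrightarrow> b \<noteq> 0 \<Longrightarrow> invertible (diag2 a b)"
  by (simp add: invertible_det_nz det_2)

text \<open>
  Multiples of \<open>N\<close> in \<open>p\<close> and \<open>q\<close> are absorbed by the third variable, and the common factor \<open>d\<close> of what is
  left goes into the scaling of the second form. The sign \<open>\<epsilon>\<close> can be chosen freely because only the
  square matters.
\<close>
lemma normal_pair_absorb:
  assumes p: "p = d * k + N * s" and q: "q = d * l + N * t" and N: "N = d * n" and e: "\<bar>\<epsilon>\<bar> = 1"
  obtains w where "w \<in> GL3Z" "normal_pair \<alpha> c N p q = pair_act w (diag2 1 (of_int d ^ 2))
      (tern_form 1 c 0 (-\<alpha>) 0 0, lin_square (vector [of_int (\<epsilon> * k), of_int (\<epsilon> * l), of_int n]))"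
proof -
  define w where "w = block_matrix 1 0 0 1 (\<epsilon> * s) (\<epsilon> * t) \<epsilon>"
  have e2: "\<epsilon> * \<epsilon> = 1" using e by (metis abs_mult_self_eq mult_1)
  define Q where "Q = (tern_form 1 c 0 (-\<alpha>) 0 0, lin_square (vector [of_int (\<epsilon> * k), of_int (\<epsilon> * l), of_int n]))"
  have "normal_pair \<alpha> c N p q = pair_act w (diag2 1 (of_int d ^ 2)) Q"
  proof (rule pair_eqI)
    fix x
    show "form_eval (fst (normal_pair \<alpha> c N p q)) x =
        diag2 1 (of_int d ^ 2)$1$1 * form_eval (fst Q) (x v* w) + diag2 1 (of_int d ^ 2)$1$2 * form_eval (snd Q) (x v* w)"
      by (simp add: normal_pair_def Q_def form_eval_tern_form w_def block_matrix_act)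
    have e2': "of_int \<epsilon> ^ 2 = (1 :: rat)" using e2 by (metis of_int_1 of_int_mult power2_eq_square)
    have "of_int p * x$1 + of_int q * x$2 + of_int N * x$3 =
      of_int d * (of_int k * x$1 + of_int l * x$2 + of_int n * (of_int s * x$1 + of_int t * x$2 + x$3))"
      by (simp add: p q N algebra_simps)
    also have "\<dots>^2 = of_int d ^ 2 * (of_int \<epsilon> * (of_int k * x$1 + of_int l * x$2 + of_int n * (of_int s * x$1 + of_int t * x$2 + x$3)))^2"
      by (simp add: power_mult_distrib e2')
    finally show "form_eval (snd (normal_pair \<alpha> c N p q)) x =
        diag2 1 (of_int d ^ 2)$2$1 * form_eval (fst Q) (x v* w) + diag2 1 (of_int d ^ 2)$2$2 * form_eval (snd Q) (x v* w)"
      by (simp add: normal_pair_def Q_def lin_square_eval3 w_def block_matrix_act algebra_simps)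
  qed (simp_all add: Q_def)
  moreover have "w \<in> GL3Z" unfolding w_def using e by (intro block_matrix_GL3Z) auto
  ultimately show ?thesis using that by (simp add: Q_def)
qed

abbreviation hex_form :: "rat^3^3" where "hex_form \<equiv> tern_form 1 1 0 (-1) 0 0"
abbreviation rect_form :: "rat^3^3" where "rect_form \<equiv> tern_form 1 3 0 0 0 0"

text \<open>
  If \<open>N\<close> divides \<open>p\<close>, all coefficients are absorbed and \<open>d = N\<close> remains. Otherwise \<open>3 p = 0\<close> modulo \<open>N\<close>
  forces \<open>N = 3 d\<close> and \<open>p = \<plusminus>d\<close> modulo \<open>N\<close>. The same \<open>d\<close> serves for both pairs, so one change of basis of
  the pencil works for both.
\<close>
lemma exceptional_pairs:
  assumes N: "0 < N" and R: "\<And>v r. attains 1 1 N p q v r \<longleftrightarrow> attains 0 3 N p' q' v r"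
  obtains w w' g where "w \<in> GL3Z" "w' \<in> GL3Z" "invertible g"
    "normal_pair 1 1 N p q = pair_act w g (hex_form, lin_square (vector [0, 0, 1])) \<and>
     normal_pair 0 3 N p' q' = pair_act w' g (rect_form, lin_square (vector [0, 0, 1])) \<or>
     normal_pair 1 1 N p q = pair_act w g (hex_form, lin_square (vector [1, 1, 3])) \<and>
     normal_pair 0 3 N p' q' = pair_act w' g (rect_form, lin_square (vector [1, 0, 3]))"
proof -
  note ex = residues_exceptional[OF R]
  obtain i where i: "q = p + N * i" using ex(1) by (metis add.commute diff_eq_eq dvdE)
  obtain t where t: "q' = N * t" using ex(4) by (elim dvdE)
  show ?thesis
  proof (cases "N dvd p")
    case True
    then obtain s where s: "p = N * s" by (elim dvdE)
    have "N dvd p'" using ex(3) True unfolding cong_pm_def by (metis dvd_add_left_iff dvd_diff_left_iff)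
    then obtain s' where s': "p' = N * s'" by (elim dvdE)
    obtain w where w: "w \<in> GL3Z" "normal_pair 1 1 N p q = pair_act w (diag2 1 (of_int N ^ 2))
      (tern_form 1 1 0 (-1) 0 0, lin_square (vector [of_int (1 * 0), of_int (1 * 0), of_int 1]))"
      by (rule normal_pair_absorb[of p N 0 N s q 0 "s + i" 1 1 1 1]) (auto simp: s i algebra_simps)
    obtain w' where w': "w' \<in> GL3Z" "normal_pair 0 3 N p' q' = pair_act w' (diag2 1 (of_int N ^ 2))
      (tern_form 1 3 0 (-0) 0 0, lin_square (vector [of_int (1 * 0), of_int (1 * 0), of_int 1]))"
      by (rule normal_pair_absorb[of p' N 0 N s' q' 0 t 1 1 0 3]) (auto simp: s' t)
    have "invertible (diag2 1 (of_int N ^ 2))" using N by (intro invertible_diag2) auto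
    thus ?thesis using that w w' by simp
  next
    case False
    obtain k where k: "3 * p = N * k" using ex(2) by (elim dvdE)
    have k3: "\<not> 3 dvd k"
    proof
      assume "3 dvd k"
      then obtain j where "k = 3 * j" by (elim dvdE)
      hence "p = N * j" using k by simp
      thus False using False by simp
    qed
    have "3 dvd N * k" using k by (metis dvd_triv_left)
    hence "3 dvd N" using k3 by (simp add: prime_dvd_mult_iff)
    then obtain d where d: "N = 3 * d" by (elim dvdE)
    have p: "p = d * k" using k d by simp
    have "k mod 3 = 1 \<or> k mod 3 = 2" using k3 by presburger
    then obtain j \<epsilon> where \<epsilon>: "k = 3 * j + \<epsilon>" "\<bar>\<epsilon>\<bar> = 1"
    proof
      assume "k mod 3 = 1"
      hence "k = 3 * (k div 3) + 1" by presburger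
      thus ?thesis using that[of "k div 3" 1] by simp
    next
      assume "k mod 3 = 2"
      hence "k = 3 * (k div 3 + 1) + -1" by presburger
      thus ?thesis using that[of "k div 3 + 1" "-1"] by simp
    qed
    have e1: "\<epsilon> * \<epsilon> = 1" using \<epsilon>(2) by (metis abs_mult_self_eq mult_1)
    obtain s' \<epsilon>' where s': "p' = d * \<epsilon>' + N * s'" "\<bar>\<epsilon>'\<bar> = 1"
    proof -
      from ex(3) show ?thesis unfolding cong_pm_def
      proof
        assume "N dvd p' - p"
        then obtain m where "p' - p = N * m" by (elim dvdE)
        hence "p' = d * \<epsilon> + N * (j + m)" using p \<epsilon> d by (simp add: algebra_simps)
        thus ?thesis using that \<epsilon>(2) by blast
      next
        assume "N dvd p' + p"
        then obtain m where "p' + p = N * m" by (elim dvdE)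
        hence "p' = d * (- \<epsilon>) + N * (m - j)" using p \<epsilon> d by (simp add: algebra_simps)
        moreover have "\<bar>- \<epsilon>\<bar> = 1" using \<epsilon>(2) by simp
        ultimately show ?thesis using that by blast
      qed
    qed
    have e1': "\<epsilon>' * \<epsilon>' = 1" using s'(2) by (metis abs_mult_self_eq mult_1)
    obtain w where w: "w \<in> GL3Z" "normal_pair 1 1 N p q = pair_act w (diag2 1 (of_int d ^ 2))
      (tern_form 1 1 0 (-1) 0 0, lin_square (vector [of_int (\<epsilon> * \<epsilon>), of_int (\<epsilon> * \<epsilon>), of_int 3]))"
      by (rule normal_pair_absorb[of p d \<epsilon> N j q \<epsilon> "j + i" 3 \<epsilon> 1 1]) (use \<epsilon> in \<open>auto simp: p i d algebra_simps\<close>)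
    obtain w' where w': "w' \<in> GL3Z" "normal_pair 0 3 N p' q' = pair_act w' (diag2 1 (of_int d ^ 2))
      (tern_form 1 3 0 (-0) 0 0, lin_square (vector [of_int (\<epsilon>' * \<epsilon>'), of_int (\<epsilon>' * 0), of_int 3]))"
      by (rule normal_pair_absorb[of p' d \<epsilon>' N s' q' 0 t 3 \<epsilon>' 0 3]) (use s' in \<open>auto simp: t d\<close>)
    have "invertible (diag2 1 (of_int d ^ 2))" using N d by (intro invertible_diag2) auto
    thus ?thesis using that w w' by (simp add: e1 e1')
  qed
qed

lemma pair_act_cancel:
  assumes "h ** g = mat 1" "fst P \<in> tern_forms" "snd P \<in> tern_forms" "g ** h = mat 1"
    and "pair_act (mat 1) h P = Q"
  shows "P = pair_act (mat 1) g Q"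
  using assms pair_act_comp[of P "mat 1" g "mat 1" h] pair_act_id[of P] by simp

lemma normal_pair_scale:
  assumes "a \<noteq> 0"
  shows "(tern_form a c 0 (-b) 0 0, lin_square (of_int_vec (vector [p, q, N]))) =
     pair_act (mat 1) (diag2 a 1) (normal_pair (b / a) (c / a) N p q)"
proof (rule pair_eqI)
  fix x :: "rat^3"
  have "a * (x$1^2 + (c / a) * x$2^2 + - (b / a) * x$1 * x$2) = a * x$1^2 + c * x$2^2 + - b * x$1 * x$2"
    using assms by (simp add: distrib_left right_diff_distrib)
  thus "form_eval (fst (tern_form a c 0 (-b) 0 0, lin_square (of_int_vec (vector [p, q, N])))) x =
      diag2 a 1 $1$1 * form_eval (fst (normal_pair (b / a) (c / a) N p q)) (x v* mat 1)
      + diag2 a 1 $1$2 * form_eval (snd (normal_pair (b / a) (c / a) N p q)) (x v* mat 1)"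
    by (simp add: normal_pair_def form_eval_tern_form)
qed (simp_all add: normal_pair_def)

text \<open>
  The leading coefficient of a reduced form is its least nonzero value.
\<close>
lemma normal_form_leading_coeff:
  assumes "0 \<le> b" "b \<le> a" "a \<le> c" "0 < a"
    and "0 \<le> b'" "b' \<le> a'" "a' \<le> c'" "0 < a'"
    and eq: "qZ (tern_form a c 0 (-b) 0 0, lin_square (of_int_vec (vector [p, q, N]))) =
      qZ (tern_form a' c' 0 (-b') 0 0, lin_square (of_int_vec (vector [p', q', N'])))"
  shows "a \<le> a'"
proof -
  have "(a', of_int p' ^ 2) \<in> qZ (tern_form a' c' 0 (-b') 0 0, lin_square (of_int_vec (vector [p', q', N'])))"
    unfolding qZ_normal by (intro exI[of _ 1] exI[of _ 0]) simp
  then obtain x y :: int where xy: "a' = a * of_int x ^ 2 - b * of_int x * of_int y + c * of_int y ^ 2"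
    unfolding eq [symmetric] qZ_normal by blast
  have "a' = a * binform (b / a) (c / a) x y" using xy assms(4) by (simp add: binform_def distrib_left right_diff_distrib)
  moreover have "(x, y) \<noteq> (0, 0)" using xy assms(8) by auto
  hence "1 \<le> binform (b / a) (c / a) x y" using assms(1-4) by (intro binform_ge_1) simp_all
  ultimately show ?thesis using assms(4) by simp
qed

lemma exceptional_pairs_set:
  assumes "0 < N" and "\<And>v r. attains 1 1 N p q v r \<longleftrightarrow> attains 0 3 N p' q' v r"
  shows "\<exists>w1\<in>GL3Z. \<exists>w2\<in>GL3Z. \<exists>g\<in>GL2Q.
     {normal_pair 1 1 N p q, normal_pair 0 3 N p' q'} =
       {pair_act w1 g (hex_form, lin_square (vector [0, 0, 1])), pair_act w2 g (rect_form, lin_square (vector [0, 0, 1]))} \<or>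
     {normal_pair 1 1 N p q, normal_pair 0 3 N p' q'} =
       {pair_act w1 g (hex_form, lin_square (vector [1, 1, 3])), pair_act w2 g (rect_form, lin_square (vector [1, 0, 3]))}"
proof (rule exceptional_pairs[OF assms])
  fix w w' g
  assume w: "w \<in> GL3Z" "w' \<in> GL3Z" "invertible g"
    and *: "normal_pair 1 1 N p q = pair_act w g (hex_form, lin_square (vector [0, 0, 1])) \<and>
     normal_pair 0 3 N p' q' = pair_act w' g (rect_form, lin_square (vector [0, 0, 1])) \<or>
     normal_pair 1 1 N p q = pair_act w g (hex_form, lin_square (vector [1, 1, 3])) \<and>
     normal_pair 0 3 N p' q' = pair_act w' g (rect_form, lin_square (vector [1, 0, 3]))"
  have "g \<in> GL2Q" using w by (simp add: GL2Q_def)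
  from * show ?thesis
    by (intro bexI[OF _ w(1)] bexI[OF _ w(2)] bexI[OF _ \<open>g \<in> GL2Q\<close>], elim disjE conjE) (simp_all only: simp_thms)
qed

lemma classification:
  assumes 1: "0 \<le> \<alpha>" "\<alpha> \<le> 1" "1 \<le> c" "0 < N" and 2: "0 \<le> \<beta>" "\<beta> \<le> 1" "1 \<le> d" "0 < M"
    and eq: "qZ (normal_pair \<alpha> c N p q) = qZ (normal_pair \<beta> d M p' q')"
  shows "(\<exists>w\<in>GL3Z. normal_pair \<alpha> c N p q = pair_act w (mat 1) (normal_pair \<beta> d M p' q')) \<or>
    (\<exists>w1\<in>GL3Z. \<exists>w2\<in>GL3Z. \<exists>g\<in>GL2Q.
       {normal_pair \<alpha> c N p q, normal_pair \<beta> d M p' q'} =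
         {pair_act w1 g (hex_form, lin_square (vector [0, 0, 1])), pair_act w2 g (rect_form, lin_square (vector [0, 0, 1]))} \<or>
       {normal_pair \<alpha> c N p q, normal_pair \<beta> d M p' q'} =
         {pair_act w1 g (hex_form, lin_square (vector [1, 1, 3])), pair_act w2 g (rect_form, lin_square (vector [1, 0, 3]))})"
    (is "?same \<or> ?exc")
proof -
  have "M dvd N" "N dvd M"
    using qZ_normal_level_dvd[OF 1(1-3) 2(1-3) 1(4) eq] qZ_normal_level_dvd[OF 2(1-3) 1(1-3) 2(4) eq [symmetric]] by auto
  hence NM: "M = N" using 1(4) 2(4) by (simp add: zdvd_antisym_nonneg)
  have R: "attains \<alpha> c N p q v r \<longleftrightarrow> attains \<beta> d N p' q' v r" for v r
    using qZ_normal_attains[OF 1(1-3) 2(1-3) 1(4)] qZ_normal_attains[OF 2(1-3) 1(1-3) 1(4)] eq unfolding NM by blast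
  have "binvalue \<alpha> c v \<longleftrightarrow> binvalue \<beta> d v" for v using attains_binvalue R by metis
  from same_values[OF 1(1-3) 2(1-3) this]
  consider "\<alpha> = \<beta>" "c = d" | "\<alpha> = 0" "c = 3" "\<beta> = 1" "d = 1" | "\<beta> = 0" "d = 3" "\<alpha> = 1" "c = 1" by blast
  thus ?thesis
  proof cases
    case 1
    have "linked \<beta> d N p' q' p q" using linked_if_same_attains[OF 2(1-3)] R unfolding 1 by blast
    then obtain w where "w \<in> GL3Z" "normal_pair \<beta> d N p q = pair_act w (mat 1) (normal_pair \<beta> d N p' q')"
      by (rule linked_pair_act)
    thus ?thesis unfolding 1 NM by (intro disjI1 bexI[of _ w])
  next
    case 2
    have "attains 1 1 N p' q' v r \<longleftrightarrow> attains 0 3 N p q v r" for v r using R unfolding 2 by blast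
    from exceptional_pairs_set[OF \<open>0 < N\<close> this]
    have ?exc unfolding 2 NM insert_commute[of "normal_pair 0 3 N p q"] .
    thus ?thesis by (rule disjI2)
  next
    case 3
    have "attains 1 1 N p q v r \<longleftrightarrow> attains 0 3 N p' q' v r" for v r using R unfolding 3 by blast
    from exceptional_pairs_set[OF \<open>0 < N\<close> this]
    have ?exc unfolding 3 NM .
    thus ?thesis by (rule disjI2)
  qed
qed

section \<open>Pairs with a multiple root\<close>

lemma transport_doubleton:
  assumes eq: "{Q1, Q2} = {pair_act u1 k S, pair_act u2 k T}"
    and w: "w1 \<in> GL3Z" "w2 \<in> GL3Z" "u1 \<in> GL3Z" "u2 \<in> GL3Z"
    and forms: "fst S \<in> tern_forms" "snd S \<in> tern_forms" "fst T \<in> tern_forms" "snd T \<in> tern_forms"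
  shows "\<exists>z1\<in>GL3Z. \<exists>z2\<in>GL3Z. {pair_act w1 G Q1, pair_act w2 G Q2} =
    {pair_act z1 (G ** k) S, pair_act z2 (G ** k) T}"
proof -
  from eq consider "Q1 = pair_act u1 k S" "Q2 = pair_act u2 k T" | "Q1 = pair_act u2 k T" "Q2 = pair_act u1 k S"
    unfolding doubleton_eq_iff by blast
  thus ?thesis
  proof cases
    case 1
    show ?thesis unfolding 1 pair_act_comp[OF forms(1,2)] pair_act_comp[OF forms(3,4)]
      by (intro bexI[of _ "w1 ** u1"] bexI[of _ "w2 ** u2"] refl GL3Z_mult w)
  next
    case 2
    show ?thesis unfolding 2 pair_act_comp[OF forms(1,2)] pair_act_comp[OF forms(3,4)]
      by (intro bexI[of _ "w2 ** u1"] bexI[of _ "w1 ** u2"] insert_commute GL3Z_mult w)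
  qed
qed

text \<open>
  An invertible change of basis of the pencil acts injectively on values.
\<close>
lemma qZ_diag2_cancel:
  assumes "a \<noteq> 0" "fst P \<in> tern_forms" "snd P \<in> tern_forms" "fst Q \<in> tern_forms" "snd Q \<in> tern_forms"
    and "qZ (pair_act (mat 1) (diag2 a 1) P) = qZ (pair_act (mat 1) (diag2 a 1) Q)"
  shows "qZ P = qZ Q"
proof -
  have "inj (\<lambda>(s, t :: rat). (a * s, t))" using assms(1) by (auto simp: inj_on_def)
  thus ?thesis using assms(6) by (simp add: qZ_pair_act GL3Z_1 assms(2-5) inj_image_eq_iff)
qed

definition equivalent_or_exceptional :: "(rat^3^3) \<times> (rat^3^3) \<Rightarrow> (rat^3^3) \<times> (rat^3^3) \<Rightarrow> bool" where
  "equivalent_or_exceptional P Q \<longleftrightarrow> (\<exists>w\<in>GL3Z. P = pair_act w (mat 1) Q) \<or>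
    (\<exists>w1\<in>GL3Z. \<exists>w2\<in>GL3Z. \<exists>v\<in>GL2Q.
       {P, Q} = {pair_act w1 v (hex_form, lin_square (vector [0, 0, 1])),
          pair_act w2 v (rect_form, lin_square (vector [0, 0, 1]))} \<or>
       {P, Q} = {pair_act w1 v (hex_form, lin_square (vector [1, 1, 3])),
          pair_act w2 v (rect_form, lin_square (vector [1, 0, 3]))})"

text \<open>
  A change of basis of the pencil applied to both pairs at once, with arbitrary integral
  substitutions in the variables, preserves the alternative, since it only multiplies the matrices
  that occur in it.
\<close>
lemma equivalent_or_exceptional_transport:
  assumes e: "equivalent_or_exceptional P Q" and w: "w1 \<in> GL3Z" "w2 \<in> GL3Z" and g: "invertible g"
    and Q: "fst Q \<in> tern_forms" "snd Q \<in> tern_forms"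
  shows "equivalent_or_exceptional (pair_act w1 g P) (pair_act w2 g Q)"
proof -
  from e consider (same) u where "u \<in> GL3Z" "P = pair_act u (mat 1) Q"
    | (exc) u1 u2 v where "u1 \<in> GL3Z" "u2 \<in> GL3Z" "v \<in> GL2Q"
       "{P, Q} = {pair_act u1 v (hex_form, lin_square (vector [0, 0, 1])),
          pair_act u2 v (rect_form, lin_square (vector [0, 0, 1]))} \<or>
       {P, Q} = {pair_act u1 v (hex_form, lin_square (vector [1, 1, 3])),
          pair_act u2 v (rect_form, lin_square (vector [1, 0, 3]))}"
    unfolding equivalent_or_exceptional_def by blast
  thus ?thesis
  proof cases
    case same
    obtain z where z: "z \<in> GL3Z" "z ** w2 = mat 1" using GL3Z_inverse[OF w(2)] by metis
    have "pair_act w1 g P = pair_act (w1 ** u ** z) (mat 1) (pair_act w2 g Q)"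
      unfolding same(2) pair_act_comp[OF Q] using z(2) by (simp flip: matrix_mul_assoc)
    moreover have "w1 ** u ** z \<in> GL3Z" using w same z by (intro GL3Z_mult)
    ultimately show ?thesis unfolding equivalent_or_exceptional_def by blast
  next
    case exc
    have "g ** v \<in> GL2Q" using g exc(3) by (simp add: GL2Q_def invertible_mult)
    thus ?thesis
      using exc(4) transport_doubleton[OF _ w exc(1,2), of P Q v _ _ g]
      unfolding equivalent_or_exceptional_def
      by (metis fst_conv snd_conv tern_forms_tern_form tern_forms_lin_square)
  qed
qed

lemma equivalent_or_exceptional_sym:
  assumes "equivalent_or_exceptional P Q" "fst Q \<in> tern_forms" "snd Q \<in> tern_forms"
  shows "equivalent_or_exceptional Q P"
proof -
  have "\<exists>z\<in>GL3Z. Q = pair_act z (mat 1) P" if u: "u \<in> GL3Z" "P = pair_act u (mat 1) Q" for u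
  proof -
    obtain z where "z \<in> GL3Z" "z ** u = mat 1" using GL3Z_inverse[OF u(1)] by metis
    thus ?thesis unfolding u(2) using assms(2,3) by (intro bexI[of _ z]) (simp_all add: pair_act_comp pair_act_id)
  qed
  thus ?thesis using assms(1) unfolding equivalent_or_exceptional_def insert_commute[of Q P] by blast
qed

text \<open>
  The first pair supplies the change of basis \<open>h\<close> of the pencil. The second pair is brought to the
  same shape by the same \<open>h\<close>, using nothing but its set of values.
\<close>
lemma multiple_root_classification:
  assumes forms: "A1 \<in> tern_forms" "B1 \<in> tern_forms" "A2 \<in> tern_forms" "B2 \<in> tern_forms"
    and ind: "lin_indep_pair A1 B1" and pd: "\<exists>c d. pos_def (mat_scale c A1 + mat_scale d B1)"
    and eq: "qZ (A1, B1) = qZ (A2, B2)" and root: "has_multiple_root (det_cubic (A1, B1))"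
  shows "equivalent_or_exceptional (A1, B1) (A2, B2)"
proof -
  obtain h :: "rat^2^2" and A1' and l1 :: "int^3" and t0 where h: "invertible h" and A1': "A1' \<in> tern_forms"
    and P1': "pair_act (mat 1) h (A1, B1) = (A1', lin_square (of_int_vec l1))"
    and val: "\<And>s t. (s, t) \<in> qZ (A1', lin_square (of_int_vec l1)) \<Longrightarrow> 0 \<le> s \<and> (s, t) \<noteq> (0, 0)"
    and zero: "(0, t0) \<in> qZ (A1', lin_square (of_int_vec l1))"
  proof -
    show thesis by (rule multiple_root_reduction[OF forms(1,2) ind pd root]) (rule that)
  qed
  obtain g where g: "h ** g = mat 1" "g ** h = mat 1" using h by (auto simp: invertible_def)
  define A2' where "A2' = fst (pair_act (mat 1) h (A2, B2))"
  define B2' where "B2' = snd (pair_act (mat 1) h (A2, B2))"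
  have forms': "A2' \<in> tern_forms" "B2' \<in> tern_forms" using forms by (simp_all add: A2'_def B2'_def pair_act_forms)
  have P2': "pair_act (mat 1) h (A2, B2) = (A2', B2')" by (simp add: A2'_def B2'_def)
  have eq': "qZ (A1', lin_square (of_int_vec l1)) = qZ (A2', B2')"
    unfolding P1' [symmetric] P2' [symmetric] using forms eq by (simp add: qZ_pair_act GL3Z_1)
  obtain l2 :: "int^3" where l2: "B2' = lin_square (of_int_vec l2)"
  proof (rule square_valued_form[OF forms'(2)])
    fix v :: "int^3"
    show "\<exists>n :: int. form_eval B2' (of_int_vec v) = of_int n ^ 2"
    proof (cases "v = 0")
      case True
      thus ?thesis by (intro exI[of _ 0]) (simp add: form_eval_def)
    next
      case False
      hence "(form_eval A2' (of_int_vec v), form_eval B2' (of_int_vec v)) \<in> qZ (A2', B2')" by (auto simp: qZ_def)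
      then obtain w :: "int^3" where "form_eval B2' (of_int_vec v) = form_eval (lin_square (of_int_vec l1)) (of_int_vec w)"
        unfolding eq' [symmetric] by (auto simp: qZ_def)
      thus ?thesis
        by (intro exI[of _ "l1$1 * w$1 + l1$2 * w$2 + l1$3 * w$3"]) (simp add: lin_square_eval3)
    qed
  qed
  obtain w1 a b c p q N where w1: "w1 \<in> GL3Z" and abc: "0 \<le> b" "b \<le> a" "a \<le> c" "0 < a" and N: "0 < N"
    and n1: "(A1', lin_square (of_int_vec l1)) = pair_act w1 (mat 1)
       (tern_form a c 0 (-b) 0 0, lin_square (of_int_vec (vector [p, q, N])))"
    by (rule normal_form[OF A1' val zero]) blast+
  obtain w2 a' b' c' p' q' M where w2: "w2 \<in> GL3Z" and abc': "0 \<le> b'" "b' \<le> a'" "a' \<le> c'" "0 < a'" and M: "0 < M"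
    and n2: "(A2', lin_square (of_int_vec l2)) = pair_act w2 (mat 1)
       (tern_form a' c' 0 (-b') 0 0, lin_square (of_int_vec (vector [p', q', M])))"
    by (rule normal_form[OF forms'(1) val[unfolded eq' l2] zero[unfolded eq' l2]]) blast+
  have eqn: "qZ (tern_form a c 0 (-b) 0 0, lin_square (of_int_vec (vector [p, q, N]))) =
    qZ (tern_form a' c' 0 (-b') 0 0, lin_square (of_int_vec (vector [p', q', M])))"
    using eq' unfolding l2 n1 n2 by (simp add: qZ_GL3Z w1 w2)
  have "a \<le> a'" "a' \<le> a"
    using normal_form_leading_coeff[OF abc abc' eqn] normal_form_leading_coeff[OF abc' abc eqn [symmetric]] by auto
  hence a': "a' = a" by simp
  define Q1 where "Q1 = normal_pair (b / a) (c / a) N p q"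
  define Q2 where "Q2 = normal_pair (b' / a) (c' / a) M p' q'"
  have Q: "fst Q1 \<in> tern_forms" "snd Q1 \<in> tern_forms" "fst Q2 \<in> tern_forms" "snd Q2 \<in> tern_forms"
    by (simp_all add: Q1_def Q2_def)
  have a0: "a \<noteq> 0" using abc by simp
  have s: "(tern_form a c 0 (-b) 0 0, lin_square (of_int_vec (vector [p, q, N]))) = pair_act (mat 1) (diag2 a 1) Q1"
    "(tern_form a' c' 0 (-b') 0 0, lin_square (of_int_vec (vector [p', q', M]))) = pair_act (mat 1) (diag2 a 1) Q2"
    unfolding Q1_def Q2_def a' by (rule normal_pair_scale[OF a0])+
  have "qZ Q1 = qZ Q2" by (rule qZ_diag2_cancel[OF a0 Q]) (use eqn s in simp)
  hence cl: "equivalent_or_exceptional Q1 Q2"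
    unfolding Q1_def Q2_def equivalent_or_exceptional_def
    using abc abc' a' by (intro classification N M) simp_all
  have "(A1, B1) = pair_act (mat 1) g (A1', lin_square (of_int_vec l1))"
    by (rule pair_act_cancel[OF g(1) _ _ g(2) P1']) (simp_all add: forms)
  hence P1: "(A1, B1) = pair_act w1 (g ** diag2 a 1) Q1"
    unfolding n1 s by (simp add: pair_act_comp pair_act_forms Q)
  have "(A2, B2) = pair_act (mat 1) g (A2', lin_square (of_int_vec l2))"
    by (rule pair_act_cancel[OF g(1) _ _ g(2)]) (simp_all add: forms P2' l2)
  hence P2: "(A2, B2) = pair_act w2 (g ** diag2 a 1) Q2"
    unfolding n2 s by (simp add: pair_act_comp pair_act_forms Q)
  have "invertible g" using g by (auto simp: invertible_def)
  hence "invertible (g ** diag2 a 1)" using a0 by (intro invertible_mult invertible_diag2) auto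
  thus ?thesis unfolding P1 P2 by (intro equivalent_or_exceptional_transport cl w1 w2 Q)
qed

theorem proposition1p2:
  fixes A1 B1 A2 B2 :: "rat^3^3"
  assumes "A1 \<in> tern_forms" "B1 \<in> tern_forms" "A2 \<in> tern_forms" "B2 \<in> tern_forms"
    and "lin_indep_pair A1 B1" "lin_indep_pair A2 B2"
    and "\<exists>c d. pos_def (mat_scale c A1 + mat_scale d B1)"
    and "\<exists>c d. pos_def (mat_scale c A2 + mat_scale d B2)"
    and "qZ (A1, B1) = qZ (A2, B2)"
    and "has_multiple_root (det_cubic (A1, B1)) \<or> has_multiple_root (det_cubic (A2, B2))"
  shows "(\<exists>w\<in>GL3Z. (A1, B1) = pair_act w (mat 1) (A2, B2)) \<or>
    (\<exists>w1\<in>GL3Z. \<exists>w2\<in>GL3Z. \<exists>v\<in>GL2Q.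
       {(A1, B1), (A2, B2)} =
         {pair_act w1 v (tern_form 1 1 0 (-1) 0 0, lin_square (vector [0, 0, 1])),
          pair_act w2 v (tern_form 1 3 0 0 0 0, lin_square (vector [0, 0, 1]))} \<or>
       {(A1, B1), (A2, B2)} =
         {pair_act w1 v (tern_form 1 1 0 (-1) 0 0, lin_square (vector [1, 1, 3])),
          pair_act w2 v (tern_form 1 3 0 0 0 0, lin_square (vector [1, 0, 3]))})"
proof -
  have "equivalent_or_exceptional (A1, B1) (A2, B2)"
    using assms(10)
  proof
    assume "has_multiple_root (det_cubic (A1, B1))"
    thus ?thesis using assms by (intro multiple_root_classification)
  next
    assume "has_multiple_root (det_cubic (A2, B2))"
    hence "equivalent_or_exceptional (A2, B2) (A1, B1)"
      using assms by (intro multiple_root_classification) simp_all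
    thus ?thesis by (rule equivalent_or_exceptional_sym) (simp_all add: assms)
  qed
  thus ?thesis unfolding equivalent_or_exceptional_def .
qed

end
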